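(* For every matroid $M$ without loops or coloops, the derivative at $t=-1$ of Speyer's polynomial $g_M(t)$ is $$g'_M(-1)=(-1)^{c(M)-1}\sum_{A\subseteq M} (-1)^{\ell(A)}\, \beta(A)\, \mathrm{rk}(A).$$
   Context: Matroids are finite. $c(M)$ is the number of connected components of $M$. For a subset $A$ of the ground set, $\mathrm{rk}(A)$ is its rank, $\ell(A)=|A|-\mathrm{rk}(A)$, and $\beta(A)=(-1)^{\mathrm{rk}(A)}\sum_{B\subseteq A}(-1)^{|B|}\,\mathrm{rk}(B)$ is Crapo's invariant of the restriction $M|A$. Speyer's polynomial: the base polytope $P(M)\subset\mathbb{R}^E$ of a matroid $M$ on $E$ is the convex hull of the indicator vectors of the bases of $M$. A function $f$ from matroids to an abelian group is valuative if $\sum_i a_i f(M_i)=0$ whenever $M_i$ are matroids on a common ground set and $a_i\in\mathbb{Z}$ with $\sum_i a_i \mathbf{1}_{P(M_i)}=0$ (as functions on $\mathbb{R}^E$). It is covaluative if $M\mapsto(-1)^{c(M)}f(M)$ is valuative. It is known that there is a unique covaluative isomorphism invariant $M\mapsto g_M(t)\in\mathbb{Z}[t]$ such that: (1) $g_M(t)=0$ if $M$ has a loop or coloop; (2) $g_M(t)=t$ if $M$ is series-parallel, i.e. obtained from the uniform matroid of rank 1 on 2 elements by a sequence of series extensions (subdividing an element) and parallel extensions (adding an element parallel to an existing one); (3) $g_{M_1\oplus M_2}(t)=g_{M_1}(t)\,g_{M_2}(t)$. This $g_M$ is Speyer's polynomial. *)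

theory Defs
  imports
    "HOL-Analysis.Analysis"
    "HOL-Analysis.Finite_Function_Topology"
    "HOL-Computational_Algebra.Polynomial"
begin

section \<open>Finite matroids\<close>

typedef 'a matroid =
  "{(E :: 'a set, \<I> :: 'a set set).
      finite E \<and> \<I> \<subseteq> Pow E \<and> {} \<in> \<I> \<and>
      (\<forall>I J. I \<in> \<I> \<longrightarrow> J \<subseteq> I \<longrightarrow> J \<in> \<I>) \<and>
      (\<forall>I J. I \<in> \<I> \<longrightarrow> J \<in> \<I> \<longrightarrow> card I < card J \<longrightarrow> (\<exists>x \<in> J - I. insert x I \<in> \<I>))}"
  by (rule exI[of _ "({}, {{}})"]) auto

definition ground :: "'a matroid \<Rightarrow> 'a set" where
  "ground M = fst (Rep_matroid M)"

definition indep :: "'a matroid \<Rightarrow> 'a set \<Rightarrow> bool" where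
  "indep M I \<longleftrightarrow> I \<in> snd (Rep_matroid M)"

lemma finite_ground: "finite (ground M)"
  and indep_subset_ground: "indep M I \<Longrightarrow> I \<subseteq> ground M"
  and indep_empty: "indep M {}"
  and indep_mono: "indep M I \<Longrightarrow> J \<subseteq> I \<Longrightarrow> indep M J"
  and indep_augment:
    "indep M I \<Longrightarrow> indep M J \<Longrightarrow> card I < card J \<Longrightarrow> \<exists>x \<in> J - I. indep M (insert x I)"
  using Rep_matroid[of M] unfolding ground_def indep_def by (simp_all add: case_prod_beta) blast+

lemma matroid_eqI:
  assumes "ground M = ground N" and "\<And>A. indep M A \<longleftrightarrow> indep N A"
  shows "M = N"
  using assms unfolding ground_def indep_def
  by (metis Rep_matroid_inject prod.expand set_eqI)

definition basis :: "'a matroid \<Rightarrow> 'a set \<Rightarrow> bool" where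
  "basis M B \<longleftrightarrow> indep M B \<and> (\<forall>I. indep M I \<longrightarrow> B \<subseteq> I \<longrightarrow> I = B)"

definition circuit :: "'a matroid \<Rightarrow> 'a set \<Rightarrow> bool" where
  "circuit M C \<longleftrightarrow> C \<subseteq> ground M \<and> \<not> indep M C \<and> (\<forall>D. D \<subset> C \<longrightarrow> indep M D)"

text \<open>Independence in the dual matroid, whose bases are the complements of the bases of \<open>M\<close>.\<close>
definition coindep :: "'a matroid \<Rightarrow> 'a set \<Rightarrow> bool" where
  "coindep M A \<longleftrightarrow> (\<exists>B. basis M B \<and> A \<subseteq> ground M - B)"

definition cocircuit :: "'a matroid \<Rightarrow> 'a set \<Rightarrow> bool" where
  "cocircuit M C \<longleftrightarrow> C \<subseteq> ground M \<and> \<not> coindep M C \<and> (\<forall>D. D \<subset> C \<longrightarrow> coindep M D)"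

definition loop :: "'a matroid \<Rightarrow> 'a \<Rightarrow> bool" where
  "loop M e \<longleftrightarrow> e \<in> ground M \<and> \<not> indep M {e}"

definition coloop :: "'a matroid \<Rightarrow> 'a \<Rightarrow> bool" where
  "coloop M e \<longleftrightarrow> e \<in> ground M \<and> (\<forall>B. basis M B \<longrightarrow> e \<in> B)"

definition rk :: "'a matroid \<Rightarrow> 'a set \<Rightarrow> nat" where
  "rk M A = Max (card ` {I. I \<subseteq> A \<and> indep M I})"

definition nullity :: "'a matroid \<Rightarrow> 'a set \<Rightarrow> nat" where
  "nullity M A = card A - rk M A"

text \<open>The sum only involves subsets of \<open>A\<close>, on which the rank functions of \<open>M\<close> and of
  the restriction of \<open>M\<close> to \<open>A\<close> agree.\<close>
definition beta :: "'a matroid \<Rightarrow> 'a set \<Rightarrow> int" where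
  "beta M A = (-1) ^ rk M A * (\<Sum>B \<in> Pow A. (-1) ^ card B * int (rk M B))"

definition connected_rel :: "'a matroid \<Rightarrow> ('a \<times> 'a) set" where
  "connected_rel M = {(e, f). e \<in> ground M \<and> f \<in> ground M \<and>
     (e = f \<or> (\<exists>C. circuit M C \<and> e \<in> C \<and> f \<in> C))}"

definition num_components :: "'a matroid \<Rightarrow> nat" where
  "num_components M = card (ground M // connected_rel M)"

definition isomorphic :: "'a matroid \<Rightarrow> 'b matroid \<Rightarrow> bool" where
  "isomorphic M N \<longleftrightarrow> (\<exists>\<phi>. bij_betw \<phi> (ground M) (ground N) \<and>
     (\<forall>A \<subseteq> ground M. indep M A \<longleftrightarrow> indep N (\<phi> ` A)))"

definition is_direct_sum :: "'a matroid \<Rightarrow> 'a matroid \<Rightarrow> 'a matroid \<Rightarrow> bool" where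
  "is_direct_sum M M1 M2 \<longleftrightarrow>
     ground M1 \<inter> ground M2 = {} \<and> ground M = ground M1 \<union> ground M2 \<and>
     (\<forall>A \<subseteq> ground M. indep M A \<longleftrightarrow> indep M1 (A \<inter> ground M1) \<and> indep M2 (A \<inter> ground M2))"


section \<open>Series-parallel matroids\<close>

text \<open>\<open>N\<close> arises from \<open>M\<close> by adding \<open>e\<close> parallel to \<open>f\<close>: deleting \<open>e\<close> from \<open>N\<close> gives \<open>M\<close>,
  and \<open>{e, f}\<close> is a circuit of \<open>N\<close>.\<close>
definition parallel_extension :: "'a matroid \<Rightarrow> 'a matroid \<Rightarrow> bool" where
  "parallel_extension M N \<longleftrightarrow> (\<exists>e f. e \<notin> ground M \<and> f \<in> ground M \<and>
     ground N = insert e (ground M) \<and> circuit N {e, f} \<and>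
     (\<forall>A \<subseteq> ground M. indep M A \<longleftrightarrow> indep N A))"

text \<open>Dually, \<open>N\<close> arises from \<open>M\<close> by subdividing \<open>f\<close> into the series pair \<open>{e, f}\<close>:
  contracting \<open>e\<close> in \<open>N\<close> gives \<open>M\<close>, and \<open>{e, f}\<close> is a cocircuit of \<open>N\<close>. The formula used for
  contraction is the one for a non-loop; \<open>e\<close> is one, as the case \<open>A = {}\<close> shows.\<close>
definition series_extension :: "'a matroid \<Rightarrow> 'a matroid \<Rightarrow> bool" where
  "series_extension M N \<longleftrightarrow> (\<exists>e f. e \<notin> ground M \<and> f \<in> ground M \<and>
     ground N = insert e (ground M) \<and> cocircuit N {e, f} \<and>
     (\<forall>A \<subseteq> ground M. indep M A \<longleftrightarrow> indep N (insert e A)))"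

inductive series_parallel :: "'a matroid \<Rightarrow> bool" where
  uniform_1_2:
    "card (ground M) = 2 \<Longrightarrow> (\<And>A. A \<subseteq> ground M \<Longrightarrow> indep M A \<longleftrightarrow> card A \<le> 1) \<Longrightarrow>
     series_parallel M"
| parallel: "series_parallel M \<Longrightarrow> parallel_extension M N \<Longrightarrow> series_parallel N"
| series: "series_parallel M \<Longrightarrow> series_extension M N \<Longrightarrow> series_parallel N"


section \<open>Valuative functions and Speyer's polynomial\<close>

text \<open>The spaces \<open>\<real>\<^sup>E\<close>, for finite subsets \<open>E\<close> of \<open>'a\<close>, are realised simultaneously as
  subspaces of the real vector space \<open>'a \<Rightarrow>\<^sub>0 real\<close> of finitely supported functions.\<close>
definition indicator_vec :: "'a set \<Rightarrow> 'a \<Rightarrow>\<^sub>0 real" where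
  "indicator_vec B = (\<Sum>e \<in> B. Poly_Mapping.single e 1)"

definition base_polytope :: "'a matroid \<Rightarrow> ('a \<Rightarrow>\<^sub>0 real) set" where
  "base_polytope M = convex hull (indicator_vec ` {B. basis M B})"

text \<open>Since base polytopes of matroids on \<open>E\<close> lie in \<open>\<real>\<^sup>E\<close>, a linear relation between their
  indicator functions holds on \<open>\<real>\<^sup>E\<close> iff it holds on all of \<open>'a \<Rightarrow>\<^sub>0 real\<close>. The values are
  taken in a ring, so that integer multiples can be written with \<open>of_int\<close>.\<close>
definition valuative :: "('a matroid \<Rightarrow> 'b::ring_1) \<Rightarrow> bool" where
  "valuative f \<longleftrightarrow> (\<forall>E (n::nat) (M :: nat \<Rightarrow> 'a matroid) (a :: nat \<Rightarrow> int).
     (\<forall>i<n. ground (M i) = E) \<longrightarrow>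
     (\<forall>x. (\<Sum>i<n. a i * indicator (base_polytope (M i)) x) = 0) \<longrightarrow>
     (\<Sum>i<n. of_int (a i) * f (M i)) = 0)"

definition covaluative :: "('a matroid \<Rightarrow> 'b::ring_1) \<Rightarrow> bool" where
  "covaluative f \<longleftrightarrow> valuative (\<lambda>M. (-1) ^ num_components M * f M)"

text \<open>The properties characterising the assignment of Speyer's polynomial \<open>g\<^sub>M\<close> to a
  matroid \<open>M\<close>. When \<open>'a\<close> is infinite, every finite matroid has an isomorphic copy in
  \<open>'a matroid\<close>, so that \<open>g\<close> amounts to an isomorphism invariant of all finite matroids.\<close>
definition is_speyer_polynomial :: "('a matroid \<Rightarrow> int poly) \<Rightarrow> bool" where
  "is_speyer_polynomial g \<longleftrightarrow>
     covaluative g \<and>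
     (\<forall>M N. isomorphic M N \<longrightarrow> g M = g N) \<and>
     (\<forall>M. (\<exists>e. loop M e \<or> coloop M e) \<longrightarrow> g M = 0) \<and>
     (\<forall>M. series_parallel M \<longrightarrow> g M = [:0, 1:]) \<and>
     (\<forall>M M1 M2. is_direct_sum M M1 M2 \<longrightarrow> g M = g M1 * g M2)"

end

theory Submission
  imports Defs
begin

text \<open>
  Write \<open>S(M)\<close> for the sum over all \<open>B \<subseteq> A \<subseteq> E\<close> of \<open>(-1)\<^sup>|\<^sup>A\<^sup>|\<^sup>+\<^sup>|\<^sup>B\<^sup>| rk(A) rk(B)\<close>; expanding \<open>\<beta>(A)\<close> shows that
  it is the sum in the theorem. Put \<open>u(M) = (-1)\<^sup>c g\<^sub>M(-1)\<close> and \<open>v(M) = (-1)\<^sup>c g'\<^sub>M(-1)\<close>, where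
  \<open>c = c(M)\<close>. The proof shows \<open>u(M) = 1\<close> and \<open>v(M) = -S(M)\<close> simultaneously for nonempty \<open>M\<close> without
  loops and coloops. The first identity is needed for direct sums: it turns the product
  rule \<open>v(M\<^sub>1 \<oplus> M\<^sub>2) = v(M\<^sub>1) u(M\<^sub>2) + u(M\<^sub>1) v(M\<^sub>2)\<close> into additivity of \<open>v\<close>, and \<open>S\<close> is additive too.

  All four functions \<open>u\<close>, \<open>1\<close>, \<open>v\<close>, \<open>S\<close> are valuative. For \<open>u\<close> and \<open>v\<close> this is the covaluativity
  of \<open>g\<close>. The other two are integer combinations of conditions of the form ``\<open>rk(A) \<ge> j\<close> and
  \<open>rk(B) \<ge> k\<close>'' with \<open>B \<subseteq> A\<close>. Since nested sets have a common optimal basis, such a condition says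
  that the base polytope meets an intersection \<open>H\<close> of half-spaces, that is, that \<open>P(M) \<inter> H\<close> has
  Euler characteristic \<open>1\<close> instead of \<open>0\<close>; and the Euler characteristic of compact convex sets
  respects linear relations between indicator functions (\<open>sum_nonempty_compact_convex_eq_0\<close>).

  So it suffices to express the indicator function of \<open>P(M)\<close> by those of simpler polytopes, never
  leaving the matroids without loops and coloops: on all others \<open>g\<close> vanishes and \<open>u \<noteq> 1\<close>.

  \<^item> By Edmonds' description (\<open>base_polytope_eq_rank_polytope\<close>), \<open>P(M)\<close> is cut out by the inequalities
    \<open>x(F) \<le> rk(F)\<close>. If some of them are violated by \<open>x\<close>, the violated ones form a poset
    with contractible order complex, so that an inclusion-exclusion over chains reduces to the
    polytopes defined by the inequalities of a single chain. These belong to nested matroids, whose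
    bases include those of \<open>M\<close> and which therefore have neither loops nor coloops
    (\<open>valuative_eq_if_eq_on_interval_matroids\<close>).

  \<^item> A nested matroid is a lattice path matroid: its bases correspond to the lattice paths between
    two bounding paths \<open>l \<le> u\<close>. If \<open>l\<close> and \<open>u\<close> are at distance at least \<open>2\<close> somewhere, a hyperplane
    cuts the polytope into two polytopes of the same kind meeting in a third (\<open>valuative_cut\<close>). If
    \<open>l\<close> and \<open>u\<close> touch, the matroid is a direct sum (\<open>interval_matroid_append\<close>).

  \<^item> What remains are the paths that stay at distance exactly \<open>1\<close> between their common end points.
    Their matroids are series-parallel (\<open>snake_series_parallel\<close>), so that \<open>g = t\<close>, \<open>c = 1\<close>, and \<open>S = 1\<close>
    because \<open>S\<close> does not change under series and parallel extensions
    (\<open>series_parallel_invariants\<close>).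
\<close>

section \<open>Rank, bases and greedy chains\<close>

lemma finite_indep: "indep M I \<Longrightarrow> finite I"
  using indep_subset_ground finite_ground finite_subset by blast

lemma card_indep_le_rk:
  assumes "indep M I" "I \<subseteq> A" shows "card I \<le> rk M A"
proof -
  have "finite {I. I \<subseteq> A \<and> indep M I}"
    by (rule finite_subset[of _ "Pow (ground M)"]) (use indep_subset_ground finite_ground in auto)
  then show ?thesis unfolding rk_def using assms by (intro Max_ge) auto
qed

lemma rk_witness: obtains I where "I \<subseteq> A" "indep M I" "card I = rk M A"
proof -
  have "finite {I. I \<subseteq> A \<and> indep M I}"
    by (rule finite_subset[of _ "Pow (ground M)"]) (use indep_subset_ground finite_ground in auto)
  then have "rk M A \<in> card ` {I. I \<subseteq> A \<and> indep M I}"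
    unfolding rk_def using indep_empty by (intro Max_in) auto
  then show ?thesis using that by auto
qed

lemma rk_le:
  assumes "\<And>I. I \<subseteq> A \<Longrightarrow> indep M I \<Longrightarrow> card I \<le> m" shows "rk M A \<le> m"
proof -
  obtain I where "I \<subseteq> A" "indep M I" "card I = rk M A" by (rule rk_witness)
  then show ?thesis using assms by metis
qed

lemma rk_mono: "A \<subseteq> B \<Longrightarrow> rk M A \<le> rk M B"
  by (meson card_indep_le_rk rk_le order_trans)

lemma rk_le_card: "finite A \<Longrightarrow> rk M A \<le> card A"
  by (meson card_mono rk_le)

lemma rk_empty [simp]: "rk M {} = 0"
  using rk_le_card[of "{}" M] by simp

lemma rk_indep: "indep M I \<Longrightarrow> rk M I = card I"
  by (meson card_indep_le_rk antisym finite_indep order_refl rk_le_card)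

lemma indep_extend_rk:
  assumes "indep M I" "I \<subseteq> A"
  obtains J where "I \<subseteq> J" "J \<subseteq> A" "indep M J" "card J = rk M A"
proof -
  have "\<exists>J. I \<subseteq> J \<and> J \<subseteq> A \<and> indep M J \<and> card J = rk M A"
    using assms
  proof (induction "rk M A - card I" arbitrary: I rule: less_induct)
    case less
    show ?case
    proof (cases "card I = rk M A")
      case True then show ?thesis using less by blast
    next
      case False
      then have lt: "card I < rk M A" using card_indep_le_rk[OF less.prems] by simp
      obtain K where K: "K \<subseteq> A" "indep M K" "card K = rk M A" by (rule rk_witness)
      then obtain x where x: "x \<in> K - I" "indep M (insert x I)"
        using indep_augment[OF less.prems(1) K(2)] lt by auto
      have "card (insert x I) = Suc (card I)"
        using x finite_indep[OF less.prems(1)] by simp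
      then have "rk M A - card (insert x I) < rk M A - card I" using lt by simp
      from less.hyps[OF this x(2)] show ?thesis using x K less.prems by blast
    qed
  qed
  then show ?thesis using that by blast
qed

lemma basis_iff: "basis M B \<longleftrightarrow> indep M B \<and> card B = rk M (ground M)"
proof
  assume B: "basis M B"
  then have i: "indep M B" by (simp add: basis_def)
  obtain J where "B \<subseteq> J" "indep M J" "card J = rk M (ground M)"
    by (rule indep_extend_rk[OF i indep_subset_ground[OF i]])
  then show "indep M B \<and> card B = rk M (ground M)" using B i by (auto simp: basis_def)
next
  assume *: "indep M B \<and> card B = rk M (ground M)"
  show "basis M B" unfolding basis_def
  proof (intro conjI allI impI)
    fix I assume I: "indep M I" "B \<subseteq> I"
    then have "card I \<le> rk M (ground M)" using card_indep_le_rk indep_subset_ground by blast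
    then show "I = B" using * I finite_indep by (metis card_seteq)
  qed (use * in auto)
qed

lemma basis_subset_ground: "basis M B \<Longrightarrow> B \<subseteq> ground M"
  using indep_subset_ground by (auto simp: basis_def)

lemma finite_basis: "basis M B \<Longrightarrow> finite B"
  using finite_indep by (auto simp: basis_def)

lemma indep_extend_basis:
  assumes "indep M I" obtains B where "I \<subseteq> B" "basis M B"
  by (rule indep_extend_rk[OF assms indep_subset_ground[OF assms]]) (auto intro: that simp: basis_iff)

lemma basis_exists: obtains B where "basis M B"
  by (rule indep_extend_basis[OF indep_empty]) (rule that)

lemma rk_indep_subset_Int:
  assumes "indep M J" shows "card (J \<inter> A) \<le> rk M A"
  using assms by (intro card_indep_le_rk) (auto intro: indep_mono)

lemma rk_eq_card_basis_Int:
  assumes "basis M B" "I \<subseteq> B" "I \<subseteq> A" "card I = rk M A"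
  shows "card (B \<inter> A) = rk M A"
proof (rule antisym)
  show "card (B \<inter> A) \<le> rk M A" using assms rk_indep_subset_Int by (auto simp: basis_def)
  have "I \<subseteq> B \<inter> A" using assms by auto
  then show "rk M A \<le> card (B \<inter> A)" using assms finite_basis by (metis card_mono finite_Int)
qed

lemma rk_submodular: "rk M (A \<union> B) + rk M (A \<inter> B) \<le> rk M A + rk M B"
proof -
  obtain I where I: "I \<subseteq> A \<inter> B" "indep M I" "card I = rk M (A \<inter> B)" by (rule rk_witness)
  obtain J where J: "I \<subseteq> J" "J \<subseteq> A \<union> B" "indep M J" "card J = rk M (A \<union> B)"
    by (rule indep_extend_rk[OF I(2), of "A \<union> B"]) (use I(1) in auto)
  have fin: "finite J" using J finite_indep by blast
  have "card J + card I \<le> card ((J \<inter> A) \<union> (J \<inter> B)) + card ((J \<inter> A) \<inter> (J \<inter> B))"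
  proof (rule add_mono)
    show "card J \<le> card ((J \<inter> A) \<union> (J \<inter> B))" using J(2) fin by (intro card_mono) auto
    show "card I \<le> card ((J \<inter> A) \<inter> (J \<inter> B))" using I(1) J(1) fin by (intro card_mono) auto
  qed
  also have "\<dots> = card (J \<inter> A) + card (J \<inter> B)" using fin by (intro card_Un_Int[symmetric]) auto
  also have "\<dots> \<le> rk M A + rk M B"
    using rk_indep_subset_Int[OF J(3)] by (intro add_mono) auto
  finally show ?thesis using I J by simp
qed

lemma rk_insert_le: "rk M (insert e A) \<le> Suc (rk M A)"
proof -
  have "rk M (A \<union> {e}) \<le> rk M A + rk M {e}" using rk_submodular[of M A "{e}"] by linarith
  then show ?thesis using rk_le_card[of "{e}" M] by simp
qed

text \<open>Independent sets can be grown greedily along any increasing sequence of sets.\<close>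
lemma chain_adapted_basis:
  assumes "\<And>i. i < n \<Longrightarrow> A i \<subseteq> A (Suc i)"
  obtains B where "basis M B" "\<And>i. i \<le> n \<Longrightarrow> card (B \<inter> A i) = rk M (A i)"
proof -
  have "\<exists>I. indep M I \<and> I \<subseteq> A n \<and> (\<forall>i\<le>n. card (I \<inter> A i) = rk M (A i))" using assms
  proof (induction n)
    case 0
    obtain I where "I \<subseteq> A 0" "indep M I" "card I = rk M (A 0)" by (rule rk_witness)
    then show ?case by (intro exI[of _ I]) (auto simp: inf.absorb1)
  next
    case (Suc n)
    then obtain I where I: "indep M I" "I \<subseteq> A n" "\<forall>i\<le>n. card (I \<inter> A i) = rk M (A i)" by auto
    obtain J where J: "I \<subseteq> J" "J \<subseteq> A (Suc n)" "indep M J" "card J = rk M (A (Suc n))"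
      by (rule indep_extend_rk[OF I(1), of "A (Suc n)"]) (use I(2) Suc.prems[of n] in auto)
    have "card (J \<inter> A i) = rk M (A i)" if "i \<le> Suc n" for i
    proof (cases "i = Suc n")
      case True then show ?thesis using J by (simp add: inf.absorb1)
    next
      case False
      then have "card (I \<inter> A i) = rk M (A i)" using I that by simp
      moreover have "card (I \<inter> A i) \<le> card (J \<inter> A i)"
        using J finite_indep[OF J(3)] by (intro card_mono) auto
      ultimately show ?thesis using rk_indep_subset_Int[OF J(3), of "A i"] by simp
    qed
    then show ?case using J by blast
  qed
  then obtain I where I: "indep M I" "\<forall>i\<le>n. card (I \<inter> A i) = rk M (A i)" by auto
  obtain B where B: "I \<subseteq> B" "basis M B" by (rule indep_extend_basis[OF I(1)])
  have "card (B \<inter> A i) = rk M (A i)" if "i \<le> n" for i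
    using rk_eq_card_basis_Int[of M B "I \<inter> A i" "A i"] B I that by auto
  then show ?thesis using that B by blast
qed

section \<open>The base polytope is cut out by the rank inequalities\<close>

abbreviation coord :: "('a \<Rightarrow>\<^sub>0 'b::zero) \<Rightarrow> 'a \<Rightarrow> 'b" where
  "coord \<equiv> Poly_Mapping.lookup"

abbreviation mass :: "('a \<Rightarrow>\<^sub>0 real) \<Rightarrow> 'a set \<Rightarrow> real" where
  "mass x A \<equiv> \<Sum>e\<in>A. coord x e"

lemma lookup_scaleR [simp]: "coord (c *\<^sub>R x) e = c *\<^sub>R coord x e"
  for x :: "'a \<Rightarrow>\<^sub>0 'b::real_vector"
proof -
  have "finite {e. c *\<^sub>R coord x e \<noteq> 0}"
    by (rule finite_subset[OF _ finite_lookup[of x]]) auto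
  then show ?thesis by (simp add: scaleR_poly_mapping_def)
qed

lemma bounded_linear_lookup: "bounded_linear (\<lambda>x::'a \<Rightarrow>\<^sub>0 real. coord x e)"
proof (rule bounded_linear_intro[where K = 1])
  fix x :: "'a \<Rightarrow>\<^sub>0 real"
  have "norm (coord x e) \<le> (\<Sum>n\<in>Poly_Mapping.keys x. norm (coord x n))"
  proof (cases "e \<in> Poly_Mapping.keys x")
    case True then show ?thesis by (intro member_le_sum) auto
  next
    case False then show ?thesis by (simp add: in_keys_iff sum_nonneg)
  qed
  then show "norm (coord x e) \<le> norm x * 1"
    by (simp add: norm_poly_mapping_def dist_poly_mapping_def)
qed (auto simp: lookup_add)

lemma continuous_on_lookup [continuous_intros]:
  "continuous_on S (\<lambda>x::'a \<Rightarrow>\<^sub>0 real. coord x e)"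
  by (rule bounded_linear.continuous_on[OF bounded_linear_lookup continuous_on_id])

lemma convex_mass_vimage: "convex S \<Longrightarrow> convex {x. mass x A \<in> S}"
proof -
  have "linear (\<lambda>x. mass x A)"
    by (intro linearI) (simp_all add: lookup_add sum.distrib sum_distrib_left)
  then show "convex S \<Longrightarrow> convex {x. mass x A \<in> S}"
    using convex_linear_vimage[of "\<lambda>x. mass x A" S] by (simp add: vimage_def)
qed

lemma lookup_indicator_vec:
  assumes "finite B"
  shows "coord (indicator_vec B) e = indicator B e"
proof -
  have "coord (indicator_vec B) e
      = (\<Sum>b\<in>B. coord (Poly_Mapping.single b 1) e)"
    unfolding indicator_vec_def by (simp add: lookup_sum)
  also have "\<dots> = (\<Sum>b\<in>B. if b = e then 1 else 0)"
    by (intro sum.cong) (auto simp: lookup_single when_def)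
  also have "\<dots> = indicator B e" using assms by (simp add: indicator_def)
  finally show ?thesis .
qed

lemma mass_indicator_vec:
  assumes "finite B" "finite A" shows "mass (indicator_vec B) A = card (B \<inter> A)"
proof -
  have "mass (indicator_vec B) A = (\<Sum>e\<in>A. indicator B e)"
    using assms by (intro sum.cong) (auto simp: lookup_indicator_vec)
  also have "\<dots> = card (B \<inter> A)"
    using sum.inter_restrict[OF assms(2), of "\<lambda>_. 1::real" B]
    by (simp add: Int_commute indicator_def of_bool_def)
  finally show ?thesis .
qed

lemma finite_bases: "finite {B. basis M B}"
  by (rule finite_subset[of _ "Pow (ground M)"]) (use basis_subset_ground finite_ground in auto)

lemma compact_base_polytope: "compact (base_polytope M)"
  unfolding base_polytope_def by (intro finite_imp_compact_convex_hull finite_imageI finite_bases)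

lemma convex_base_polytope: "convex (base_polytope M)"
  unfolding base_polytope_def by (rule convex_convex_hull)

lemma basis_in_base_polytope: "basis M B \<Longrightarrow> indicator_vec B \<in> base_polytope M"
  unfolding base_polytope_def by (auto intro: hull_inc)

definition rank_polytope :: "'a matroid \<Rightarrow> ('a \<Rightarrow>\<^sub>0 real) set" where
  "rank_polytope M = {x. (\<forall>e. 0 \<le> coord x e) \<and>
     (\<forall>e. e \<notin> ground M \<longrightarrow> coord x e = 0) \<and>
     mass x (ground M) = rk M (ground M) \<and> (\<forall>A\<subseteq>ground M. mass x A \<le> rk M A)}"

lemma convex_rank_polytope: "convex (rank_polytope M)"
proof -
  have "rank_polytope M = (\<Inter>e. {x. mass x {e} \<in> {0..}}) \<inter> (\<Inter>e\<in>- ground M. {x. mass x {e} \<in> {0}}) \<inter>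
      {x. mass x (ground M) \<in> {real (rk M (ground M))}} \<inter>
      (\<Inter>A\<in>Pow (ground M). {x. mass x A \<in> {..real (rk M A)}})"
    by (auto simp: rank_polytope_def)
  then show ?thesis
    by (simp only:) (intro convex_Int convex_INT convex_mass_vimage convex_singleton convex_real_interval)
qed

lemma sum_times_indicator:
  fixes w :: "'a \<Rightarrow> real"
  assumes "finite A" "B \<subseteq> A" shows "(\<Sum>e\<in>A. w e * indicator B e) = sum w B"
  using assms by (intro sum.mono_neutral_cong_right) (auto simp: indicator_def)

text \<open>Abel summation: decreasing weights can only increase a sum with nonnegative partial sums.\<close>
lemma abel_summation_ge:
  fixes w d :: "nat \<Rightarrow> real"
  assumes "\<And>k. k \<le> Suc n \<Longrightarrow> 0 \<le> (\<Sum>i<k. d i)" "\<And>i. i < n \<Longrightarrow> w (Suc i) \<le> w i"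
  shows "w n * (\<Sum>i<Suc n. d i) \<le> (\<Sum>i<Suc n. w i * d i)"
  using assms
proof (induction n)
  case (Suc n)
  have "w (Suc n) * (\<Sum>i<Suc n. d i) \<le> w n * (\<Sum>i<Suc n. d i)"
    using Suc.prems(1)[of "Suc n"] Suc.prems(2) by (intro mult_right_mono) simp_all
  also have "\<dots> \<le> (\<Sum>i<Suc n. w i * d i)"
    using Suc.prems(1)[OF le_SucI] Suc.prems(2) by (intro Suc.IH) (simp_all del: sum.lessThan_Suc)
  finally show ?case by (simp add: algebra_simps)
qed simp

text \<open>A linear functional is maximised over the points satisfying the rank inequalities by a
  greedy basis: write the functional as a nonnegative combination of the masses of the initial
  segments of an ordering of the ground set by decreasing weight (Abel summation).\<close>
lemma greedy_maximises:
  fixes w :: "'a \<Rightarrow> real"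
  assumes x: "x \<in> rank_polytope M"
  obtains B where "basis M B" "(\<Sum>e\<in>ground M. w e * coord x e) \<le> sum w B"
proof -
  obtain ys where ys: "set ys = ground M" "distinct ys"
    using finite_distinct_list[OF finite_ground] by metis
  define xs where "xs = sort_key (\<lambda>e. - w e) ys"
  have xs: "set xs = ground M" "distinct xs" using ys by (auto simp: xs_def)
  have "sorted (map (\<lambda>e. - w e) xs)" by (simp add: xs_def)
  then have decr: "w (xs ! Suc i) \<le> w (xs ! i)" if "Suc i < length xs" for i
    using that by (auto simp: sorted_iff_nth_Suc)
  define A where "A i = (!) xs ` {..<i}" for i
  have inj: "inj_on ((!) xs) {..<i}" if "i \<le> length xs" for i
    using xs(2) that by (intro inj_on_nth) auto
  have sumA: "sum h (A i) = (\<Sum>j<i. h (xs ! j))" if "i \<le> length xs" for h :: "'a \<Rightarrow> real" and i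
    unfolding A_def using inj[OF that] by (simp add: sum.reindex)
  have A_top: "A (length xs) = ground M"
    unfolding A_def using xs(1) by (metis nth_image order_refl take_all lessThan_atLeast0)
  have A_sub: "A i \<subseteq> ground M" if "i \<le> length xs" for i
    using A_top that by (force simp: A_def)
  have "A i \<subseteq> A (Suc i)" for i by (auto simp: A_def)
  then obtain B where B: "basis M B" "\<And>i. i \<le> length xs \<Longrightarrow> card (B \<inter> A i) = rk M (A i)"
    using chain_adapted_basis[of "length xs" A M] by auto
  have finB: "finite B" using finite_basis B by blast
  have finA: "finite (A i)" for i by (simp add: A_def)
  define d where "d i = indicator B (xs ! i) - coord x (xs ! i)" for i
  have part: "(\<Sum>i<k. d i) = rk M (A k) - mass x (A k)" if "k \<le> length xs" for k
  proof -
    have "(\<Sum>i<k. d i) = (\<Sum>e\<in>A k. indicator B e - coord x e)"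
      using sumA[OF that, of "\<lambda>e. indicator B e - coord x e"] by (simp add: d_def)
    also have "\<dots> = mass (indicator_vec B) (A k) - mass x (A k)"
      by (simp add: sum_subtractf lookup_indicator_vec finB)
    finally show ?thesis using mass_indicator_vec[OF finB finA] B(2)[OF that] by simp
  qed
  have nonneg: "0 \<le> (\<Sum>i<k. d i)" if "k \<le> length xs" for k
    using part[OF that] x A_sub[OF that] by (simp add: rank_polytope_def)
  have total: "(\<Sum>i<length xs. d i) = 0"
    using part[of "length xs"] x by (simp add: rank_polytope_def A_top)
  have "0 \<le> (\<Sum>i<length xs. w (xs ! i) * d i)"
  proof (cases "length xs")
    case (Suc n)
    have "w (xs ! n) * (\<Sum>i<Suc n. d i) \<le> (\<Sum>i<Suc n. w (xs ! i) * d i)"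
      using nonneg decr Suc by (intro abel_summation_ge) auto
    then show ?thesis using total Suc by simp
  qed simp
  also have "\<dots> = (\<Sum>e\<in>ground M. w e * (indicator B e - coord x e))"
    using sumA[of "length xs" "\<lambda>e. w e * (indicator B e - coord x e)"]
    by (simp add: d_def A_top)
  also have "\<dots> = (\<Sum>e\<in>ground M. w e * indicator B e)
      - (\<Sum>e\<in>ground M. w e * coord x e)"
    by (simp add: right_diff_distrib sum_subtractf)
  also have "(\<Sum>e\<in>ground M. w e * indicator B e) = sum w B"
    by (rule sum_times_indicator[OF finite_ground basis_subset_ground[OF B(1)]])
  finally show ?thesis using that[OF B(1)] by simp
qed

lemma basis_in_rank_polytope:
  assumes "basis M B" shows "indicator_vec B \<in> rank_polytope M"
proof -
  have B: "indep M B" "B \<subseteq> ground M" "finite B" "card B = rk M (ground M)"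
    using assms basis_subset_ground[OF assms] finite_basis[OF assms] by (auto simp: basis_iff)
  have "mass (indicator_vec B) A \<le> rk M A" if "A \<subseteq> ground M" for A
    using rk_indep_subset_Int[OF B(1)] finite_subset[OF that finite_ground] B(3)
    by (simp add: mass_indicator_vec)
  moreover have "mass (indicator_vec B) (ground M) = rk M (ground M)"
    using B by (simp add: mass_indicator_vec finite_ground inf.absorb1)
  moreover have "coord (indicator_vec B) e = 0" if "e \<notin> ground M" for e
    using B that by (auto simp: lookup_indicator_vec indicator_def)
  moreover have "0 \<le> coord (indicator_vec B) e" for e
    using B by (simp add: lookup_indicator_vec)
  ultimately show ?thesis by (simp add: rank_polytope_def)
qed

text \<open>For the nontrivial inclusion, separate a point of the right-hand side from the base polytope
  by the functional pointing away from its nearest point in the polytope; a greedy basis would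
  violate the separation.\<close>
theorem base_polytope_eq_rank_polytope: "base_polytope M = rank_polytope M"
proof
  show sub: "base_polytope M \<subseteq> rank_polytope M"
    unfolding base_polytope_def
    by (intro hull_minimal) (auto simp: basis_in_rank_polytope convex_rank_polytope)
  show "rank_polytope M \<subseteq> base_polytope M"
  proof
    fix x assume x: "x \<in> rank_polytope M"
    define q where "q z = (\<Sum>e\<in>ground M. (coord x e - coord z e)\<^sup>2)" for z
    have "base_polytope M \<noteq> {}" using basis_exists basis_in_base_polytope by (metis empty_iff)
    moreover have "continuous_on (base_polytope M) q"
      unfolding q_def by (intro continuous_intros)
    ultimately obtain z where z: "z \<in> base_polytope M" "\<And>y. y \<in> base_polytope M \<Longrightarrow> q z \<le> q y"
      using continuous_attains_inf[OF compact_base_polytope] by blast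
    \<comment> \<open>\<open>z\<close> is the point of the polytope nearest to \<open>x\<close>, and \<open>w\<close> points from \<open>z\<close> to \<open>x\<close>.\<close>
    define w where "w e = coord x e - coord z e" for e
    obtain B where B: "basis M B" "(\<Sum>e\<in>ground M. w e * coord x e) \<le> sum w B"
      using greedy_maximises[OF x] by blast
    define p where "p = (indicator_vec B :: 'a \<Rightarrow>\<^sub>0 real)"
    define v where "v e = coord p e - coord z e" for e
    define a where "a = (\<Sum>e\<in>ground M. w e * v e)"
    define b where "b = (\<Sum>e\<in>ground M. (v e)\<^sup>2)"
    have bpos: "b \<ge> 0" by (simp add: b_def sum_nonneg)
    have step: "2 * s * a \<le> s\<^sup>2 * b" if s: "0 \<le> s" "s \<le> 1" for s
    proof -
      let ?y = "(1 - s) *\<^sub>R z + s *\<^sub>R p"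
      have "?y \<in> base_polytope M"
        using convexD[OF convex_base_polytope z(1), of p "1 - s" s] s basis_in_base_polytope[OF B(1)]
        by (simp add: p_def)
      then have "q z \<le> q ?y" by (rule z(2))
      also have "q ?y = (\<Sum>e\<in>ground M. (w e)\<^sup>2 - 2 * s * (w e * v e) + s\<^sup>2 * (v e)\<^sup>2)"
        unfolding q_def
      proof (intro sum.cong refl)
        fix e
        have "coord ?y e = coord z e + s * v e"
          by (simp add: lookup_add v_def algebra_simps del: scaleR_left_diff_distrib)
        then have *: "coord x e - coord ?y e = w e - s * v e"
          by (simp add: w_def)
        show "(coord x e - coord ?y e)\<^sup>2
            = (w e)\<^sup>2 - 2 * s * (w e * v e) + s\<^sup>2 * (v e)\<^sup>2"
          unfolding * by (simp add: power2_eq_square algebra_simps)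
      qed
      also have "\<dots> = q z - 2 * s * a + s\<^sup>2 * b"
        by (simp add: sum.distrib sum_subtractf q_def w_def[symmetric] a_def b_def sum_distrib_left)
      finally show ?thesis by simp
    qed
    have a_le: "a \<le> 0"
    proof (rule ccontr)
      assume "\<not> a \<le> 0"
      then have a: "a > 0" by simp
      \<comment> \<open>so short a step towards \<open>p\<close> that the quadratic term cannot make up for the linear gain\<close>
      define s where "s = min 1 (a / (b + 1))"
      have s: "0 < s" "s \<le> 1" using a bpos by (auto simp: s_def)
      have "s * b \<le> a / (b + 1) * b" using bpos by (intro mult_right_mono) (auto simp: s_def)
      also have "\<dots> \<le> a" using a bpos by (simp add: field_simps)
      finally have "s * (s * b) \<le> s * a" using s by (intro mult_left_mono) auto
      then show False using step[of s] s a mult_pos_pos[OF s(1) a] by (simp add: power2_eq_square)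
    qed
    have fin: "finite (ground M)" by (rule finite_ground)
    have "sum w B = (\<Sum>e\<in>ground M. w e * coord p e)"
      using sum_times_indicator[OF fin basis_subset_ground[OF B(1)], of w] finite_basis[OF B(1)]
      by (simp only: p_def lookup_indicator_vec)
    moreover have "a = (\<Sum>e\<in>ground M. w e * coord p e)
        - (\<Sum>e\<in>ground M. w e * coord z e)"
      by (simp add: a_def v_def right_diff_distrib sum_subtractf)
    moreover have "(\<Sum>e\<in>ground M. (w e)\<^sup>2) = (\<Sum>e\<in>ground M. w e * coord x e)
        - (\<Sum>e\<in>ground M. w e * coord z e)"
      by (simp add: w_def power2_eq_square right_diff_distrib flip: sum_subtractf)
    ultimately have "(\<Sum>e\<in>ground M. (w e)\<^sup>2) \<le> a" using B(2) by linarith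
    then have "(\<Sum>e\<in>ground M. (w e)\<^sup>2) = 0"
      using a_le by (intro antisym sum_nonneg) auto
    then have "w e = 0" if "e \<in> ground M" for e
      using that fin by (simp add: sum_nonneg_eq_0_iff)
    moreover have "w e = 0" if "e \<notin> ground M" for e
      using that x z(1) sub by (auto simp: w_def rank_polytope_def)
    ultimately have "x = z" by (intro poly_mapping_eqI) (auto simp: w_def)
    then show "x \<in> base_polytope M" using z by simp
  qed
qed

section \<open>Euler characteristic and valuative rank functions\<close>

text \<open>The Euler characteristic of a compact interval is 1, and it can be read off from the
  indicator function by summing its downward jumps.\<close>
lemma sum_nonempty_intervals_eq_0:
  fixes a :: "'i \<Rightarrow> int" and J :: "'i \<Rightarrow> real set"
  assumes fin: "finite I"
    and J: "\<And>i. i \<in> I \<Longrightarrow> \<exists>p q. J i = {p..q}"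
    and rel: "\<And>t. (\<Sum>i\<in>I. a i * of_bool (t \<in> J i)) = 0"
  shows "(\<Sum>i\<in>I. a i * of_bool (J i \<noteq> {})) = 0"
proof -
  obtain p q where pq: "\<And>i. i \<in> I \<Longrightarrow> J i = {p i..q i}" using J by metis
  define K where "K = {i \<in> I. p i \<le> q i}"
  have finK: "finite K" and KI: "K \<subseteq> I" using fin by (auto simp: K_def)
  have relK: "(\<Sum>i\<in>K. a i * of_bool (p i \<le> t \<and> t \<le> q i)) = 0" for t
  proof -
    have "(\<Sum>i\<in>K. a i * of_bool (p i \<le> t \<and> t \<le> q i)) = (\<Sum>i\<in>I. a i * of_bool (t \<in> J i))"
      using fin by (intro sum.mono_neutral_cong_left) (auto simp: K_def pq)
    then show ?thesis using rel by simp
  qed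
  have jump: "(\<Sum>i\<in>{i \<in> K. q i = c}. a i) = 0" for c
  proof -
    \<comment> \<open>Compare the values at \<open>c\<close> and at a point \<open>s\<close> right of \<open>c\<close> with no end point in between.\<close>
    have "eventually (\<lambda>s. \<forall>i\<in>K. (c < p i \<longrightarrow> s < p i) \<and> (c < q i \<longrightarrow> s < q i)) (at_right c)"
    proof (intro eventually_ball_finite finK ballI eventually_conj)
      fix i
      show "eventually (\<lambda>s. c < p i \<longrightarrow> s < p i) (at_right c)"
        by (cases "c < p i") (auto intro: eventually_at_rightI[of c "p i"])
      show "eventually (\<lambda>s. c < q i \<longrightarrow> s < q i) (at_right c)"
        by (cases "c < q i") (auto intro: eventually_at_rightI[of c "q i"])
    qed
    then have "eventually (\<lambda>s. c < s \<and> (\<forall>i\<in>K. (c < p i \<longrightarrow> s < p i) \<and> (c < q i \<longrightarrow> s < q i))) (at_right c)"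
      using eventually_at_right_less[of c] by (rule eventually_conj[rotated])
    then obtain s where s: "c < s" "\<And>i. i \<in> K \<Longrightarrow> c < p i \<Longrightarrow> s < p i"
        "\<And>i. i \<in> K \<Longrightarrow> c < q i \<Longrightarrow> s < q i"
      using eventually_happens'[OF trivial_limit_at_right_real] by blast
    have "(\<Sum>i\<in>{i \<in> K. q i = c}. a i) = (\<Sum>i\<in>K. a i * of_bool (q i = c))"
      using finK by (intro sum.mono_neutral_cong_left) auto
    also have "\<dots> = (\<Sum>i\<in>K. a i * of_bool (p i \<le> c \<and> c \<le> q i) - a i * of_bool (p i \<le> s \<and> s \<le> q i))"
    proof (intro sum.cong refl)
      fix i assume i: "i \<in> K"
      then have "p i \<le> q i" by (simp add: K_def)
      then have "of_bool (q i = c) = (of_bool (p i \<le> c \<and> c \<le> q i) - of_bool (p i \<le> s \<and> s \<le> q i) :: int)"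
        using s(1) s(2)[OF i] s(3)[OF i] by (cases "q i = c"; cases "c < q i"; cases "c < p i") auto
      then show "a i * of_bool (q i = c)
          = a i * of_bool (p i \<le> c \<and> c \<le> q i) - a i * of_bool (p i \<le> s \<and> s \<le> q i)"
        by (simp add: right_diff_distrib)
    qed
    also have "\<dots> = 0" using relK by (simp add: sum_subtractf)
    finally show ?thesis .
  qed
  have "(\<Sum>i\<in>I. a i * of_bool (J i \<noteq> {})) = (\<Sum>i\<in>K. a i)"
    using fin by (intro sum.mono_neutral_cong_right) (auto simp: K_def pq)
  also have "\<dots> = (\<Sum>c\<in>q ` K. \<Sum>i\<in>{i \<in> K. q i = c}. a i)" by (rule sum.image_gen[OF finK])
  also have "\<dots> = 0" by (simp add: jump)
  finally show ?thesis .
qed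

text \<open>Linear relations between indicator functions survive the projection along one coordinate,
  because the fibres are compact intervals; projecting along all coordinates in turn gives the
  relation between the Euler characteristics.\<close>
lemma sum_nonempty_compact_convex_eq_0:
  fixes a :: "'i \<Rightarrow> int" and K :: "'i \<Rightarrow> ('a \<Rightarrow>\<^sub>0 real) set"
  assumes fin: "finite I" "finite E"
    and K: "\<And>i. i \<in> I \<Longrightarrow> compact (K i)" "\<And>i. i \<in> I \<Longrightarrow> convex (K i)"
    and supp: "\<And>i x e. i \<in> I \<Longrightarrow> x \<in> K i \<Longrightarrow> e \<notin> E \<Longrightarrow> coord x e = 0"
    and rel: "\<And>x. (\<Sum>i\<in>I. a i * of_bool (x \<in> K i)) = 0"
  shows "(\<Sum>i\<in>I. a i * of_bool (K i \<noteq> {})) = 0"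
proof -
  have "(\<Sum>i\<in>I. a i * of_bool
      (\<exists>x\<in>K i. \<forall>e. e \<notin> F \<longrightarrow> coord x e = coord y e)) = 0"
    if "finite F" for F y
    using that
  proof (induction F arbitrary: y)
    case empty
    have "(\<exists>x\<in>K i. \<forall>e. e \<notin> {} \<longrightarrow> coord x e = coord y e) \<longleftrightarrow> y \<in> K i" for i
      using poly_mapping_eqI by auto
    then show ?case using rel by simp
  next
    case (insert f F)
    define H where "H = {x. \<forall>e. e \<notin> insert f F \<longrightarrow> coord x e = coord y e}"
    define J where "J i = (\<lambda>x. coord x f) ` (K i \<inter> H)" for i
    have "closed (\<Inter>e\<in>- insert f F. {x. coord x e = coord y e})"
      by (intro closed_INT ballI closed_Collect_eq continuous_intros)
    also have "(\<Inter>e\<in>- insert f F. {x. coord x e = coord y e}) = H"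
      by (auto simp: H_def)
    finally have closedH: "closed H" .
    have "convex (\<Inter>e\<in>- insert f F. {x. mass x {e} \<in> {coord y e}})"
      by (intro convex_INT convex_mass_vimage convex_singleton)
    also have "(\<Inter>e\<in>- insert f F. {x. mass x {e} \<in> {coord y e}}) = H" by (auto simp: H_def)
    finally have convexH: "convex H" .
    have "\<exists>p q. J i = {p..q}" if i: "i \<in> I" for i
    proof -
      have "compact (K i \<inter> H)" "convex (K i \<inter> H)"
        using K[OF i] closedH convexH by (auto intro: compact_Int_closed convex_Int)
      then have "compact (J i)" "connected (J i)"
        unfolding J_def
        by (simp_all add: compact_continuous_image connected_continuous_image
            continuous_on_lookup convex_connected)
      then show ?thesis using connected_compact_interval_1 by metis
    qed
    moreover have "(\<Sum>i\<in>I. a i * of_bool (t \<in> J i)) = 0" for t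
    proof -
      have "t \<in> J i \<longleftrightarrow> (\<exists>x\<in>K i. \<forall>e. e \<notin> F \<longrightarrow>
          coord x e = coord (Poly_Mapping.update f t y) e)" for i
        using insert.hyps(2) by (auto simp: J_def H_def lookup_update image_iff)
      then show ?thesis using insert.IH[of "Poly_Mapping.update f t y"] by simp
    qed
    ultimately have "(\<Sum>i\<in>I. a i * of_bool (J i \<noteq> {})) = 0"
      by (intro sum_nonempty_intervals_eq_0 fin) auto
    moreover have "J i \<noteq> {} \<longleftrightarrow> (\<exists>x\<in>K i. \<forall>e. e \<notin> insert f F \<longrightarrow>
        coord x e = coord y e)" for i
      by (auto simp: J_def H_def)
    ultimately show ?case by simp
  qed
  from this[OF fin(2), of 0] have
    "(\<Sum>i\<in>I. a i * of_bool (\<exists>x\<in>K i. \<forall>e. e \<notin> E \<longrightarrow> coord x e = 0)) = 0" by simp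
  moreover have "(\<exists>x\<in>K i. \<forall>e. e \<notin> E \<longrightarrow> coord x e = 0) \<longleftrightarrow> K i \<noteq> {}" if "i \<in> I" for i
    using supp that by blast
  ultimately show ?thesis by (simp cong: sum.cong)
qed

definition polytope_relation :: "'a set \<Rightarrow> nat \<Rightarrow> (nat \<Rightarrow> 'a matroid) \<Rightarrow> (nat \<Rightarrow> int) \<Rightarrow> bool" where
  "polytope_relation E n M a \<longleftrightarrow> (\<forall>i<n. ground (M i) = E) \<and>
     (\<forall>x. (\<Sum>i<n. a i * indicator (base_polytope (M i)) x) = 0)"

lemma valuative_iff:
  "valuative f \<longleftrightarrow> (\<forall>E n M a. polytope_relation E n M a \<longrightarrow> (\<Sum>i<n. of_int (a i) * f (M i)) = 0)"
  unfolding valuative_def polytope_relation_def by blast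

text \<open>A relation between indicator functions may be multiplied by the indicator function of \<open>H\<close>,
  and then be evaluated by the Euler characteristic.\<close>
lemma polytope_relation_section:
  assumes rel: "polytope_relation E n M a" and H: "closed H" "convex H"
  shows "(\<Sum>i<n. a i * of_bool (base_polytope (M i) \<inter> H \<noteq> {})) = 0"
proof (cases "n = 0")
  case False
  then have "finite E" using rel finite_ground[of "M 0"] by (auto simp: polytope_relation_def)
  show ?thesis
  proof (rule sum_nonempty_compact_convex_eq_0[OF finite_lessThan \<open>finite E\<close>])
    fix i x e assume *: "i \<in> {..<n}" "x \<in> base_polytope (M i) \<inter> H" "e \<notin> E"
    then show "coord x e = 0"
      using rel by (auto simp: polytope_relation_def base_polytope_eq_rank_polytope rank_polytope_def)
  next
    fix x
    show "(\<Sum>i<n. a i * of_bool (x \<in> base_polytope (M i) \<inter> H)) = 0"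
    proof (cases "x \<in> H")
      case True
      then show ?thesis using rel by (simp add: polytope_relation_def indicator_def of_bool_def)
    qed simp
  qed (use H compact_base_polytope convex_base_polytope in
      \<open>auto intro: compact_Int_closed convex_Int\<close>)
qed simp

text \<open>Base polytopes have Euler characteristic 1.\<close>
lemma valuative_1: "valuative (\<lambda>M. 1 :: int)"
  unfolding valuative_iff
proof (intro allI impI)
  fix E :: "'a set" and n M a assume "polytope_relation E n M a"
  then have "(\<Sum>i<n. a i * of_bool (base_polytope (M i) \<inter> UNIV \<noteq> {})) = 0"
    by (intro polytope_relation_section) auto
  moreover have "base_polytope N \<noteq> {}" for N :: "'a matroid"
  proof -
    obtain B where "basis N B" by (rule basis_exists)
    then show ?thesis using basis_in_base_polytope by blast
  qed
  ultimately show "(\<Sum>i<n. of_int (a i) * 1) = (0 :: int)" by simp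
qed

text \<open>Both lower bounds on the ranks of nested sets are attained by a common basis, so they say
  that the base polytope meets an intersection of two half-spaces.\<close>
lemma rk_bounds_iff_base_polytope_meets:
  assumes "B \<subseteq> A" "A \<subseteq> ground M"
  shows "j \<le> rk M A \<and> k \<le> rk M B \<longleftrightarrow>
    base_polytope M \<inter> ({x. real j \<le> mass x A} \<inter> {x. real k \<le> mass x B}) \<noteq> {}"
proof
  assume *: "j \<le> rk M A \<and> k \<le> rk M B"
  define S where "S i = (if i = 0 then B else A)" for i :: nat
  have S: "S i \<subseteq> S (Suc i)" for i using assms by (auto simp: S_def)
  obtain C where C: "basis M C" "\<And>i. i \<le> 1 \<Longrightarrow> card (C \<inter> S i) = rk M (S i)"
    using chain_adapted_basis[of 1 S M] S by auto
  have "finite A" using finite_subset[OF assms(2) finite_ground] .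
  moreover have "finite B" using finite_subset[OF assms(1) \<open>finite A\<close>] .
  ultimately have "mass (indicator_vec C) A = rk M A" "mass (indicator_vec C) B = rk M B"
    using C(2)[of 0] C(2)[of 1] finite_basis[OF C(1)] by (simp_all add: mass_indicator_vec S_def)
  then show "base_polytope M \<inter> ({x. real j \<le> mass x A} \<inter> {x. real k \<le> mass x B}) \<noteq> {}"
    using basis_in_base_polytope[OF C(1)] * by auto
next
  assume "base_polytope M \<inter> ({x. real j \<le> mass x A} \<inter> {x. real k \<le> mass x B}) \<noteq> {}"
  then obtain x where x: "x \<in> rank_polytope M" "real j \<le> mass x A" "real k \<le> mass x B"
    by (auto simp: base_polytope_eq_rank_polytope)
  then have "mass x A \<le> rk M A" "mass x B \<le> rk M B" using assms by (auto simp: rank_polytope_def)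
  then show "j \<le> rk M A \<and> k \<le> rk M B" using x by linarith
qed

lemma closed_convex_mass_halfspace: "closed {x. c \<le> mass x A}" "convex {x. c \<le> mass x A}"
proof -
  show "closed {x. c \<le> mass x A}" by (intro closed_Collect_le continuous_intros)
  show "convex {x. c \<le> mass x A}"
    using convex_mass_vimage[OF convex_real_interval(1), of A c] by simp
qed

text \<open>This pairs \<open>f\<close> with the Moebius transform of \<open>h\<close> on the Boolean lattice.\<close>
definition moebius_form :: "'a set \<Rightarrow> ('a set \<Rightarrow> int) \<Rightarrow> ('a set \<Rightarrow> int) \<Rightarrow> int" where
  "moebius_form E f h = (\<Sum>A\<in>Pow E. \<Sum>B\<in>Pow A. (-1) ^ (card A + card B) * (f A * h B))"

definition rank_form :: "'a matroid \<Rightarrow> int" where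
  "rank_form M = moebius_form (ground M) (\<lambda>A. int (rk M A)) (\<lambda>A. int (rk M A))"

lemma int_eq_sum_of_bool: "m \<le> N \<Longrightarrow> int m = (\<Sum>k\<in>{1..N}. of_bool (k \<le> m))"
proof -
  assume "m \<le> N"
  then have "{1..N} \<inter> {k. k \<le> m} = {1..m}" by auto
  then show ?thesis by simp
qed

text \<open>A product of ranks counts the pairs of lower bounds that the two ranks satisfy.\<close>
lemma valuative_rank_form: "valuative rank_form"
  unfolding valuative_iff
proof (intro allI impI)
  fix E :: "'a set" and n M a assume rel: "polytope_relation E n M a"
  have "(\<Sum>i<n. a i * rank_form (M i)) = 0"
  proof (cases "n = 0")
    case False
    then have finE: "finite E" and gr: "\<And>i. i < n \<Longrightarrow> ground (M i) = E"
      using rel finite_ground[of "M 0"] by (auto simp: polytope_relation_def)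
    define N where "N = card E"
    have rkN: "rk (M i) A \<le> N" if "i < n" "A \<subseteq> E" for i A
      unfolding N_def using that finE by (meson card_mono finite_subset order_trans rk_le_card)
    have bounds: "(\<Sum>i<n. a i * of_bool (j \<le> rk (M i) A \<and> k \<le> rk (M i) B)) = 0"
      if "A \<subseteq> E" "B \<subseteq> A" for A B j k
    proof -
      have "(\<Sum>i<n. a i * of_bool (j \<le> rk (M i) A \<and> k \<le> rk (M i) B))
        = (\<Sum>i<n. a i * of_bool (base_polytope (M i)
              \<inter> ({x. real j \<le> mass x A} \<inter> {x. real k \<le> mass x B}) \<noteq> {}))"
        using that gr by (intro sum.cong refl) (simp add: rk_bounds_iff_base_polytope_meets)
      also have "\<dots> = 0"
        by (intro polytope_relation_section[OF rel] closed_Int convex_Int closed_convex_mass_halfspace)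
      finally show ?thesis .
    qed
    have prods: "(\<Sum>i<n. a i * (int (rk (M i) A) * int (rk (M i) B))) = 0"
      if AB: "A \<subseteq> E" "B \<subseteq> A" for A B
    proof -
      have "(\<Sum>i<n. a i * (int (rk (M i) A) * int (rk (M i) B)))
        = (\<Sum>i<n. \<Sum>j\<in>{1..N}. \<Sum>k\<in>{1..N}. a i * of_bool (j \<le> rk (M i) A \<and> k \<le> rk (M i) B))"
      proof (intro sum.cong refl)
        fix i assume "i \<in> {..<n}"
        then have le: "rk (M i) A \<le> N" "rk (M i) B \<le> N" using rkN AB by auto
        have "int (rk (M i) A) * int (rk (M i) B)
            = (\<Sum>j\<in>{1..N}. \<Sum>k\<in>{1..N}. of_bool (j \<le> rk (M i) A \<and> k \<le> rk (M i) B))"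
          unfolding int_eq_sum_of_bool[OF le(1)] int_eq_sum_of_bool[OF le(2)] sum_product of_bool_conj ..
        then show "a i * (int (rk (M i) A) * int (rk (M i) B))
            = (\<Sum>j\<in>{1..N}. \<Sum>k\<in>{1..N}. a i * of_bool (j \<le> rk (M i) A \<and> k \<le> rk (M i) B))"
          by (simp only: sum_distrib_left)
      qed
      also have "\<dots> = (\<Sum>j\<in>{1..N}. \<Sum>k\<in>{1..N}. \<Sum>i<n. a i * of_bool (j \<le> rk (M i) A \<and> k \<le> rk (M i) B))"
        by (subst sum.swap, rule sum.cong[OF refl], rule sum.swap)
      also have "\<dots> = 0" by (simp only: bounds[OF AB] sum.neutral_const)
      finally show ?thesis .
    qed
    have "(\<Sum>i<n. a i * rank_form (M i))
      = (\<Sum>i<n. \<Sum>A\<in>Pow E. \<Sum>B\<in>Pow A. (-1) ^ (card A + card B) * (a i * (int (rk (M i) A) * int (rk (M i) B))))"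
      using gr by (intro sum.cong refl)
        (simp add: rank_form_def moebius_form_def sum_distrib_left mult.left_commute)
    also have "\<dots> = (\<Sum>A\<in>Pow E. \<Sum>B\<in>Pow A. \<Sum>i<n. (-1) ^ (card A + card B) * (a i * (int (rk (M i) A) * int (rk (M i) B))))"
      by (subst sum.swap, rule sum.cong[OF refl], rule sum.swap)
    also have "\<dots> = 0"
      by (rule sum.neutral, rule ballI, rule sum.neutral, rule ballI)
        (simp only: prods mult_zero_right Pow_iff flip: sum_distrib_left)
    finally show ?thesis .
  qed simp
  then show "(\<Sum>i<n. of_int (a i) * rank_form (M i)) = 0" by simp
qed

lemma valuative_sum_eq:
  fixes f :: "'a matroid \<Rightarrow> int"
  assumes f: "valuative f" and fin: "finite K" and gr: "\<And>k. k \<in> K \<Longrightarrow> ground (N k) = ground M"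
    and eq: "\<And>x. indicator (base_polytope M) x = (\<Sum>k\<in>K. a k * indicator (base_polytope (N k)) x)"
  shows "f M = (\<Sum>k\<in>K. a k * f (N k))"
proof -
  obtain h where h: "bij_betw h {..<card K} K"
    using ex_bij_betw_nat_finite[OF fin] by (auto simp: lessThan_atLeast0)
  \<comment> \<open>Move the left-hand side over to obtain a relation; index \<open>card K\<close> carries the matroid \<open>M\<close>.\<close>
  define b where "b i = (if i = card K then -1 else a (h i))" for i
  define L where "L i = (if i = card K then M else N (h i))" for i
  have hK: "h i \<in> K" if "i < card K" for i using h that by (auto dest: bij_betwE)
  have sum_eq: "(\<Sum>i<Suc (card K). b i * F (L i)) = (\<Sum>k\<in>K. a k * F (N k)) - F M" for F :: "'a matroid \<Rightarrow> int"
  proof -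
    have "(\<Sum>i<card K. b i * F (L i)) = (\<Sum>i<card K. a (h i) * F (N (h i)))"
      by (intro sum.cong) (auto simp: b_def L_def)
    also have "\<dots> = (\<Sum>k\<in>K. a k * F (N k))"
      by (rule sum.reindex_bij_betw[OF h, of "\<lambda>k. a k * F (N k)"])
    finally show ?thesis by (simp add: b_def L_def)
  qed
  have "polytope_relation (ground M) (Suc (card K)) L b"
    unfolding polytope_relation_def
  proof (intro conjI allI impI)
    fix i assume "i < Suc (card K)" then show "ground (L i) = ground M"
      using gr hK by (auto simp: L_def)
  next
    fix x show "(\<Sum>i<Suc (card K). b i * indicator (base_polytope (L i)) x) = 0"
      using sum_eq[of "\<lambda>M. indicator (base_polytope M) x"] eq[of x] by simp
  qed
  then have "(\<Sum>i<Suc (card K). b i * f (L i)) = 0"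
    using f by (fastforce simp: valuative_iff)
  then show ?thesis using sum_eq[of f] by simp
qed

section \<open>Matroids given by interval constraints\<close>

definition seg :: "'a list \<Rightarrow> nat \<Rightarrow> nat \<Rightarrow> 'a set" where
  "seg xs j k = (!) xs ` {j..<k}"

lemma finite_seg [simp]: "finite (seg xs j k)"
  by (simp add: seg_def)

lemma seg_empty [simp]: "k \<le> j \<Longrightarrow> seg xs j k = {}"
  by (simp add: seg_def)

lemma seg_all: "seg xs 0 (length xs) = set xs"
  unfolding seg_def using nth_image[of "length xs" xs] by simp

lemma seg_mono: "j' \<le> j \<Longrightarrow> k \<le> k' \<Longrightarrow> seg xs j k \<subseteq> seg xs j' k'"
  by (auto simp: seg_def)

lemma seg_subset_set: "k \<le> length xs \<Longrightarrow> seg xs j k \<subseteq> set xs"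
  by (auto simp: seg_def)

lemma seg_Un: "i \<le> j \<Longrightarrow> j \<le> k \<Longrightarrow> seg xs i k = seg xs i j \<union> seg xs j k"
  by (simp add: seg_def ivl_disj_un_two flip: image_Un)

lemma seg_Int:
  assumes "distinct xs" "k \<le> length xs" "k' \<le> length xs"
  shows "seg xs j k \<inter> seg xs j' k' = seg xs (max j j') (min k k')"
proof -
  have "inj_on ((!) xs) {..<length xs}" using assms(1) by (intro inj_on_nth) auto
  then have "(!) xs ` ({j..<k} \<inter> {j'..<k'}) = seg xs j k \<inter> seg xs j' k'"
    unfolding seg_def using assms by (intro inj_on_image_Int[of _ "{..<length xs}"]) auto
  then show ?thesis by (simp add: seg_def)
qed

lemma seg_Suc: "seg xs j (Suc k) = (if j \<le> k then insert (xs ! k) (seg xs j k) else {})"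
  by (auto simp: seg_def less_Suc_eq_le le_less)

lemma card_seg: "distinct xs \<Longrightarrow> k \<le> length xs \<Longrightarrow> card (seg xs j k) = k - j"
  unfolding seg_def by (subst card_image) (auto intro: inj_on_nth)

lemma seg_append1: "k \<le> length ys \<Longrightarrow> seg (ys @ zs) j k = seg ys j k"
  unfolding seg_def by (intro image_cong) (auto simp: nth_append)

lemma seg_append2: "seg (ys @ zs) (length ys + j) (length ys + k) = seg zs j k"
proof -
  have "{length ys + j..<length ys + k} = (\<lambda>i. length ys + i) ` {j..<k}" by (simp add: add.commute)
  then show ?thesis unfolding seg_def by (simp only: image_image) (simp add: nth_append)
qed

lemma sum_seg_split:
  fixes f :: "'a \<Rightarrow> 'b::comm_monoid_add"
  assumes "distinct xs" "i \<le> j" "j \<le> k" "k \<le> length xs"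
  shows "sum f (seg xs i k) = sum f (seg xs i j) + sum f (seg xs j k)"
proof -
  have "seg xs i j \<inter> seg xs j k = {}" using seg_Int[of xs j k i j] assms by simp
  then show ?thesis using seg_Un[OF assms(2,3), of xs] by (simp add: sum.union_disjoint)
qed

lemma card_Int_seg_split:
  assumes "distinct xs" "i \<le> j" "j \<le> k" "k \<le> length xs"
  shows "card (I \<inter> seg xs i k) = card (I \<inter> seg xs i j) + card (I \<inter> seg xs j k)"
proof -
  have "seg xs i j \<inter> seg xs j k = {}" using seg_Int[of xs j k i j] assms by simp
  then have "card (I \<inter> seg xs i j \<union> I \<inter> seg xs j k) = card (I \<inter> seg xs i j) + card (I \<inter> seg xs j k)"
    by (intro card_Un_disjoint) auto
  then show ?thesis using seg_Un[OF assms(2,3), of xs] by (simp add: Int_Un_distrib)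
qed

text \<open>A set whose initial segments have sizes between \<open>l\<close> and \<open>u\<close> has at most \<open>u k - l j\<close> elements
  in the segment from \<open>j\<close> to \<open>k\<close>. These bounds describe the subsets of such sets.\<close>
definition interval_indep :: "'a list \<Rightarrow> (nat \<Rightarrow> int) \<Rightarrow> (nat \<Rightarrow> int) \<Rightarrow> 'a set \<Rightarrow> bool" where
  "interval_indep xs l u I \<longleftrightarrow> I \<subseteq> set xs \<and>
     (\<forall>j k. j \<le> k \<longrightarrow> k \<le> length xs \<longrightarrow> int (card (I \<inter> seg xs j k)) \<le> u k - l j)"

definition path_sets :: "'a list \<Rightarrow> (nat \<Rightarrow> int) \<Rightarrow> (nat \<Rightarrow> int) \<Rightarrow> 'a set set" where
  "path_sets xs l u = {B. B \<subseteq> set xs \<and>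
     (\<forall>k\<le>length xs. l k \<le> int (card (B \<inter> seg xs 0 k)) \<and> int (card (B \<inter> seg xs 0 k)) \<le> u k)}"

definition feasible :: "'a list \<Rightarrow> (nat \<Rightarrow> int) \<Rightarrow> (nat \<Rightarrow> int) \<Rightarrow> bool" where
  "feasible xs l u \<longleftrightarrow> distinct xs \<and> l 0 = 0 \<and> u 0 = 0 \<and> l (length xs) = u (length xs) \<and>
     path_sets xs l u \<noteq> {}"

definition interval_matroid :: "'a list \<Rightarrow> (nat \<Rightarrow> int) \<Rightarrow> (nat \<Rightarrow> int) \<Rightarrow> 'a matroid" where
  "interval_matroid xs l u = Abs_matroid (set xs, {I. interval_indep xs l u I})"

definition tight_interval :: "'a list \<Rightarrow> (nat \<Rightarrow> int) \<Rightarrow> (nat \<Rightarrow> int) \<Rightarrow> 'a set \<Rightarrow> 'a set \<Rightarrow> bool" where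
  "tight_interval xs l u I T \<longleftrightarrow>
     (\<exists>j k. j \<le> k \<and> k \<le> length xs \<and> T = seg xs j k \<and> int (card (I \<inter> T)) = u k - l j)"

text \<open>Uncrossing: the bound \<open>u k - l j\<close> is modular on overlapping intervals.\<close>
lemma tight_interval_Un:
  assumes d: "distinct xs" and I: "interval_indep xs l u I"
    and T: "tight_interval xs l u I T1" "tight_interval xs l u I T2" "T1 \<inter> T2 \<noteq> {}"
  shows "tight_interval xs l u I (T1 \<union> T2)"
proof -
  have main: "tight_interval xs l u I (seg xs j1 k1 \<union> seg xs j2 k2)"
    if T1: "j1 \<le> k1" "k1 \<le> length xs" "int (card (I \<inter> seg xs j1 k1)) = u k1 - l j1"
    and T2: "j2 \<le> k2" "k2 \<le> length xs" "int (card (I \<inter> seg xs j2 k2)) = u k2 - l j2"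
    and ne: "seg xs j1 k1 \<inter> seg xs j2 k2 \<noteq> {}" and le: "j1 \<le> j2" for j1 k1 j2 k2
  proof (cases "k2 \<le> k1")
    case True
    then have "seg xs j1 k1 \<union> seg xs j2 k2 = seg xs j1 k1" using seg_mono[OF le True, of xs] by auto
    then show ?thesis using T1 by (auto simp: tight_interval_def)
  next
    case False
    have "j2 < k1"
    proof (rule ccontr)
      assume "\<not> j2 < k1"
      then have "seg xs (max j1 j2) (min k1 k2) = {}" using le by simp
      then show False using ne seg_Int[OF d T1(2) T2(2)] by simp
    qed
    have un: "seg xs j1 k1 \<union> seg xs j2 k2 = seg xs j1 k2"
      using seg_Un[of j1 j2 k2 xs] seg_mono[of j1 j1 k1 k2 xs] seg_mono[of j1 j1 j2 k1 xs]
        le False \<open>j2 < k1\<close> by auto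
    have "card (I \<inter> seg xs j1 k2) = card (I \<inter> seg xs j1 k1) + card (I \<inter> seg xs k1 k2)"
      using d T1 T2 False by (intro card_Int_seg_split) auto
    moreover have "card (I \<inter> seg xs j2 k2) = card (I \<inter> seg xs j2 k1) + card (I \<inter> seg xs k1 k2)"
      using d T1 T2 False \<open>j2 < k1\<close> by (intro card_Int_seg_split) auto
    moreover have "int (card (I \<inter> seg xs j2 k1)) \<le> u k1 - l j2"
      "int (card (I \<inter> seg xs j1 k2)) \<le> u k2 - l j1"
      using I T1 T2 False \<open>j2 < k1\<close> le by (auto simp: interval_indep_def)
    ultimately have "int (card (I \<inter> seg xs j1 k2)) = u k2 - l j1" using T1(3) T2(3) by linarith
    then show ?thesis unfolding un tight_interval_def using le T2 False T1 by (intro exI[of _ j1] exI[of _ k2]) auto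
  qed
  obtain j1 k1 where T1: "j1 \<le> k1" "k1 \<le> length xs" "T1 = seg xs j1 k1" "int (card (I \<inter> T1)) = u k1 - l j1"
    using T(1) by (auto simp: tight_interval_def)
  obtain j2 k2 where T2: "j2 \<le> k2" "k2 \<le> length xs" "T2 = seg xs j2 k2" "int (card (I \<inter> T2)) = u k2 - l j2"
    using T(2) by (auto simp: tight_interval_def)
  show ?thesis
  proof (cases "j1 \<le> j2")
    case True then show ?thesis using main[of j1 k1 j2 k2] T1 T2 T(3) by simp
  next
    case False then show ?thesis using main[of j2 k2 j1 k1] T1 T2 T(3) by (simp add: Int_commute Un_commute)
  qed
qed

text \<open>Merge overlapping members of the family until all are disjoint, then add up.\<close>
lemma weight_Union_tight_le:
  fixes x :: "'a \<Rightarrow> real"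
  assumes d: "distinct xs" and I: "interval_indep xs l u I"
    and x: "\<And>j k. j \<le> k \<Longrightarrow> k \<le> length xs \<Longrightarrow> sum x (seg xs j k) \<le> of_int (u k - l j)"
    and fin: "finite \<T>" and tight: "\<And>T. T \<in> \<T> \<Longrightarrow> tight_interval xs l u I T"
  shows "sum x (\<Union>\<T>) \<le> card (I \<inter> \<Union>\<T>)"
  using fin tight
proof (induction "card \<T>" arbitrary: \<T> rule: less_induct)
  case less
  show ?case
  proof (cases "\<exists>T1\<in>\<T>. \<exists>T2\<in>\<T>. T1 \<noteq> T2 \<and> T1 \<inter> T2 \<noteq> {}")
    case True
    then obtain T1 T2 where T: "T1 \<in> \<T>" "T2 \<in> \<T>" "T1 \<noteq> T2" "T1 \<inter> T2 \<noteq> {}" by blast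
    define \<S> where "\<S> = insert (T1 \<union> T2) (\<T> - {T1, T2})"
    have "card \<S> \<le> Suc (card (\<T> - {T1, T2}))" using less.prems(1) by (simp add: \<S>_def card_insert_le_m1 card_insert_if)
    also have "card (\<T> - {T1, T2}) = card \<T> - 2"
      using T less.prems(1) by (subst card_Diff_subset) auto
    also have "card {T1, T2} \<le> card \<T>" using T less.prems(1) by (intro card_mono) auto
    then have "Suc (card \<T> - 2) < card \<T>" using T(3) by simp
    finally have "card \<S> < card \<T>" .
    moreover have "finite \<S>" using less.prems(1) by (simp add: \<S>_def)
    moreover have "tight_interval xs l u I S" if "S \<in> \<S>" for S
      using that less.prems(2) tight_interval_Un[OF d I _ _ T(4)] T(1,2) by (auto simp: \<S>_def)
    ultimately have "sum x (\<Union>\<S>) \<le> card (I \<inter> \<Union>\<S>)" using less.hyps by blast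
    moreover have "\<Union>\<S> = \<Union>\<T>" using T by (auto simp: \<S>_def)
    ultimately show ?thesis by simp
  next
    case False
    have finT: "finite T" if "T \<in> \<T>" for T using less.prems(2)[OF that] by (auto simp: tight_interval_def)
    have "sum x (\<Union>\<T>) = (\<Sum>T\<in>\<T>. sum x T)"
      using False finT less.prems(1) by (intro sum.Union_disjoint[unfolded comp_def]) auto
    also have "\<dots> \<le> (\<Sum>T\<in>\<T>. real (card (I \<inter> T)))"
    proof (intro sum_mono)
      fix T assume "T \<in> \<T>"
      then have "tight_interval xs l u I T" by (rule less.prems(2))
      then obtain j k where "j \<le> k" "k \<le> length xs" "T = seg xs j k" "int (card (I \<inter> T)) = u k - l j"
        unfolding tight_interval_def by blast
      then show "sum x T \<le> real (card (I \<inter> T))" using x[of j k]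
        by (metis of_int_of_nat_eq)
    qed
    also have "\<dots> = real (card (\<Union>T\<in>\<T>. I \<inter> T))"
      using False finT less.prems(1) by (subst card_UN_disjoint) auto
    also have "(\<Union>T\<in>\<T>. I \<inter> T) = I \<inter> \<Union>\<T>" by auto
    finally show ?thesis .
  qed
qed

text \<open>Overlapping tight intervals merge, so the tight intervals form disjoint blocks on each of
  which the weight is at most the size of \<open>I\<close>; outside the blocks nothing of \<open>F\<close> is missing
  from \<open>I\<close>. For \<open>x\<close> the indicator function of an independent set this is the augmentation
  axiom, for fractional \<open>x\<close> it is the bound on the rank of \<open>F\<close>.\<close>
lemma weight_le_card_saturated:
  fixes x :: "'a \<Rightarrow> real"
  assumes d: "distinct xs" and I: "interval_indep xs l u I"
    and x: "\<And>j k. j \<le> k \<Longrightarrow> k \<le> length xs \<Longrightarrow> sum x (seg xs j k) \<le> of_int (u k - l j)"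
    and x01: "\<And>e. 0 \<le> x e" "\<And>e. x e \<le> 1"
    and F: "F \<subseteq> set xs" "\<And>e. e \<in> F - I \<Longrightarrow> \<not> interval_indep xs l u (insert e I)"
  shows "sum x F \<le> card I"
proof -
  define \<T> where "\<T> = {T. tight_interval xs l u I T}"
  have "\<T> \<subseteq> Pow (set xs)" using seg_subset_set by (fastforce simp: \<T>_def tight_interval_def)
  then have fin: "finite \<T>" by (rule finite_subset) simp
  have finU: "finite (\<Union>\<T>)" 
    using \<open>\<T> \<subseteq> Pow (set xs)\<close> by (intro finite_subset[of "\<Union>\<T>" "set xs"]) auto
  have finI: "finite I" using I finite_subset by (auto simp: interval_indep_def)
  have finF: "finite F" using F(1) finite_subset by auto
  have cover: "F - \<Union>\<T> \<subseteq> I"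
  proof (intro subsetI, rule ccontr)
    fix e assume e: "e \<in> F - \<Union>\<T>" "e \<notin> I"
    then have "\<not> interval_indep xs l u (insert e I)" using F(2) by blast
    moreover have "insert e I \<subseteq> set xs" using e F(1) I unfolding interval_indep_def by blast
    ultimately obtain j k where jk: "j \<le> k" "k \<le> length xs"
        "\<not> int (card (insert e I \<inter> seg xs j k)) \<le> u k - l j"
      unfolding interval_indep_def by blast
    moreover have le: "int (card (I \<inter> seg xs j k)) \<le> u k - l j" using jk I by (auto simp: interval_indep_def)
    ultimately have es: "e \<in> seg xs j k" by (cases "e \<in> seg xs j k") auto
    then have "card (insert e I \<inter> seg xs j k) = Suc (card (I \<inter> seg xs j k))" using e finI by simp
    then have "int (card (I \<inter> seg xs j k)) = u k - l j" using jk(3) le by linarith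
    then have "seg xs j k \<in> \<T>" using jk by (auto simp: \<T>_def tight_interval_def)
    then show False using es e by blast
  qed
  have "sum x F \<le> sum x (\<Union>\<T> \<union> (F - \<Union>\<T>))"
    using x01 finU finF by (intro sum_mono2) auto
  also have "\<dots> = sum x (\<Union>\<T>) + sum x (F - \<Union>\<T>)"
    using finU finF by (intro sum.union_disjoint) auto
  also have "\<dots> \<le> card (I \<inter> \<Union>\<T>) + card (I - \<Union>\<T>)"
  proof -
    have "sum x (\<Union>\<T>) \<le> card (I \<inter> \<Union>\<T>)"
      using weight_Union_tight_le[OF d I x fin] by (auto simp: \<T>_def)
    moreover have "sum x (F - \<Union>\<T>) \<le> real (card (F - \<Union>\<T>))"
      using sum_bounded_above[of "F - \<Union>\<T>" x 1] x01 by simp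
    moreover have "card (F - \<Union>\<T>) \<le> card (I - \<Union>\<T>)" using cover finI by (intro card_mono) auto
    ultimately show ?thesis by linarith
  qed
  also have "\<dots> = card I" using finI card_Int_Diff[of I "\<Union>\<T>"] by simp
  finally show ?thesis .
qed

context
  fixes xs :: "'a list" and l u :: "nat \<Rightarrow> int"
  assumes feas: "feasible xs l u"
begin

lemma feasible_distinct: "distinct xs" using feas by (simp add: feasible_def)

lemma path_set_interval_indep:
  assumes "B \<in> path_sets xs l u" shows "interval_indep xs l u B"
  unfolding interval_indep_def
proof (intro conjI allI impI)
  fix j k assume jk: "j \<le> k" "k \<le> length xs"
  then have "card (B \<inter> seg xs 0 k) = card (B \<inter> seg xs 0 j) + card (B \<inter> seg xs j k)"
    by (intro card_Int_seg_split feasible_distinct) auto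
  moreover have "int (card (B \<inter> seg xs 0 k)) \<le> u k" "l j \<le> int (card (B \<inter> seg xs 0 j))"
    using assms jk by (auto simp: path_sets_def)
  ultimately show "int (card (B \<inter> seg xs j k)) \<le> u k - l j" by linarith
qed (use assms in \<open>auto simp: path_sets_def\<close>)

lemma interval_indep_mono:
  assumes "interval_indep xs l u I" "J \<subseteq> I" shows "interval_indep xs l u J"
  unfolding interval_indep_def
proof (intro conjI allI impI)
  fix j k assume jk: "j \<le> k" "k \<le> length xs"
  have "card (J \<inter> seg xs j k) \<le> card (I \<inter> seg xs j k)" using assms(2) by (intro card_mono) auto
  moreover have "int (card (I \<inter> seg xs j k)) \<le> u k - l j"
    using assms(1) jk by (simp add: interval_indep_def)
  ultimately show "int (card (J \<inter> seg xs j k)) \<le> u k - l j" by linarith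
qed (use assms in \<open>auto simp: interval_indep_def\<close>)

lemma interval_indep_augment:
  assumes I: "interval_indep xs l u I" and J: "interval_indep xs l u J" and lt: "card I < card J"
  shows "\<exists>e\<in>J - I. interval_indep xs l u (insert e I)"
proof (rule ccontr)
  assume *: "\<not> (\<exists>e\<in>J - I. interval_indep xs l u (insert e I))"
  have finJ: "finite J" using J finite_subset by (auto simp: interval_indep_def)
  have ind: "sum (indicator J) A = real (card (J \<inter> A))" if "finite A" for A
    using sum.inter_restrict[OF that, of "\<lambda>_. 1::real" J]
    by (simp add: Int_commute indicator_def of_bool_def)
  have "sum (indicator J) (seg xs j k) \<le> real_of_int (u k - l j)" if "j \<le> k" "k \<le> length xs" for j k
  proof -
    have "int (card (J \<inter> seg xs j k)) \<le> u k - l j" using J that by (auto simp: interval_indep_def)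
    then show ?thesis unfolding ind[OF finite_seg] by linarith
  qed
  then have "sum (indicator J) J \<le> real (card I)"
    by (rule weight_le_card_saturated[OF feasible_distinct I])
      (use * J in \<open>auto simp: interval_indep_def indicator_def\<close>)
  then show False using lt by (simp add: ind[OF finJ])
qed

lemma Rep_interval_matroid: "Rep_matroid (interval_matroid xs l u) = (set xs, {I. interval_indep xs l u I})"
  unfolding interval_matroid_def
proof (rule Abs_matroid_inverse, unfold mem_Collect_eq prod.case, intro conjI allI impI)
  obtain B where "B \<in> path_sets xs l u" using feas by (auto simp: feasible_def)
  then show "interval_indep xs l u {}"
    using interval_indep_mono[OF path_set_interval_indep, of B "{}"] by simp
  show "{I. interval_indep xs l u I} \<subseteq> Pow (set xs)" by (auto simp: interval_indep_def)
qed (use interval_indep_mono interval_indep_augment in simp_all)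

lemma ground_interval_matroid: "ground (interval_matroid xs l u) = set xs"
  by (simp add: ground_def Rep_interval_matroid)

lemma indep_interval_matroid: "indep (interval_matroid xs l u) I \<longleftrightarrow> interval_indep xs l u I"
  by (simp add: indep_def Rep_interval_matroid)

lemma card_path_set: "B \<in> path_sets xs l u \<Longrightarrow> int (card B) = u (length xs)"
proof -
  assume B: "B \<in> path_sets xs l u"
  then have "B \<inter> seg xs 0 (length xs) = B" by (auto simp: seg_all path_sets_def)
  moreover have "int (card (B \<inter> seg xs 0 (length xs))) = u (length xs)"
    using B feas by (intro antisym) (auto simp: path_sets_def feasible_def)
  ultimately show ?thesis by simp
qed

lemma rk_ground_interval_matroid: "int (rk (interval_matroid xs l u) (set xs)) = u (length xs)"
proof (rule antisym)
  obtain B where B: "B \<in> path_sets xs l u" using feas by (auto simp: feasible_def)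
  then have "card B \<le> rk (interval_matroid xs l u) (set xs)"
    by (intro card_indep_le_rk) (auto simp: indep_interval_matroid path_set_interval_indep path_sets_def)
  then show "u (length xs) \<le> int (rk (interval_matroid xs l u) (set xs))" using card_path_set[OF B] by simp
  obtain I where I: "I \<subseteq> set xs" "interval_indep xs l u I" "card I = rk (interval_matroid xs l u) (set xs)"
    using rk_witness[of "set xs" "interval_matroid xs l u"] by (auto simp: indep_interval_matroid)
  then have "int (card (I \<inter> seg xs 0 (length xs))) \<le> u (length xs) - l 0" by (auto simp: interval_indep_def)
  then show "int (rk (interval_matroid xs l u) (set xs)) \<le> u (length xs)"
    using I feas by (simp add: seg_all inf.absorb1 feasible_def)
qed

lemma basis_interval_matroid: "basis (interval_matroid xs l u) B \<longleftrightarrow> B \<in> path_sets xs l u"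
proof
  assume B: "B \<in> path_sets xs l u"
  have "card B = rk (interval_matroid xs l u) (set xs)"
    using card_path_set[OF B] rk_ground_interval_matroid by linarith
  then show "basis (interval_matroid xs l u) B"
    using path_set_interval_indep[OF B]
    by (simp add: basis_iff ground_interval_matroid indep_interval_matroid)
next
  assume "basis (interval_matroid xs l u) B"
  then have B: "interval_indep xs l u B" "int (card B) = u (length xs)"
    using rk_ground_interval_matroid
    by (auto simp: basis_iff ground_interval_matroid indep_interval_matroid)
  then have all: "B \<inter> seg xs 0 (length xs) = B" by (auto simp: seg_all interval_indep_def)
  have "l k \<le> int (card (B \<inter> seg xs 0 k)) \<and> int (card (B \<inter> seg xs 0 k)) \<le> u k" if k: "k \<le> length xs" for k
  proof -
    have "card (B \<inter> seg xs 0 (length xs)) = card (B \<inter> seg xs 0 k) + card (B \<inter> seg xs k (length xs))"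
      using k by (intro card_Int_seg_split feasible_distinct) auto
    moreover have "int (card (B \<inter> seg xs 0 k)) \<le> u k - l 0"
      "int (card (B \<inter> seg xs k (length xs))) \<le> u (length xs) - l k"
      using B(1) k by (auto simp: interval_indep_def)
    ultimately show ?thesis using B(2) all feas by (simp add: feasible_def)
  qed
  then show "B \<in> path_sets xs l u" using B(1) by (auto simp: path_sets_def interval_indep_def)
qed

text \<open>The inequalities for initial segments imply all rank inequalities, because a maximal
  independent subset of \<open>F\<close> certifies the rank bound by its tight intervals.\<close>
lemma base_polytope_interval_matroid:
  "x \<in> base_polytope (interval_matroid xs l u) \<longleftrightarrow>
    (\<forall>e. 0 \<le> coord x e \<and> coord x e \<le> 1) \<and>
    (\<forall>e. e \<notin> set xs \<longrightarrow> coord x e = 0) \<and>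
    (\<forall>k\<le>length xs. of_int (l k) \<le> mass x (seg xs 0 k) \<and> mass x (seg xs 0 k) \<le> of_int (u k))"
    (is "_ \<longleftrightarrow> ?R")
proof
  assume "x \<in> base_polytope (interval_matroid xs l u)"
  then have x: "\<And>e. 0 \<le> coord x e" "\<And>e. e \<notin> set xs \<Longrightarrow> coord x e = 0"
      "mass x (set xs) = rk (interval_matroid xs l u) (set xs)"
      "\<And>A. A \<subseteq> set xs \<Longrightarrow> mass x A \<le> rk (interval_matroid xs l u) A"
    by (auto simp: base_polytope_eq_rank_polytope rank_polytope_def ground_interval_matroid)
  have total: "mass x (set xs) = of_int (u (length xs))"
    using x(3) rk_ground_interval_matroid by (metis of_int_of_nat_eq)
  have rk_seg: "mass x (seg xs j k) \<le> of_int (u k - l j)" if jk: "j \<le> k" "k \<le> length xs" for j k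
  proof -
    obtain I where "I \<subseteq> seg xs j k" "interval_indep xs l u I" "card I = rk (interval_matroid xs l u) (seg xs j k)"
      using rk_witness[of "seg xs j k" "interval_matroid xs l u"] by (auto simp: indep_interval_matroid)
    then have "int (rk (interval_matroid xs l u) (seg xs j k)) \<le> u k - l j"
      using jk by (metis inf.absorb1 interval_indep_def)
    moreover have "mass x (seg xs j k) \<le> rk (interval_matroid xs l u) (seg xs j k)"
      using jk seg_subset_set x(4) by blast
    ultimately show ?thesis by linarith
  qed
  have "coord x e \<le> 1" for e
  proof (cases "e \<in> set xs")
    case True
    then have "mass x {e} \<le> rk (interval_matroid xs l u) {e}" by (intro x(4)) auto
    then show ?thesis using rk_le_card[of "{e}" "interval_matroid xs l u"] by simp
  qed (simp add: x)
  moreover have "of_int (l k) \<le> mass x (seg xs 0 k) \<and> mass x (seg xs 0 k) \<le> of_int (u k)"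
    if k: "k \<le> length xs" for k
  proof -
    have "mass x (seg xs 0 (length xs)) = mass x (seg xs 0 k) + mass x (seg xs k (length xs))"
      using k by (intro sum_seg_split feasible_distinct) auto
    then show ?thesis using total rk_seg[of 0 k] rk_seg[of k "length xs"] k feas
      by (simp add: seg_all feasible_def)
  qed
  ultimately show ?R using x by blast
next
  assume x: ?R
  have interval: "mass x (seg xs j k) \<le> of_int (u k - l j)" if jk: "j \<le> k" "k \<le> length xs" for j k
  proof -
    have "mass x (seg xs 0 k) = mass x (seg xs 0 j) + mass x (seg xs j k)"
      using jk by (intro sum_seg_split feasible_distinct) auto
    moreover have "of_int (l j) \<le> mass x (seg xs 0 j)" "mass x (seg xs 0 k) \<le> of_int (u k)"
      using x jk by auto
    ultimately show ?thesis by simp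
  qed
  have "mass x F \<le> rk (interval_matroid xs l u) F" if F: "F \<subseteq> set xs" for F
  proof -
    obtain I where I: "I \<subseteq> F" "interval_indep xs l u I" "card I = rk (interval_matroid xs l u) F"
      using rk_witness[of F "interval_matroid xs l u"] by (auto simp: indep_interval_matroid)
    have "\<not> interval_indep xs l u (insert e I)" if e: "e \<in> F - I" for e
    proof
      assume "interval_indep xs l u (insert e I)"
      then have "card (insert e I) \<le> rk (interval_matroid xs l u) F"
        using I e by (intro card_indep_le_rk) (auto simp: indep_interval_matroid)
      moreover have "finite I" using I(1) F finite_subset by (metis List.finite_set)
      ultimately show False using I(3) e by simp
    qed
    then have "mass x F \<le> card I"
      using x by (intro weight_le_card_saturated[OF feasible_distinct I(2) interval _ _ F]) auto
    then show ?thesis using I(3) by simp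
  qed
  moreover have "mass x (set xs) = rk (interval_matroid xs l u) (set xs)"
  proof -
    have "mass x (set xs) = of_int (u (length xs))"
      using x feas by (intro antisym) (force simp: feasible_def seg_all)+
    then show ?thesis using rk_ground_interval_matroid by (metis of_int_of_nat_eq)
  qed
  ultimately show "x \<in> base_polytope (interval_matroid xs l u)"
    using x by (auto simp: base_polytope_eq_rank_polytope rank_polytope_def ground_interval_matroid)
qed

end

section \<open>Reduction to chains of rank inequalities\<close>

abbreviation set_chains :: "'a set set \<Rightarrow> 'a set set set" where
  "set_chains W \<equiv> {C. subset.chain W C}"

text \<open>The order complex of a family that contains with \<open>F\<close> also \<open>F \<union> T\<close> is contractible, via
  \<open>F \<le> F \<union> T \<ge> T\<close>. On the level of chains: toggling the union of \<open>T\<close> with the largest member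
  that does not contain \<open>T\<close> is a sign-reversing involution.\<close>
lemma sum_set_chains_eq_0:
  fixes W :: "'a set set"
  assumes fin: "finite W" and T: "T \<in> W" "\<And>F. F \<in> W \<Longrightarrow> F \<union> T \<in> W"
  shows "(\<Sum>C\<in>set_chains W. (-1) ^ card C) = (0::int)"
proof -
  define V where "V C = T \<union> \<Union>{F \<in> C. \<not> T \<subseteq> F}" for C :: "'a set set"
  define \<phi> where "\<phi> C = (if V C \<in> C then C - {V C} else insert (V C) C)" for C
  have V\<phi>: "V (\<phi> C) = V C" for C
  proof -
    have "{F \<in> \<phi> C. \<not> T \<subseteq> F} = {F \<in> C. \<not> T \<subseteq> F}" by (auto simp: \<phi>_def V_def)
    then show ?thesis by (simp add: V_def)
  qed
  have inv: "\<phi> (\<phi> C) = C" for C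
    unfolding \<phi>_def[of "\<phi> C"] V\<phi> by (auto simp: \<phi>_def)
  have finC: "finite C" if "subset.chain W C" for C
    using that fin by (auto simp: subset_chain_def intro: finite_subset)
  have VW: "V C \<in> W" if C: "subset.chain W C" for C
  proof (cases "{F \<in> C. \<not> T \<subseteq> F} = {}")
    case True then show ?thesis using T(1) by (simp only: V_def True) simp
  next
    case False
    have "subset.chain W {F \<in> C. \<not> T \<subseteq> F}" using C by (auto simp: subset_chain_def)
    then have "\<Union>{F \<in> C. \<not> T \<subseteq> F} \<in> {F \<in> C. \<not> T \<subseteq> F}"
      using False finC[OF C] by (intro Union_in_chain) auto
    then have "\<Union>{F \<in> C. \<not> T \<subseteq> F} \<in> W" using C by (auto simp: subset_chain_def)
    from T(2)[OF this] show ?thesis by (simp add: V_def Un_commute)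
  qed
  have comparable: "G \<subseteq> V C \<or> V C \<subseteq> G" if C: "subset.chain W C" and G: "G \<in> C" for C G
  proof (cases "T \<subseteq> G")
    case True
    then have "F \<subseteq> G" if "F \<in> C" "\<not> T \<subseteq> F" for F
      using C G that unfolding subset_chain_def by blast
    then show ?thesis using True by (auto simp: V_def)
  next
    case False then show ?thesis using G by (auto simp: V_def)
  qed
  have chain: "subset.chain W (\<phi> C)" if C: "subset.chain W C" for C
  proof (cases "V C \<in> C")
    case True then show ?thesis using C by (auto simp: \<phi>_def subset_chain_def)
  next
    case False
    have "\<forall>G\<in>C. G \<subseteq> V C \<or> V C \<subseteq> G" using comparable[OF C] by blast
    then have "subset.chain W (insert (V C) C)"
      using C VW[OF C] unfolding subset_chain_def by blast
    then show ?thesis using False by (simp add: \<phi>_def)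
  qed
  have sign: "(-1) ^ card (\<phi> C) = - ((-1::int) ^ card C)" if C: "subset.chain W C" for C
  proof (cases "V C \<in> C")
    case True
    then have "card C = Suc (card (\<phi> C))" 
      using card_Suc_Diff1[OF finC[OF C] True] by (simp add: \<phi>_def)
    then show ?thesis by simp
  next
    case False then show ?thesis using finC[OF C] by (simp add: \<phi>_def)
  qed
  have "(\<Sum>C\<in>set_chains W. (-1) ^ card C) = (\<Sum>C\<in>set_chains W. - ((-1::int) ^ card C))"
    by (rule sum.reindex_bij_witness[of _ \<phi> \<phi>]) (auto simp: inv chain sign)
  then show ?thesis by (simp add: sum_negf)
qed

text \<open>The excess \<open>x(F) - rk(F)\<close> is supermodular. If \<open>T\<close> maximises it, joining \<open>T\<close> to another set does
  not decrease its excess, so the violated sets are closed under union with \<open>T\<close>.\<close>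
lemma sum_violated_chains:
  fixes M :: "'a matroid"
  defines "W x \<equiv> {F \<in> Pow (ground M). rk M F < mass x F}"
  shows "(\<Sum>C\<in>set_chains (W x). (-1) ^ card C) = (of_bool (W x = {}) :: int)"
proof (cases "W x = {}")
  case True
  then have "set_chains (W x) = {{}}" by (auto simp: subset_chain_def)
  then show ?thesis using True by simp
next
  case False
  define q where "q F = mass x F - rk M F" for F
  have finP: "finite (Pow (ground M))" using finite_ground[of M] by simp
  have "Max (q ` Pow (ground M)) \<in> q ` Pow (ground M)"
    using finP by (intro Max_in) auto
  then obtain T where T: "T \<subseteq> ground M" "q T = Max (q ` Pow (ground M))" by auto
  have q_le: "q F \<le> q T" if "F \<subseteq> ground M" for F
    unfolding T(2) using finP that by (intro Max_ge) auto
  have W_iff: "F \<in> W x \<longleftrightarrow> F \<subseteq> ground M \<and> q F > 0" for F by (auto simp: W_def q_def)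
  obtain F where "F \<in> W x" using False by blast
  then have "T \<in> W x" using q_le[of F] T(1) unfolding W_iff by linarith
  moreover have "F \<union> T \<in> W x" if "F \<in> W x" for F
  proof -
    have F: "F \<subseteq> ground M" "q F > 0" using that by (auto simp: W_iff)
    have "finite F" "finite T"
      using finite_subset[OF F(1) finite_ground] finite_subset[OF T(1) finite_ground] by auto
    then have "mass x (F \<union> T) + mass x (F \<inter> T) = mass x F + mass x T" by (rule sum.union_inter)
    then have "q F + q T \<le> q (F \<union> T) + q (F \<inter> T)"
      using rk_submodular[of M F T] by (simp add: q_def)
    also have "q (F \<inter> T) \<le> q T" using F(1) by (intro q_le) auto
    finally have "q (F \<union> T) > 0" using F(2) by linarith
    then show ?thesis using F(1) T(1) by (auto simp: W_iff)
  qed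
  moreover have "finite (W x)" using finP by (auto simp: W_def)
  ultimately show ?thesis using False by (simp add: sum_set_chains_eq_0)
qed

lemma ordering_adapted_to_chain:
  assumes "finite E" "subset.chain (Pow E) D"
  obtains xs where "distinct xs" "set xs = E" "\<And>F. F \<in> D \<Longrightarrow> \<exists>k\<le>length xs. F = seg xs 0 k"
proof -
  have "\<exists>xs. distinct xs \<and> set xs = E \<and> (\<forall>F\<in>D. \<exists>k\<le>length xs. F = seg xs 0 k)"
    using assms
  proof (induction "card E" arbitrary: E D)
    case 0
    then have "E = {}" by simp
    then have "\<forall>F\<in>D. F = seg [] 0 0" using 0 by (auto simp: subset_chain_def)
    then show ?case using \<open>E = {}\<close> by (intro exI[of _ "[]"]) auto
  next
    case (Suc n)
    define D' where "D' = D - {E}"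
    have D': "subset.chain (Pow E) D'" using Suc.prems(2) by (auto simp: D'_def subset_chain_def)
    have "\<Union>D' \<noteq> E"
    proof
      assume eq: "\<Union>D' = E"
      have "E \<noteq> {}" using Suc by auto
      then have "D' \<noteq> {}" using eq by auto
      moreover have "finite D'"
        using D' Suc.prems(1) by (auto simp: subset_chain_def intro: finite_subset[of D' "Pow E"])
      ultimately have "\<Union>D' \<in> D'" using D' by (intro Union_in_chain)
      then show False using eq by (simp add: D'_def)
    qed
    moreover have "\<Union>D' \<subseteq> E" using D' by (auto simp: subset_chain_def)
    ultimately obtain e where e: "e \<in> E" "e \<notin> \<Union>D'" by auto
    have "n = card (E - {e})" using Suc.hyps(2) Suc.prems(1) e by simp
    moreover have "subset.chain (Pow (E - {e})) D'" using D' e by (auto simp: subset_chain_def)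
    ultimately obtain ys where ys: "distinct ys" "set ys = E - {e}" "\<forall>F\<in>D'. \<exists>k\<le>length ys. F = seg ys 0 k"
      using Suc.hyps(1)[of "E - {e}" D'] Suc.prems(1) by auto
    have "\<exists>k\<le>length (ys @ [e]). F = seg (ys @ [e]) 0 k" if F: "F \<in> D" for F
    proof (cases "F = E")
      case True
      then have "F = seg (ys @ [e]) 0 (length (ys @ [e]))" using ys(2) e by (simp only: seg_all) auto
      then show ?thesis by blast
    next
      case False
      then obtain k where "k \<le> length ys" "F = seg ys 0 k" using ys(3) F by (auto simp: D'_def)
      then show ?thesis using seg_append1[of k ys "[e]" 0] by (intro exI[of _ k]) simp
    qed
    then show ?case using ys e by (intro exI[of _ "ys @ [e]"]) auto
  qed
  then show ?thesis using that by blast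
qed

definition rank_box :: "'a matroid \<Rightarrow> ('a \<Rightarrow>\<^sub>0 real) set" where
  "rank_box M = {x. (\<forall>e. 0 \<le> coord x e \<and> coord x e \<le> 1) \<and>
     (\<forall>e. e \<notin> ground M \<longrightarrow> coord x e = 0) \<and> mass x (ground M) = rk M (ground M)}"

lemma base_polytope_subset_rank_box: "base_polytope M \<subseteq> rank_box M"
proof
  fix x assume "x \<in> base_polytope M"
  then have x: "\<And>e. 0 \<le> coord x e" "\<And>e. e \<notin> ground M \<Longrightarrow> coord x e = 0"
      "mass x (ground M) = rk M (ground M)" "\<And>A. A \<subseteq> ground M \<Longrightarrow> mass x A \<le> rk M A"
    by (auto simp: base_polytope_eq_rank_polytope rank_polytope_def)
  have "coord x e \<le> 1" for e
  proof (cases "e \<in> ground M")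
    case True
    then have "mass x {e} \<le> rk M {e}" by (intro x(4)) auto
    then show ?thesis using rk_le_card[of "{e}" M] by simp
  qed (simp add: x)
  then show "x \<in> rank_box M" using x by (simp add: rank_box_def)
qed

text \<open>The rank inequalities for a chain of sets cut out the base polytope of an interval matroid:
  order the ground set so that the members of the chain become initial segments.\<close>
lemma nested_matroid_exists:
  assumes D: "subset.chain (Pow (ground M)) D"
  obtains xs l u where "feasible xs l u" "set xs = ground M" "{B. basis M B} \<subseteq> path_sets xs l u"
    "base_polytope (interval_matroid xs l u) = {x \<in> rank_box M. \<forall>F\<in>D. mass x F \<le> rk M F}"
proof -
  obtain xs where xs: "distinct xs" "set xs = ground M" "\<And>F. F \<in> D \<Longrightarrow> \<exists>k\<le>length xs. F = seg xs 0 k"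
    using ordering_adapted_to_chain[OF finite_ground D] by metis
  define r where "r = rk M (ground M)"
  define n where "n = length xs"
  define l :: "nat \<Rightarrow> int" where "l k = (if k = n then int r else 0)" for k
  define u :: "nat \<Rightarrow> int" where
    "u k = (if k = 0 then 0 else if seg xs 0 k \<in> D then int (rk M (seg xs 0 k)) else int r)" for k
  have seg_n: "seg xs 0 n = ground M" using xs(2) by (simp add: n_def seg_all)
  have r0: "r = 0" if "n = 0" using that seg_n by (simp add: r_def flip: seg_n)
  have u_n: "u n = int r" using r0 by (simp add: u_def seg_n r_def)
  have paths: "B \<in> path_sets xs l u" if B: "basis M B" for B
    unfolding path_sets_def
  proof (intro CollectI conjI allI impI)
    show sub: "B \<subseteq> set xs" using B basis_subset_ground xs(2) by blast
    fix k assume k: "k \<le> length xs"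
    have cB: "indep M B" "card B = r" using B by (auto simp: basis_iff r_def)
    have "B \<inter> ground M = B" using sub xs(2) by auto
    then show "l k \<le> int (card (B \<inter> seg xs 0 k))" using cB by (simp add: l_def seg_n)
    have "card (B \<inter> seg xs 0 k) \<le> r"
      using cB finite_basis[OF B] card_mono[of B "B \<inter> seg xs 0 k"] by simp
    then show "int (card (B \<inter> seg xs 0 k)) \<le> u k"
      using rk_indep_subset_Int[OF cB(1), of "seg xs 0 k"] by (simp add: u_def)
  qed
  obtain B where "basis M B" by (rule basis_exists)
  then have feas: "feasible xs l u"
    using paths xs(1) r0 u_n by (auto simp: feasible_def l_def u_def n_def[symmetric])
  have "x \<in> base_polytope (interval_matroid xs l u) \<longleftrightarrow> x \<in> rank_box M \<and> (\<forall>F\<in>D. mass x F \<le> rk M F)" for x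
  proof
    assume "x \<in> base_polytope (interval_matroid xs l u)"
    then have x: "\<forall>e. 0 \<le> coord x e \<and> coord x e \<le> 1"
      "\<forall>e. e \<notin> ground M \<longrightarrow> coord x e = 0"
      "\<And>k. k \<le> n \<Longrightarrow> of_int (l k) \<le> mass x (seg xs 0 k)"
      "\<And>k. k \<le> n \<Longrightarrow> mass x (seg xs 0 k) \<le> of_int (u k)"
      by (auto simp: base_polytope_interval_matroid[OF feas] xs(2) n_def)
    have "mass x (ground M) = r" using x(3)[of n] x(4)[of n] by (simp add: seg_n u_n l_def)
    moreover have "mass x F \<le> rk M F" if F: "F \<in> D" for F
    proof -
      obtain k where k: "k \<le> n" "F = seg xs 0 k" using xs(3)[OF F] by (auto simp: n_def)
      then show ?thesis using x(4)[of k] F by (cases "k = 0") (auto simp: u_def)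
    qed
    ultimately show "x \<in> rank_box M \<and> (\<forall>F\<in>D. mass x F \<le> rk M F)"
      using x by (auto simp: rank_box_def r_def)
  next
    assume *: "x \<in> rank_box M \<and> (\<forall>F\<in>D. mass x F \<le> rk M F)"
    then have x: "\<forall>e. 0 \<le> coord x e \<and> coord x e \<le> 1"
      "\<forall>e. e \<notin> ground M \<longrightarrow> coord x e = 0" "mass x (ground M) = r"
      by (auto simp: rank_box_def r_def)
    have nonneg: "0 \<le> mass x A" for A using x(1) by (simp add: sum_nonneg)
    have "of_int (l k) \<le> mass x (seg xs 0 k) \<and> mass x (seg xs 0 k) \<le> of_int (u k)" if k: "k \<le> n" for k
    proof -
      have "mass x (seg xs 0 k) \<le> mass x (ground M)"
        using k x(1) xs(2) seg_subset_set[of k xs 0] finite_ground[of M] by (intro sum_mono2) (auto simp: n_def)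
      then show ?thesis using * x(3) nonneg k r0 by (auto simp: l_def u_def seg_n)
    qed
    then show "x \<in> base_polytope (interval_matroid xs l u)"
      using x by (auto simp: base_polytope_interval_matroid[OF feas] xs(2) n_def)
  qed
  then have "base_polytope (interval_matroid xs l u) = {x \<in> rank_box M. \<forall>F\<in>D. mass x F \<le> rk M F}" by auto
  then show ?thesis using that feas xs(2) paths by blast
qed

text \<open>Inclusion-exclusion over the chains of violated rank inequalities writes the indicator
  function of a base polytope as an integer combination of those of nested matroids. All bases of
  \<open>M\<close> are bases of these matroids, which later excludes loops and coloops.\<close>
theorem valuative_eq_if_eq_on_interval_matroids:
  fixes f h :: "'a matroid \<Rightarrow> int"
  assumes f: "valuative f" and h: "valuative h"
    and eq: "\<And>xs l u. feasible xs l u \<Longrightarrow> set xs = ground M \<Longrightarrow> {B. basis M B} \<subseteq> path_sets xs l u \<Longrightarrow>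
      f (interval_matroid xs l u) = h (interval_matroid xs l u)"
  shows "f M = h M"
proof -
  let ?E = "ground M"
  have finP: "finite (Pow ?E)" using finite_ground[of M] by simp
  define P where "P D N \<longleftrightarrow> ground N = ?E \<and> f N = h N \<and>
      base_polytope N = {x \<in> rank_box M. \<forall>F\<in>D. mass x F \<le> rk M F}" for D N
  have ex: "\<exists>N. P D N" if D: "subset.chain (Pow ?E) D" for D
  proof -
    obtain xs l u where *: "feasible xs l u" "set xs = ?E" "{B. basis M B} \<subseteq> path_sets xs l u"
      "base_polytope (interval_matroid xs l u) = {x \<in> rank_box M. \<forall>F\<in>D. mass x F \<le> rk M F}"
      by (rule nested_matroid_exists[OF D])
    show ?thesis
      by (rule exI[of _ "interval_matroid xs l u"])
        (simp only: P_def eq[OF *(1-3)] ground_interval_matroid[OF *(1)] *(2,4) simp_thms)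
  qed
  define N where "N D = (SOME N. P D N)" for D
  have PN: "P D (N D)" if "subset.chain (Pow ?E) D" for D
    unfolding N_def using ex[OF that] by (rule someI_ex)
  have N1: "ground (N D) = ?E" and N2: "f (N D) = h (N D)"
    and N3: "base_polytope (N D) = {x \<in> rank_box M. \<forall>F\<in>D. mass x F \<le> rk M F}"
    if "subset.chain (Pow ?E) D" for D
    using PN[OF that] unfolding P_def by blast+
  \<comment> \<open>The chain \<open>C\<close> stands for the inequalities required to be violated; expanding each violation as
    one minus satisfaction singles out a subchain \<open>D\<close> of satisfied inequalities.\<close>
  define K where "K = Sigma (set_chains (Pow ?E)) Pow"
  define a :: "'a set set \<times> 'a set set \<Rightarrow> int" where "a k = (-1) ^ (card (fst k) + card (snd k))" for k
  have fin_chains: "finite (set_chains (Pow ?E))"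
  proof (rule finite_subset)
    show "set_chains (Pow ?E) \<subseteq> Pow (Pow ?E)" by (simp add: subset_chain_def Collect_mono_iff Pow_def)
    show "finite (Pow (Pow ?E))" using finP by simp
  qed
  have fin_chain: "finite C" if "subset.chain (Pow ?E) C" for C
  proof (rule finite_subset[OF _ finP])
    show "C \<subseteq> Pow ?E" using that by (simp add: subset_chain_def)
  qed
  have finK: "finite K" unfolding K_def
    by (rule finite_SigmaI[OF fin_chains]) (simp add: fin_chain)
  have chainK: "subset.chain (Pow ?E) (snd k)" if "k \<in> K" for k
  proof -
    have "subset.chain (Pow ?E) (fst k)" "snd k \<subseteq> fst k" using that by (auto simp: K_def)
    then show ?thesis unfolding subset_chain_def by blast
  qed
  have ind: "indicator (base_polytope M) x = (\<Sum>k\<in>K. a k * indicator (base_polytope (N (snd k))) x)" for x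
  proof (cases "x \<in> rank_box M")
    case False
    then have "x \<notin> base_polytope M" using base_polytope_subset_rank_box by blast
    moreover have "x \<notin> base_polytope (N (snd k))" if "k \<in> K" for k
      using False N3[OF chainK[OF that]] by simp
    ultimately show ?thesis by simp
  next
    case True
    define W where "W = {F \<in> Pow ?E. rk M F < mass x F}"
    define c :: "'a set \<Rightarrow> int" where "c F = of_bool (F \<notin> W)" for F
    have "(\<Sum>k\<in>K. a k * indicator (base_polytope (N (snd k))) x)
      = (\<Sum>k\<in>K. (-1) ^ card (fst k) * ((-1) ^ card (snd k) * prod c (snd k)))"
    proof (intro sum.cong refl)
      fix k assume k: "k \<in> K"
      have sub: "snd k \<subseteq> Pow ?E" "finite (snd k)"
        using chainK[OF k] fin_chain[OF chainK[OF k]] by (auto simp: subset_chain_def)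
      have "indicator (base_polytope (N (snd k))) x = (of_bool (\<forall>F\<in>snd k. mass x F \<le> rk M F) :: int)"
        using True N3[OF chainK[OF k]] by (simp add: indicator_def)
      also have "\<dots> = of_bool (\<forall>F\<in>snd k. F \<notin> W)"
        using sub(1) by (intro arg_cong[where f = of_bool] ball_cong) (auto simp: W_def not_less)
      also have "\<dots> = prod c (snd k)"
        using sub(2) by (cases "\<forall>F\<in>snd k. F \<notin> W") (auto simp: c_def)
      finally show "a k * indicator (base_polytope (N (snd k))) x
          = (-1) ^ card (fst k) * ((-1) ^ card (snd k) * prod c (snd k))"
        by (simp add: a_def power_add)
    qed
    also have "\<dots> = (\<Sum>C\<in>set_chains (Pow ?E). \<Sum>D\<in>Pow C. (-1) ^ card C * ((-1) ^ card D * prod c D))"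
      unfolding K_def using fin_chains fin_chain by (subst sum.Sigma) (auto simp: case_prod_beta)
    also have "\<dots> = (\<Sum>C\<in>set_chains (Pow ?E). (-1) ^ card C * of_bool (C \<subseteq> W))"
    proof (intro sum.cong refl)
      fix C assume C: "C \<in> set_chains (Pow ?E)"
      then have "(\<Sum>D\<in>Pow C. (-1) ^ card D * prod c D) = (\<Prod>F\<in>C. 1 - c F)"
        using fin_chain by (simp add: prod_diff_conv_sum)
      also have "\<dots> = of_bool (C \<subseteq> W)"
      proof (cases "C \<subseteq> W")
        case True
        then have "\<forall>F\<in>C. 1 - c F = 1" by (auto simp: c_def)
        then show ?thesis using True by (simp add: prod.neutral)
      next
        case False
        then have "\<exists>F\<in>C. 1 - c F = 0" by (auto simp: c_def)
        then show ?thesis using False C fin_chain by (simp add: prod_zero)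
      qed
      finally show "(\<Sum>D\<in>Pow C. (-1) ^ card C * ((-1) ^ card D * prod c D)) = (-1) ^ card C * of_bool (C \<subseteq> W)"
        by (simp flip: sum_distrib_left)
    qed
    also have "\<dots> = (\<Sum>C\<in>set_chains W. (-1) ^ card C)"
      using fin_chains by (intro sum.mono_neutral_cong_right) (auto simp: subset_chain_def W_def)
    also have "\<dots> = of_bool (W = {})" unfolding W_def by (rule sum_violated_chains)
    also have "\<dots> = indicator (base_polytope M) x"
      using True by (auto simp: W_def base_polytope_eq_rank_polytope rank_polytope_def rank_box_def
          indicator_def not_less)
    finally show ?thesis by simp
  qed
  have val: "F M = (\<Sum>k\<in>K. a k * F (N (snd k)))" if "valuative F" for F :: "'a matroid \<Rightarrow> int"
    using N1[OF chainK] by (rule valuative_sum_eq[OF that finK _ ind])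
  have "f M = (\<Sum>k\<in>K. a k * f (N (snd k)))" by (rule val[OF f])
  also have "\<dots> = (\<Sum>k\<in>K. a k * h (N (snd k)))"
    using N2[OF chainK] by (intro sum.cong refl) simp
  also have "\<dots> = h M" by (rule val[OF h, symmetric])
  finally show ?thesis .
qed

section \<open>The alternating rank form\<close>

lemma sum_Pow_insert:
  assumes "finite E" "e \<notin> E"
  shows "(\<Sum>A\<in>Pow (insert e E). F A) = (\<Sum>A\<in>Pow E. F A) + (\<Sum>A\<in>Pow E. F (insert e A))"
proof -
  have "inj_on (insert e) (Pow E)" using assms(2) by (auto simp: inj_on_def)
  moreover have "Pow E \<inter> insert e ` Pow E = {}" using assms(2) by auto
  ultimately show ?thesis
    using assms(1) by (simp add: Pow_insert sum.union_disjoint sum.reindex)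
qed

lemma moebius_form_cong:
  assumes "E = E'" "\<And>A. A \<subseteq> E \<Longrightarrow> f A = f' A" "\<And>A. A \<subseteq> E \<Longrightarrow> h A = h' A"
  shows "moebius_form E f h = moebius_form E' f' h'"
  unfolding moebius_form_def assms(1)[symmetric]
proof (intro sum.cong refl)
  fix A B assume "A \<in> Pow E" "B \<in> Pow A"
  then have "A \<subseteq> E" "B \<subseteq> E" by auto
  then show "(-1) ^ (card A + card B) * (f A * h B) = (-1) ^ (card A + card B) * (f' A * h' B)"
    by (simp add: assms(2,3))
qed

lemma moebius_form_empty [simp]: "moebius_form {} f h = f {} * h {}"
  by (simp add: moebius_form_def)

lemma moebius_form_add_left:
  "moebius_form E (\<lambda>A. f A + f' A) h = moebius_form E f h + moebius_form E f' h"
  by (simp add: moebius_form_def sum.distrib algebra_simps)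

lemma moebius_form_diff_right:
  "moebius_form E f (\<lambda>B. h B - h' B) = moebius_form E f h - moebius_form E f h'"
  by (simp add: moebius_form_def sum_subtractf algebra_simps)

text \<open>Of the three ways to place \<open>e\<close>, those with \<open>e\<close> in \<open>A\<close> combine into a difference in \<open>B\<close>. This
  recursion drives all computations with the form.\<close>
lemma moebius_form_insert:
  assumes E: "finite E" "e \<notin> E"
  shows "moebius_form (insert e E) f h
    = moebius_form E f h + moebius_form E (\<lambda>A. f (insert e A)) (\<lambda>B. h (insert e B) - h B)"
proof -
  have key: "(\<Sum>B\<in>Pow (insert e A). (-1) ^ (card (insert e A) + card B) * (f (insert e A) * h B))
      = (\<Sum>B\<in>Pow A. (-1) ^ (card A + card B) * (f (insert e A) * (h (insert e B) - h B)))"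
    if A: "A \<in> Pow E" for A
  proof -
    have fin: "finite A" "e \<notin> A" using A E finite_subset by auto
    have "card (insert e B) = Suc (card B)" if "B \<in> Pow A" for B
      using that fin finite_subset[of B A] by (subst card_insert_disjoint) auto
    then show ?thesis using fin
      by (simp add: sum_Pow_insert algebra_simps flip: sum.distrib)
  qed
  show ?thesis
    unfolding moebius_form_def sum_Pow_insert[OF E]
    by (rule arg_cong[where f = "(+) _", OF sum.cong[OF refl key]])
qed

lemma moebius_form_const_right:
  assumes "finite E" shows "moebius_form E f (\<lambda>_. c) = f {} * c"
  using assms
proof (induction E)
  case (insert e E)
  have "moebius_form E g (\<lambda>_. 0) = 0" for g by (simp add: moebius_form_def)
  then show ?case using insert by (simp add: moebius_form_insert)
qed simp

lemma moebius_form_const_left: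
  assumes "finite E" shows "moebius_form E (\<lambda>_. c) h = c * h E"
  using assms
proof (induction E arbitrary: h)
  case (insert e E)
  then show ?case by (simp add: moebius_form_insert algebra_simps)
qed simp

text \<open>The mixed terms degenerate because pairing with a constant evaluates at the empty set or at
  the whole set; for rank functions they vanish.\<close>
lemma moebius_form_direct_sum:
  assumes "finite E1" "finite E2" "E1 \<inter> E2 = {}"
    and "\<And>A B. A \<subseteq> E1 \<Longrightarrow> B \<subseteq> E2 \<Longrightarrow> f (A \<union> B) = f1 A + f2 B"
    and "\<And>A B. A \<subseteq> E1 \<Longrightarrow> B \<subseteq> E2 \<Longrightarrow> h (A \<union> B) = h1 A + h2 B"
  shows "moebius_form (E1 \<union> E2) f h
    = moebius_form E1 f1 h1 + moebius_form E2 f2 h2 + f1 {} * h2 E2 + f2 {} * h1 E1"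
  using assms(2-)
proof (induction E2 arbitrary: f h f2 h1 h2)
  case empty
  have "moebius_form E1 f h = moebius_form E1 (\<lambda>A. f1 A + f2 {}) (\<lambda>A. h1 A - (- h2 {}))"
    using empty.prems(2,3)[of _ "{}"] by (intro moebius_form_cong) auto
  then show ?case
    unfolding moebius_form_diff_right moebius_form_add_left
      moebius_form_const_left[OF assms(1)] moebius_form_const_right[OF assms(1)] by simp
next
  case (insert e E2)
  let ?E = "E1 \<union> E2"
  have e: "e \<notin> ?E" "finite ?E" "E1 \<inter> E2 = {}" using insert assms(1) by auto
  have "moebius_form (E1 \<union> insert e E2) f h = moebius_form ?E f h
    + moebius_form ?E (\<lambda>A. f (insert e A)) (\<lambda>A. h (insert e A) - h A)"
    unfolding Un_insert_right by (rule moebius_form_insert[OF e(2,1)])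
  also have "moebius_form ?E f h
      = moebius_form E1 f1 h1 + moebius_form E2 f2 h2 + f1 {} * h2 E2 + f2 {} * h1 E1"
    by (rule insert.IH[OF e(3)]) (rule insert.prems(2,3), assumption, erule subset_insertI2)+
  also have "moebius_form ?E (\<lambda>A. f (insert e A)) (\<lambda>A. h (insert e A) - h A)
      = moebius_form E1 f1 (\<lambda>_. 0)
      + moebius_form E2 (\<lambda>B. f2 (insert e B)) (\<lambda>B. h2 (insert e B) - h2 B)
      + f1 {} * (h2 (insert e E2) - h2 E2) + f2 (insert e {}) * 0"
  proof (rule insert.IH[OF e(3)])
    fix A B assume AB: "A \<subseteq> E1" "B \<subseteq> E2"
    then show "f (insert e (A \<union> B)) = f1 A + f2 (insert e B)"
      using insert.prems(2)[of A "insert e B"] by auto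
    show "h (insert e (A \<union> B)) - h (A \<union> B) = 0 + (h2 (insert e B) - h2 B)"
      using AB subset_insertI2[OF AB(2), of e] insert.prems(3)[of A "insert e B"] insert.prems(3)[of A B] by auto
  qed
  finally show ?case using e insert.hyps
    by (simp add: moebius_form_insert moebius_form_const_right[OF assms(1)] algebra_simps)
qed

lemma indep_iff_rk: "finite A \<Longrightarrow> indep M A \<longleftrightarrow> rk M A = card A"
  using rk_indep[of M A] rk_witness[of A M] card_subset_eq[of A] by metis

lemma rk_cong_indep:
  assumes "\<And>I. I \<subseteq> A \<Longrightarrow> indep M I \<longleftrightarrow> indep N I" shows "rk M A = rk N A"
proof -
  have "{I. I \<subseteq> A \<and> indep M I} = {I. I \<subseteq> A \<and> indep N I}" using assms by auto
  then show ?thesis by (simp add: rk_def)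
qed

section \<open>Direct sums\<close>

context
  fixes M M1 M2 :: "'a matroid"
  assumes sum: "is_direct_sum M M1 M2"
begin

lemma direct_sum_ground: "ground M1 \<inter> ground M2 = {}" "ground M = ground M1 \<union> ground M2"
  using sum by (auto simp: is_direct_sum_def)

lemma direct_sum_indep:
  "A \<subseteq> ground M \<Longrightarrow> indep M A \<longleftrightarrow> indep M1 (A \<inter> ground M1) \<and> indep M2 (A \<inter> ground M2)"
  using sum by (auto simp: is_direct_sum_def)

lemma direct_sum_rk:
  assumes A: "A \<subseteq> ground M"
  shows "rk M A = rk M1 (A \<inter> ground M1) + rk M2 (A \<inter> ground M2)"
proof (rule antisym)
  have split: "card I = card (I \<inter> ground M1) + card (I \<inter> ground M2)" if "I \<subseteq> ground M" for I
  proof -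
    have "I = (I \<inter> ground M1) \<union> (I \<inter> ground M2)" using that direct_sum_ground by auto
    moreover have "finite I" using that finite_ground finite_subset by metis
    ultimately show ?thesis
      using direct_sum_ground(1) card_Un_disjoint[of "I \<inter> ground M1" "I \<inter> ground M2"] by auto
  qed
  show "rk M A \<le> rk M1 (A \<inter> ground M1) + rk M2 (A \<inter> ground M2)"
  proof (rule rk_le)
    fix I assume I: "I \<subseteq> A" "indep M I"
    then have "card (I \<inter> ground M1) \<le> rk M1 (A \<inter> ground M1)" "card (I \<inter> ground M2) \<le> rk M2 (A \<inter> ground M2)"
      using A direct_sum_indep[of I] by (auto intro!: card_indep_le_rk)
    then show "card I \<le> rk M1 (A \<inter> ground M1) + rk M2 (A \<inter> ground M2)" using split[of I] I A by simp
  qed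
  obtain I1 where I1: "I1 \<subseteq> A \<inter> ground M1" "indep M1 I1" "card I1 = rk M1 (A \<inter> ground M1)" by (rule rk_witness)
  obtain I2 where I2: "I2 \<subseteq> A \<inter> ground M2" "indep M2 I2" "card I2 = rk M2 (A \<inter> ground M2)" by (rule rk_witness)
  have *: "(I1 \<union> I2) \<inter> ground M1 = I1" "(I1 \<union> I2) \<inter> ground M2 = I2" "I1 \<union> I2 \<subseteq> ground M"
    using I1(1) I2(1) A direct_sum_ground by auto
  then have "indep M (I1 \<union> I2)" using direct_sum_indep[of "I1 \<union> I2"] I1 I2 by simp
  then have "card (I1 \<union> I2) \<le> rk M A" using I1 I2 by (intro card_indep_le_rk) auto
  then show "rk M1 (A \<inter> ground M1) + rk M2 (A \<inter> ground M2) \<le> rk M A"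
    using split[OF *(3)] I1(3) I2(3) by (simp add: *(1,2))
qed

lemma rank_form_direct_sum: "rank_form M = rank_form M1 + rank_form M2"
proof -
  have rk: "int (rk M (A \<union> B)) = int (rk M1 A) + int (rk M2 B)" if "A \<subseteq> ground M1" "B \<subseteq> ground M2" for A B
  proof -
    have "(A \<union> B) \<inter> ground M1 = A" "(A \<union> B) \<inter> ground M2 = B" "A \<union> B \<subseteq> ground M"
      using that direct_sum_ground by auto
    then show ?thesis using direct_sum_rk[of "A \<union> B"] by simp
  qed
  have "rank_form M = rank_form M1 + rank_form M2
      + int (rk M1 {}) * int (rk M2 (ground M2)) + int (rk M2 {}) * int (rk M1 (ground M1))"
    unfolding rank_form_def direct_sum_ground(2)
    by (rule moebius_form_direct_sum[OF finite_ground finite_ground direct_sum_ground(1)])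
      (rule rk; assumption)+
  then show ?thesis by simp
qed

lemma direct_sum_circuit: "circuit M C \<longleftrightarrow> circuit M1 C \<or> circuit M2 C"
proof -
  have 1: "indep M A \<longleftrightarrow> indep M1 A" if "A \<subseteq> ground M1" for A
  proof -
    have "A \<inter> ground M1 = A" "A \<inter> ground M2 = {}" using that direct_sum_ground by auto
    then show ?thesis using direct_sum_indep[of A] that direct_sum_ground(2) indep_empty[of M2] by auto
  qed
  have 2: "indep M A \<longleftrightarrow> indep M2 A" if "A \<subseteq> ground M2" for A
  proof -
    have "A \<inter> ground M2 = A" "A \<inter> ground M1 = {}" using that direct_sum_ground by auto
    then show ?thesis using direct_sum_indep[of A] that direct_sum_ground(2) indep_empty[of M1] by auto
  qed
  have c1: "circuit M C \<longleftrightarrow> circuit M1 C" if C: "C \<subseteq> ground M1" for C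
  proof -
    have "C \<subseteq> ground M" using C direct_sum_ground(2) by auto
    moreover have "(D \<subset> C \<longrightarrow> indep M D) \<longleftrightarrow> (D \<subset> C \<longrightarrow> indep M1 D)" for D using C 1[of D] by auto
    ultimately show ?thesis using C 1[OF C] by (simp add: circuit_def)
  qed
  have c2: "circuit M C \<longleftrightarrow> circuit M2 C" if C: "C \<subseteq> ground M2" for C
  proof -
    have "C \<subseteq> ground M" using C direct_sum_ground(2) by auto
    moreover have "(D \<subset> C \<longrightarrow> indep M D) \<longleftrightarrow> (D \<subset> C \<longrightarrow> indep M2 D)" for D using C 2[of D] by auto
    ultimately show ?thesis using C 2[OF C] by (simp add: circuit_def)
  qed
  have "C \<subseteq> ground M1 \<or> C \<subseteq> ground M2" if C: "circuit M C"
  proof (rule ccontr)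
    assume "\<not> (C \<subseteq> ground M1 \<or> C \<subseteq> ground M2)"
    then have "C \<inter> ground M1 \<subset> C" "C \<inter> ground M2 \<subset> C" by auto
    then have "indep M (C \<inter> ground M1)" "indep M (C \<inter> ground M2)" using C by (auto simp: circuit_def)
    then have "indep M C" using C 1[of "C \<inter> ground M1"] 2[of "C \<inter> ground M2"] direct_sum_indep[of C]
      by (auto simp: circuit_def)
    then show False using C by (simp add: circuit_def)
  qed
  moreover have "C \<subseteq> ground M1" if "circuit M1 C" using that by (simp add: circuit_def)
  moreover have "C \<subseteq> ground M2" if "circuit M2 C" using that by (simp add: circuit_def)
  ultimately show ?thesis using c1 c2 by blast
qed

lemma num_components_direct_sum: "num_components M = num_components M1 + num_components M2"
proof -
  have R: "connected_rel M = connected_rel M1 \<union> connected_rel M2"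
    using direct_sum_ground
    by (auto simp: connected_rel_def direct_sum_circuit dest: circuit_def[THEN iffD1])
  have sub: "connected_rel N \<subseteq> ground N \<times> ground N" for N :: "'a matroid"
    by (auto simp: connected_rel_def)
  have ne: "x \<in> connected_rel N `` {x}" if "x \<in> ground N" for x and N :: "'a matroid"
    using that by (auto simp: connected_rel_def)
  have q: "ground N // connected_rel N = (\<lambda>x. connected_rel N `` {x}) ` ground N" for N :: "'a matroid"
    by (auto simp: quotient_def)
  have fin: "finite (ground N // connected_rel N)" for N :: "'a matroid"
    unfolding q by (intro finite_imageI finite_ground)
  have im1: "connected_rel M `` {x} = connected_rel M1 `` {x}" if "x \<in> ground M1" for x
    using that R sub[of M2] direct_sum_ground by auto
  have im2: "connected_rel M `` {x} = connected_rel M2 `` {x}" if "x \<in> ground M2" for x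
    using that R sub[of M1] direct_sum_ground by auto
  have "ground M // connected_rel M = ground M1 // connected_rel M1 \<union> ground M2 // connected_rel M2"
    unfolding q unfolding direct_sum_ground(2) image_Un using im1 im2 by (simp cong: image_cong)
  moreover have "(ground M1 // connected_rel M1) \<inter> (ground M2 // connected_rel M2) = {}"
  proof (rule ccontr)
    assume "(ground M1 // connected_rel M1) \<inter> (ground M2 // connected_rel M2) \<noteq> {}"
    then obtain x y where xy: "x \<in> ground M1" "y \<in> ground M2" "connected_rel M1 `` {x} = connected_rel M2 `` {y}"
      unfolding q by auto
    then have "x \<in> connected_rel M2 `` {y}" using ne by metis
    then show False using xy(1) sub[of M2] direct_sum_ground(1) by auto
  qed
  ultimately show ?thesis unfolding num_components_def by (simp add: card_Un_disjoint fin)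
qed

end

section \<open>Series-parallel matroids\<close>

text \<open>Any two elements lie on a common circuit; in this form connectedness is inherited by
  parallel and series extensions.\<close>
definition circuit_connected :: "'a matroid \<Rightarrow> bool" where
  "circuit_connected M \<longleftrightarrow> 2 \<le> card (ground M) \<and>
     (\<forall>x\<in>ground M. \<forall>y\<in>ground M. x \<noteq> y \<longrightarrow> (\<exists>C. circuit M C \<and> x \<in> C \<and> y \<in> C))"

lemma circuit_connected_obtain_circuit:
  assumes "circuit_connected M" "f \<in> ground M"
  obtains C x where "circuit M C" "f \<in> C" "x \<in> C" "x \<noteq> f"
proof -
  have "ground M \<noteq> {f}" using assms(1) by (auto simp: circuit_connected_def)
  then obtain x where "x \<in> ground M" "x \<noteq> f" using assms(2) by blast
  then obtain C where "circuit M C" "f \<in> C" "x \<in> C"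
    using assms by (metis circuit_connected_def)
  then show ?thesis using that \<open>x \<noteq> f\<close> by blast
qed

lemma circuit_connected_insertI:
  assumes M: "circuit_connected M" and e: "e \<notin> ground M" "ground N = insert e (ground M)"
    and old: "\<And>x y. x \<in> ground M \<Longrightarrow> y \<in> ground M \<Longrightarrow> x \<noteq> y \<Longrightarrow> \<exists>C. circuit N C \<and> x \<in> C \<and> y \<in> C"
    and new: "\<And>y. y \<in> ground M \<Longrightarrow> \<exists>C. circuit N C \<and> e \<in> C \<and> y \<in> C"
  shows "circuit_connected N"
proof -
  have "\<exists>C. circuit N C \<and> x \<in> C \<and> y \<in> C" if xy: "x \<in> ground N" "y \<in> ground N" "x \<noteq> y" for x y
  proof -
    consider "x = e" "y \<in> ground M" | "y = e" "x \<in> ground M" | "x \<in> ground M" "y \<in> ground M"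
      using xy unfolding e(2) by blast
    then show ?thesis
    proof cases
      case 1 then show ?thesis using new[of y] by blast
    next
      case 2 then show ?thesis using new[of x] by blast
    next
      case 3 then show ?thesis using old xy(3) by blast
    qed
  qed
  moreover have "2 \<le> card (ground N)"
    using M e finite_ground[of M] by (simp add: circuit_connected_def)
  ultimately show ?thesis unfolding circuit_connected_def by blast
qed

lemma circuit_connected_num_components:
  assumes "circuit_connected M" shows "num_components M = 1"
proof -
  have "connected_rel M = ground M \<times> ground M"
    using assms by (auto simp: connected_rel_def circuit_connected_def)
  moreover have "ground M \<noteq> {}" using assms by (auto simp: circuit_connected_def)
  ultimately have "ground M // connected_rel M = {ground M}" by (auto simp: quotient_def)
  then show ?thesis by (simp add: num_components_def)
qed

lemma circuit_connected_rk_singleton: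
  assumes "circuit_connected M" "f \<in> ground M" shows "rk M {f} = 1"
proof -
  obtain C x where C: "circuit M C" "f \<in> C" "x \<in> C" "x \<noteq> f"
    by (rule circuit_connected_obtain_circuit[OF assms])
  then have "{f} \<subset> C" by auto
  then have "indep M {f}" using C(1) by (simp add: circuit_def)
  then show ?thesis by (simp add: rk_indep)
qed

lemma circuit_connected_rk_delete:
  assumes "circuit_connected M" "f \<in> ground M" shows "rk M (ground M - {f}) = rk M (ground M)"
proof -
  obtain C x where C: "circuit M C" "f \<in> C" "x \<in> C" "x \<noteq> f"
    by (rule circuit_connected_obtain_circuit[OF assms])
  have CE: "C \<subseteq> ground M" using C by (simp add: circuit_def)
  have finC: "finite C" by (rule finite_subset[OF CE finite_ground])
  have "C - {f} \<subset> C" using C(2) by auto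
  then have "indep M (C - {f})" using C(1) by (simp add: circuit_def)
  then have rC: "rk M (C - {f}) = card C - 1" using C(2) finC by (simp add: rk_indep)
  have "rk M C \<noteq> card C" using C(1) finC by (simp add: circuit_def indep_iff_rk)
  then have rC': "rk M C \<le> card C - 1" using rk_le_card[OF finC, of M] by simp
  have "(ground M - {f}) \<union> C = ground M" "(ground M - {f}) \<inter> C = C - {f}" using C CE by auto
  then have "rk M (ground M) + rk M (C - {f}) \<le> rk M (ground M - {f}) + rk M C"
    using rk_submodular[of M "ground M - {f}" C] by simp
  then show ?thesis using rC rC' rk_mono[of "ground M - {f}" "ground M" M] by simp
qed

context
  fixes M N :: "'a matroid" and e f :: 'a
  assumes e: "e \<notin> ground M" and f: "f \<in> ground M" and gr: "ground N = insert e (ground M)"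
    and circ: "circuit N {e, f}" and del: "\<And>A. A \<subseteq> ground M \<Longrightarrow> indep M A \<longleftrightarrow> indep N A"
begin

lemma parallel_rk_delete: "A \<subseteq> ground M \<Longrightarrow> rk N A = rk M A"
  using del by (intro rk_cong_indep) auto

lemma parallel_rk_insert: "rk N (insert e A) = rk N (insert f A)" "rk N (insert e (insert f A)) = rk N (insert f A)"
proof -
  have ef: "e \<noteq> f" using e f by auto
  have "{e} \<subset> {e, f}" "{f} \<subset> {e, f}" using ef by auto
  then have "indep N {e}" "indep N {f}" using circ by (simp_all add: circuit_def)
  then have 1: "rk N {e} = 1" "rk N {f} = 1" by (simp_all add: rk_indep)
  have "rk N {e, f} \<noteq> card {e, f}" using circ by (simp add: circuit_def flip: indep_iff_rk)
  then have 2: "rk N {e, f} \<le> 1" using rk_le_card[of "{e, f}" N] ef by simp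
  have *: "rk N (insert e (insert f A)) \<le> rk N (insert g A)" if g: "g = e \<or> g = f" for g
  proof -
    have un: "insert g A \<union> {e, f} = insert e (insert f A)" using g by auto
    have "rk N {g} \<le> rk N (insert g A \<inter> {e, f})" using g by (intro rk_mono) auto
    moreover have "rk N (insert e (insert f A)) + rk N (insert g A \<inter> {e, f}) \<le> rk N (insert g A) + rk N {e, f}"
      using rk_submodular[of N "insert g A" "{e, f}"] unfolding un .
    moreover have "rk N {g} = 1" using 1 g by auto
    ultimately show ?thesis using 2 by linarith
  qed
  have "rk N (insert e A) \<le> rk N (insert e (insert f A))" "rk N (insert f A) \<le> rk N (insert e (insert f A))"
    by (auto intro: rk_mono)
  then show "rk N (insert e A) = rk N (insert f A)" "rk N (insert e (insert f A)) = rk N (insert f A)"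
    using *[of e] *[of f] by auto
qed

text \<open>The increment of the rank upon adding \<open>e\<close> vanishes on sets containing \<open>f\<close>, so the
  contributions of \<open>e\<close> from sets without and with \<open>f\<close> cancel.\<close>
lemma parallel_rank_form: "rank_form N = rank_form M"
proof -
  define E where "E = ground M - {f}"
  have E: "finite E" "f \<notin> E" "e \<notin> insert f E" "ground M = insert f E" "e \<notin> E"
    using finite_ground[of M] e f by (auto simp: E_def)
  define p where "p A = int (rk N A)" for A
  have "rank_form N = moebius_form (insert e (insert f E)) p p"
    unfolding rank_form_def gr E(4) p_def[abs_def] ..
  also have "\<dots> = moebius_form (insert f E) p p
      + moebius_form (insert f E) (\<lambda>A. p (insert e A)) (\<lambda>A. p (insert e A) - p A)"
    using E by (intro moebius_form_insert) auto
  also have "moebius_form (insert f E) (\<lambda>A. p (insert e A)) (\<lambda>A. p (insert e A) - p A) = 0"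
    using E by (simp add: moebius_form_insert p_def parallel_rk_insert insert_absorb
        moebius_form_diff_right moebius_form_const_right)
  also have "moebius_form (insert f E) p p = rank_form M"
    unfolding rank_form_def p_def using E(4) by (intro moebius_form_cong) (auto simp: parallel_rk_delete)
  finally show ?thesis by simp
qed

lemma parallel_circuit_connected:
  assumes conn: "circuit_connected M" shows "circuit_connected N"
proof -
  have ef: "e \<noteq> f" using e f by auto
  have swap: "indep N (insert e A) \<longleftrightarrow> indep N (insert f A)" if A: "A \<subseteq> ground M" "f \<notin> A" for A
  proof -
    have "finite A" using finite_subset[OF A(1) finite_ground] .
    moreover have "e \<notin> A" using A e by auto
    ultimately show ?thesis using A(2) by (simp add: indep_iff_rk parallel_rk_insert)
  qed
  have old: "circuit N C" if C: "circuit M C" for C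
    unfolding circuit_def
  proof (intro conjI allI impI)
    have CM: "C \<subseteq> ground M" using C by (simp add: circuit_def)
    then show "C \<subseteq> ground N" using gr by auto
    show "\<not> indep N C" using C del[OF CM] by (simp add: circuit_def)
    fix D assume "D \<subset> C"
    then show "indep N D" using C del[of D] CM by (auto simp: circuit_def)
  qed
  have new: "circuit N (insert e (C - {f}))" if C: "circuit M C" "f \<in> C" for C
    unfolding circuit_def
  proof (intro conjI allI impI)
    have CM: "C \<subseteq> ground M" using C by (simp add: circuit_def)
    then show "insert e (C - {f}) \<subseteq> ground N" using gr by auto
    have "insert f (C - {f}) = C" using C(2) by auto
    then have "\<not> indep N (insert f (C - {f}))" using old[OF C(1)] by (simp add: circuit_def)
    then show "\<not> indep N (insert e (C - {f}))" using swap[of "C - {f}"] CM by auto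
    fix D assume D: "D \<subset> insert e (C - {f})"
    show "indep N D"
    proof (cases "e \<in> D")
      case True
      have "insert f (D - {e}) \<subset> C"
      proof -
        have "D - {e} \<subset> C - {f}" using D True by auto
        then show ?thesis using C(2) by auto
      qed
      then have "indep N (insert f (D - {e}))" using old[OF C(1)] by (simp add: circuit_def)
      moreover have "D - {e} \<subseteq> ground M" "f \<notin> D - {e}" using D CM ef by auto
      ultimately have "indep N (insert e (D - {e}))" using swap[of "D - {e}"] by simp
      then show ?thesis using True by (simp add: insert_absorb)
    next
      case False
      then have "D \<subset> C" using D C(2) by auto
      then show ?thesis using old[OF C(1)] by (simp add: circuit_def)
    qed
  qed
  have through_e: "\<exists>C. circuit N C \<and> e \<in> C \<and> y \<in> C" if y: "y \<in> ground M" for y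
  proof (cases "y = f")
    case True then show ?thesis using circ by blast
  next
    case False
    then obtain C where "circuit M C" "f \<in> C" "y \<in> C" using conn f y by (metis circuit_connected_def)
    then show ?thesis using new[of C] False by blast
  qed
  show ?thesis
  proof (rule circuit_connected_insertI[OF conn e gr _ through_e])
    fix x y assume "x \<in> ground M" "y \<in> ground M" "x \<noteq> y"
    then obtain C where "circuit M C" "x \<in> C" "y \<in> C" using conn by (metis circuit_connected_def)
    then show "\<exists>C. circuit N C \<and> x \<in> C \<and> y \<in> C" using old[of C] by blast
  qed
qed

end

context
  fixes M N :: "'a matroid" and e f :: 'a
  assumes e: "e \<notin> ground M" and f: "f \<in> ground M" and gr: "ground N = insert e (ground M)"
    and cocirc: "cocircuit N {e, f}" and contr: "\<And>A. A \<subseteq> ground M \<Longrightarrow> indep M A \<longleftrightarrow> indep N (insert e A)"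
begin

lemma series_rk_contract:
  assumes A: "A \<subseteq> ground M" shows "rk N (insert e A) = Suc (rk M A)"
proof (rule antisym)
  have eA: "e \<notin> A" using A e by auto
  have "indep N {e}" using contr[of "{}"] indep_empty by auto
  then obtain J where J: "{e} \<subseteq> J" "J \<subseteq> insert e A" "indep N J" "card J = rk N (insert e A)"
    by (rule indep_extend_rk[of N "{e}" "insert e A"]) auto
  have J': "J - {e} \<subseteq> A" "insert e (J - {e}) = J" using J(1,2) by auto
  then have "indep M (J - {e})" using contr[of "J - {e}"] A J(3) by auto
  then have "card (J - {e}) \<le> rk M A" using J'(1) by (rule card_indep_le_rk)
  then show "rk N (insert e A) \<le> Suc (rk M A)"
    using J(1,4) finite_indep[OF J(3)] card_Suc_Diff1[of J e] by simp
  obtain I where I: "I \<subseteq> A" "indep M I" "card I = rk M A" by (rule rk_witness)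
  then have "card (insert e I) \<le> rk N (insert e A)"
    using contr[of I] A by (intro card_indep_le_rk) auto
  moreover have "card (insert e I) = Suc (card I)" using I eA finite_indep[OF I(2)] by (intro card_insert_disjoint) auto
  ultimately show "Suc (rk M A) \<le> rk N (insert e A)" using I(3) by simp
qed

text \<open>After deletion of one element of the series pair, the other one is a coloop.\<close>
lemma series_rk_insert:
  assumes A: "A \<subseteq> ground M - {f}" and g: "g = e \<or> g = f"
  shows "rk N (insert g A) = Suc (rk N A)"
proof -
  define g' where "g' = (if g = e then f else e)"
  have ef: "e \<noteq> f" using e f by auto
  have gg: "{g, g'} = {e, f}" "g \<noteq> g'" using g ef by (auto simp: g'_def)
  have sub: "{g'} \<subset> {e, f}" using gg by auto
  then have "coindep N {g'}" using cocirc by (simp add: cocircuit_def)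
  then obtain B where B: "basis N B" "g' \<notin> B" by (auto simp: coindep_def)
  have BG: "B \<subseteq> ground N" by (rule basis_subset_ground[OF B(1)])
  have "card B \<le> rk N (ground N - {g'})" using B BG by (intro card_indep_le_rk) (auto simp: basis_def)
  then have 1: "rk N (ground N) \<le> rk N (ground N - {g'})" using B(1) by (simp add: basis_iff)
  have 2: "rk N (ground N - {e, f}) < rk N (ground N)"
  proof (rule ccontr)
    assume "\<not> rk N (ground N - {e, f}) < rk N (ground N)"
    moreover have "rk N (ground N - {e, f}) \<le> rk N (ground N)" by (rule rk_mono) auto
    moreover obtain I where I: "I \<subseteq> ground N - {e, f}" "indep N I" "card I = rk N (ground N - {e, f})"
      by (rule rk_witness)
    ultimately have "basis N I" by (simp add: basis_iff)
    then have "coindep N {e, f}" using I(1) gr f by (auto simp: coindep_def)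
    then show False using cocirc by (simp add: cocircuit_def)
  qed
  have "insert g A \<union> (ground N - {e, f}) = ground N - {g'}" "insert g A \<inter> (ground N - {e, f}) = A"
    using A gr f gg ef e by auto
  then have "rk N (ground N - {g'}) + rk N A \<le> rk N (insert g A) + rk N (ground N - {e, f})"
    using rk_submodular[of N "insert g A" "ground N - {e, f}"] by simp
  then show ?thesis using 1 2 rk_insert_le[of N g A] by simp
qed

lemma series_rk_eq: "A \<subseteq> ground M - {f} \<Longrightarrow> rk N A = rk M A"
  using series_rk_contract[of A] series_rk_insert[of A e] by auto

text \<open>With \<open>p(A) = rk\<^sub>M(A)\<close> and \<open>q(A) = rk\<^sub>M(A + f)\<close>, the rank in \<open>N\<close> is \<open>p\<close> on sets avoiding the series
  pair, \<open>p + 1\<close> if exactly one and \<open>q + 1\<close> if both elements are present. The resulting correction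
  cancels exactly when \<open>f\<close> is neither a loop nor a coloop of \<open>M\<close>.\<close>
lemma series_rank_form:
  assumes conn: "circuit_connected M" shows "rank_form N = rank_form M"
proof -
  define E where "E = ground M - {f}"
  have E: "finite E" "f \<notin> E" "e \<notin> insert f E" "ground M = insert f E" "e \<notin> E"
    using finite_ground[of M] e f by (auto simp: E_def)
  define p q where "p A = int (rk M A)" and "q A = int (rk M (insert f A))" for A
  have rks: "int (rk N A) = p A" "int (rk N (insert f A)) = p A + 1" "int (rk N (insert e A)) = p A + 1"
    "int (rk N (insert e (insert f A))) = q A + 1" "int (rk N (insert f (insert e A))) = q A + 1"
    if A: "A \<subseteq> E" for A
  proof -
    have 1: "A \<subseteq> ground M - {f}" "insert f A \<subseteq> ground M" using A E by auto
    then show "int (rk N A) = p A" "int (rk N (insert f A)) = p A + 1" "int (rk N (insert e A)) = p A + 1"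
      "int (rk N (insert e (insert f A))) = q A + 1"
      by (simp_all add: p_def q_def series_rk_eq series_rk_insert series_rk_contract)
    then show "int (rk N (insert f (insert e A))) = q A + 1" by (simp add: insert_commute)
  qed
  have M: "rank_form M = moebius_form E p p + moebius_form E q (\<lambda>A. q A - p A)"
    using E by (simp add: rank_form_def moebius_form_insert p_def[abs_def] q_def[abs_def])
  define n where "n A = int (rk N A)" for A
  have "rank_form N = moebius_form (insert e (insert f E)) n n"
    unfolding rank_form_def gr E(4) n_def[abs_def] ..
  also have "\<dots> = moebius_form (insert f E) n n
      + moebius_form (insert f E) (\<lambda>A. n (insert e A)) (\<lambda>A. n (insert e A) - n A)"
    using E by (intro moebius_form_insert) auto
  also have "moebius_form (insert f E) n n
      = moebius_form E n n + moebius_form E (\<lambda>A. n (insert f A)) (\<lambda>A. n (insert f A) - n A)"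
    using E by (intro moebius_form_insert) auto
  also have "moebius_form E n n = moebius_form E p p"
    by (intro moebius_form_cong) (auto simp: n_def rks)
  also have "moebius_form E (\<lambda>A. n (insert f A)) (\<lambda>A. n (insert f A) - n A) = moebius_form E (\<lambda>A. p A + 1) (\<lambda>_. 1)"
    by (intro moebius_form_cong) (auto simp: n_def rks)
  also have "moebius_form (insert f E) (\<lambda>A. n (insert e A)) (\<lambda>A. n (insert e A) - n A)
      = moebius_form E (\<lambda>A. n (insert e A)) (\<lambda>A. n (insert e A) - n A)
      + moebius_form E (\<lambda>A. n (insert e (insert f A)))
        (\<lambda>A. (n (insert e (insert f A)) - n (insert f A)) - (n (insert e A) - n A))"
    using E by (intro moebius_form_insert) auto
  also have "moebius_form E (\<lambda>A. n (insert e A)) (\<lambda>A. n (insert e A) - n A) = moebius_form E (\<lambda>A. p A + 1) (\<lambda>_. 1)"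
    by (intro moebius_form_cong) (auto simp: n_def rks)
  also have "moebius_form E (\<lambda>A. n (insert e (insert f A)))
        (\<lambda>A. (n (insert e (insert f A)) - n (insert f A)) - (n (insert e A) - n A))
      = moebius_form E (\<lambda>A. q A + 1) (\<lambda>A. (q A - p A) - 1)"
    by (intro moebius_form_cong) (auto simp: n_def rks)
  finally have "rank_form N = rank_form M + 2 * (p {} + 1) + (q E - p E) - (q {} + 1)"
    unfolding M by (simp add: moebius_form_add_left moebius_form_diff_right moebius_form_const_left
        moebius_form_const_right E(1))
  moreover have "q {} = 1" using circuit_connected_rk_singleton[OF conn f] by (simp add: q_def)
  moreover have "q E = p E" 
    using circuit_connected_rk_delete[OF conn f]
    unfolding p_def q_def E(4)[symmetric] E_def[symmetric] by simp
  ultimately show ?thesis by (simp add: p_def)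
qed

lemma series_circuit_connected:
  assumes conn: "circuit_connected M" shows "circuit_connected N"
proof -
  have ef: "e \<noteq> f" using e f by auto
  have fin: "finite A" if "A \<subseteq> ground M" for A using finite_subset[OF that finite_ground] .
  have ind1: "indep N A \<longleftrightarrow> indep M A" if A: "A \<subseteq> ground M - {f}" for A
  proof -
    have "A \<subseteq> ground M" using A by auto
    then show ?thesis using series_rk_eq[OF A] fin[of A] by (simp only: indep_iff_rk)
  qed
  have ind2: "indep N (insert f A) \<longleftrightarrow> indep M A" if A: "A \<subseteq> ground M - {f}" for A
  proof -
    have "finite A" "f \<notin> A" using A fin[of A] by auto
    then show ?thesis using A series_rk_insert[OF A, of f] by (simp add: indep_iff_rk series_rk_eq)
  qed
  have old: "circuit N C" if C: "circuit M C" "f \<notin> C" for C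
    unfolding circuit_def
  proof (intro conjI allI impI)
    have CM: "C \<subseteq> ground M - {f}" using C by (auto simp: circuit_def)
    then show "C \<subseteq> ground N" using gr by auto
    show "\<not> indep N C" using C ind1[OF CM] by (simp add: circuit_def)
    fix D assume "D \<subset> C"
    then show "indep N D" using C(1) ind1[of D] CM by (auto simp: circuit_def)
  qed
  have new: "circuit N (insert e C)" if C: "circuit M C" "f \<in> C" for C
    unfolding circuit_def
  proof (intro conjI allI impI)
    have CM: "C \<subseteq> ground M" using C by (simp add: circuit_def)
    then show "insert e C \<subseteq> ground N" using gr by auto
    show "\<not> indep N (insert e C)" using C contr[OF CM] by (simp add: circuit_def)
    fix D assume D: "D \<subset> insert e C"
    show "indep N D"
    proof (cases "e \<in> D")
      case True
      then have "D - {e} \<subset> C" using D CM e by auto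
      then have "indep M (D - {e})" "D - {e} \<subseteq> ground M" using C(1) CM by (auto simp: circuit_def)
      then show ?thesis using contr[of "D - {e}"] True by (simp add: insert_absorb)
    next
      case False
      then have DC: "D \<subseteq> C" using D by auto
      then have "D - {f} \<subset> C" using C(2) by auto
      then have i: "indep M (D - {f})" "D - {f} \<subseteq> ground M - {f}" using C(1) CM by (auto simp: circuit_def)
      then have "indep N (insert f (D - {f}))" using ind2 by blast
      then show ?thesis by (rule indep_mono) auto
    qed
  qed
  have pairs: "\<exists>C. circuit N C \<and> x \<in> C \<and> y \<in> C" if xy: "x \<in> ground M" "y \<in> ground M" "x \<noteq> y" for x y
  proof -
    obtain C where C: "circuit M C" "x \<in> C" "y \<in> C" using conn xy by (metis circuit_connected_def)
    then show ?thesis using old[of C] new[of C] by (cases "f \<in> C") blast+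
  qed
  have through_e: "\<exists>C. circuit N C \<and> e \<in> C \<and> y \<in> C" if y: "y \<in> ground M" for y
  proof -
    have "\<exists>C. circuit M C \<and> f \<in> C \<and> y \<in> C"
    proof (cases "y = f")
      case True
      obtain C x where "circuit M C" "f \<in> C" "x \<in> C" "x \<noteq> f"
        by (rule circuit_connected_obtain_circuit[OF conn f])
      then show ?thesis using True by blast
    next
      case False then show ?thesis using conn f y by (metis circuit_connected_def)
    qed
    then show ?thesis using new by blast
  qed
  show ?thesis by (rule circuit_connected_insertI[OF conn e gr pairs through_e])
qed

end

lemma uniform_1_2_circuit_connected:
  assumes "card (ground M) = 2" "\<And>A. A \<subseteq> ground M \<Longrightarrow> indep M A \<longleftrightarrow> card A \<le> 1"
  shows "circuit_connected M" "rank_form M = 1"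
proof -
  obtain x y where xy: "ground M = {x, y}" "x \<noteq> y" using assms(1) by (auto simp: card_2_iff)
  have "circuit M {x, y}"
    unfolding circuit_def
  proof (intro conjI allI impI)
    show "\<not> indep M {x, y}" using assms(2)[of "{x, y}"] xy by simp
    fix D assume "D \<subset> {x, y}"
    then have "D = {} \<or> D = {x} \<or> D = {y}" using xy(2) by auto
    then show "indep M D" using assms(2)[of D] xy(1) by auto
  qed (use xy in auto)
  then show "circuit_connected M" using xy by (auto simp: circuit_connected_def)
  have "indep M {x}" "indep M {y}" "\<not> indep M {x, y}" using assms(2) xy by auto
  then have "rk M {x} = 1" "rk M {y} = 1" "rk M {x, y} \<noteq> 2"
    using rk_indep[of M "{x}"] rk_indep[of M "{y}"] indep_iff_rk[of "{x, y}" M] xy(2) by auto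
  moreover have "rk M {x, y} \<le> 2" using rk_le_card[of "{x, y}" M] xy(2) by simp
  moreover have "rk M {x} \<le> rk M {x, y}" by (rule rk_mono) auto
  ultimately have "rk M {x} = 1" "rk M {y} = 1" "rk M {x, y} = 1" by auto
  then show "rank_form M = 1"
    using xy(2) by (simp add: rank_form_def xy(1) moebius_form_insert insert_commute)
qed

lemma series_parallel_invariants:
  assumes "series_parallel M" shows "circuit_connected M \<and> rank_form M = 1"
  using assms
proof induction
  case (uniform_1_2 M)
  then show ?case using uniform_1_2_circuit_connected[of M] by blast
next
  case (parallel M N)
  then obtain e f where *: "e \<notin> ground M" "f \<in> ground M" "ground N = insert e (ground M)"
    "circuit N {e, f}" "\<And>A. A \<subseteq> ground M \<Longrightarrow> indep M A \<longleftrightarrow> indep N A"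
    by (auto simp: parallel_extension_def)
  then show ?case
    using parallel_rank_form[OF *] parallel_circuit_connected[OF *] parallel.IH by simp
next
  case (series M N)
  then obtain e f where *: "e \<notin> ground M" "f \<in> ground M" "ground N = insert e (ground M)"
    "cocircuit N {e, f}" "\<And>A. A \<subseteq> ground M \<Longrightarrow> indep M A \<longleftrightarrow> indep N (insert e A)"
    by (auto simp: series_extension_def)
  then show ?case
    using series_rank_form[OF *] series_circuit_connected[OF *] series.IH by simp
qed

section \<open>Lattice path matroids\<close>

definition lattice_path :: "nat \<Rightarrow> (nat \<Rightarrow> int) \<Rightarrow> bool" where
  "lattice_path n p \<longleftrightarrow> p 0 = 0 \<and> (\<forall>k<n. p (Suc k) = p k \<or> p (Suc k) = p k + 1)"

definition path_pair :: "'a list \<Rightarrow> (nat \<Rightarrow> int) \<Rightarrow> (nat \<Rightarrow> int) \<Rightarrow> bool" where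
  "path_pair xs l u \<longleftrightarrow> distinct xs \<and> lattice_path (length xs) l \<and> lattice_path (length xs) u \<and>
     l (length xs) = u (length xs) \<and> (\<forall>k\<le>length xs. l k \<le> u k)"

definition no_common_step :: "nat \<Rightarrow> (nat \<Rightarrow> int) \<Rightarrow> (nat \<Rightarrow> int) \<Rightarrow> bool" where
  "no_common_step n l u \<longleftrightarrow> (\<forall>k<n. \<not> (l k = u k \<and> l (Suc k) = u (Suc k)))"

text \<open>The set encoded by a lattice path: the elements at its up-steps.\<close>
definition step_set :: "'a list \<Rightarrow> (nat \<Rightarrow> int) \<Rightarrow> 'a set" where
  "step_set xs p = {xs ! k |k. k < length xs \<and> p (Suc k) \<noteq> p k}"

lemma lattice_path_bounds:
  assumes "lattice_path n p" "i \<le> j" "j \<le> n"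
  shows "p i \<le> p j" "p j \<le> p i + int (j - i)"
proof -
  have "p i \<le> p j \<and> p j \<le> p i + int (j - i)" using assms(2,3)
  proof (induction j rule: dec_induct)
    case (step k)
    then have "p (Suc k) = p k \<or> p (Suc k) = p k + 1" using assms(1) by (simp add: lattice_path_def)
    then show ?case using step by (auto simp: Suc_diff_le)
  qed simp
  then show "p i \<le> p j" "p j \<le> p i + int (j - i)" by auto
qed

lemma nth_in_step_set:
  assumes "distinct xs" "k < length xs"
  shows "xs ! k \<in> step_set xs p \<longleftrightarrow> p (Suc k) \<noteq> p k"
  using assms by (auto simp: step_set_def nth_eq_iff_index_eq)

lemma nth_notin_seg: "distinct xs \<Longrightarrow> k < length xs \<Longrightarrow> xs ! k \<notin> seg xs j k"
  by (auto simp: seg_def nth_eq_iff_index_eq)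

lemma card_step_set:
  assumes "distinct xs" "lattice_path (length xs) p" "k \<le> length xs"
  shows "int (card (step_set xs p \<inter> seg xs 0 k)) = p k"
  using assms(3)
proof (induction k)
  case 0 then show ?case using assms(2) by (simp add: lattice_path_def)
next
  case (Suc k)
  then have k: "k < length xs" by simp
  have seg: "seg xs 0 (Suc k) = insert (xs ! k) (seg xs 0 k)" by (simp add: seg_Suc)
  show ?case
  proof (cases "p (Suc k) = p k")
    case True
    then have "step_set xs p \<inter> seg xs 0 (Suc k) = step_set xs p \<inter> seg xs 0 k"
      using nth_in_step_set[OF assms(1) k, of p] by (auto simp: seg)
    then show ?thesis using Suc True by simp
  next
    case False
    then have "step_set xs p \<inter> seg xs 0 (Suc k) = insert (xs ! k) (step_set xs p \<inter> seg xs 0 k)"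
      using nth_in_step_set[OF assms(1) k, of p] by (auto simp: seg)
    moreover have "p (Suc k) = p k + 1" using False assms(2) k by (auto simp: lattice_path_def)
    ultimately show ?thesis using Suc nth_notin_seg[OF assms(1) k, of 0] by simp
  qed
qed

lemma step_set_in_path_sets:
  assumes "path_pair xs l u" "lattice_path (length xs) p" "\<And>k. k \<le> length xs \<Longrightarrow> l k \<le> p k \<and> p k \<le> u k"
  shows "step_set xs p \<in> path_sets xs l u"
  using assms card_step_set[of xs p] by (auto simp: path_sets_def path_pair_def step_set_def)

lemma path_pair_feasible:
  assumes "path_pair xs l u" shows "feasible xs l u"
proof -
  have "step_set xs u \<in> path_sets xs l u"
    using assms by (intro step_set_in_path_sets) (auto simp: path_pair_def)
  then show ?thesis using assms by (auto simp: feasible_def path_pair_def lattice_path_def)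
qed

lemma matroid_eq_if_same_bases:
  assumes "ground M = ground N" "\<And>B. basis M B \<longleftrightarrow> basis N B" shows "M = N"
proof (rule matroid_eqI[OF assms(1)])
  have "indep M A \<longleftrightarrow> (\<exists>B. basis M B \<and> A \<subseteq> B)" for M :: "'a matroid" and A
  proof
    assume "indep M A"
    then obtain B where "A \<subseteq> B" "basis M B" by (rule indep_extend_basis)
    then show "\<exists>B. basis M B \<and> A \<subseteq> B" by blast
  qed (auto simp: basis_def intro: indep_mono)
  then show "indep M A \<longleftrightarrow> indep N A" for A using assms(2) by simp
qed

lemma seg_head: "j < k \<Longrightarrow> seg xs j k = insert (xs ! j) (seg xs (Suc j) k)"
  using seg_Un[of j "Suc j" k xs] by (simp add: seg_Suc)

text \<open>Tightening the constraints to the extreme values attained by the bases turns them into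
  lattice paths.\<close>
lemma path_pair_normal_form:
  assumes feas: "feasible xs l u"
  obtains l' u' where "path_pair xs l' u'" "path_sets xs l' u' = path_sets xs l u"
    "interval_matroid xs l' u' = interval_matroid xs l u"
proof -
  define N where "N = interval_matroid xs l u"
  define n where "n = length xs"
  define r where "r = rk N (set xs)"
  define l' where "l' k = int r - int (rk N (seg xs k n))" for k
  define u' where "u' k = int (rk N (seg xs 0 k))" for k
  have d: "distinct xs" by (rule feasible_distinct[OF feas])
  have un: "u n = int r" using rk_ground_interval_matroid[OF feas] by (simp add: r_def N_def n_def)
  have all: "seg xs 0 n = set xs" by (simp add: n_def seg_all)
  have "lattice_path n l'"
    unfolding lattice_path_def
  proof (intro conjI allI impI)
    show "l' 0 = 0" by (simp add: l'_def all r_def)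
    fix k assume k: "k < n"
    have "rk N (seg xs (Suc k) n) \<le> rk N (seg xs k n)" by (intro rk_mono seg_mono) auto
    moreover have "rk N (seg xs k n) \<le> Suc (rk N (seg xs (Suc k) n))"
      unfolding seg_head[OF k] by (rule rk_insert_le)
    ultimately show "l' (Suc k) = l' k \<or> l' (Suc k) = l' k + 1" by (auto simp: l'_def)
  qed
  moreover have "lattice_path n u'"
    unfolding lattice_path_def
  proof (intro conjI allI impI)
    show "u' 0 = 0" by (simp add: u'_def)
    fix k assume k: "k < n"
    have "rk N (seg xs 0 k) \<le> rk N (seg xs 0 (Suc k))" by (intro rk_mono seg_mono) auto
    moreover have "rk N (seg xs 0 (Suc k)) \<le> Suc (rk N (seg xs 0 k))"
      using rk_insert_le by (simp add: seg_Suc)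
    ultimately show "u' (Suc k) = u' k \<or> u' (Suc k) = u' k + 1" by (auto simp: u'_def)
  qed
  moreover have "l' k \<le> u' k" if "k \<le> n" for k
  proof -
    have "set xs = seg xs 0 k \<union> seg xs k n" using seg_Un[of 0 k n xs] that all by simp
    then show ?thesis using rk_submodular[of N "seg xs 0 k" "seg xs k n"] by (simp add: l'_def u'_def r_def)
  qed
  moreover have "l' n = u' n" by (simp add: l'_def u'_def all r_def)
  ultimately have pp: "path_pair xs l' u'" using d by (simp add: path_pair_def n_def)
  have rk_seg: "int (rk N (seg xs j k)) \<le> u k - l j" if jk: "j \<le> k" "k \<le> n" for j k
  proof -
    obtain I where I: "I \<subseteq> seg xs j k" "indep N I" "card I = rk N (seg xs j k)" by (rule rk_witness)
    then have "I \<inter> seg xs j k = I" "interval_indep xs l u I"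
      using indep_interval_matroid[OF feas] by (auto simp: N_def)
    then have "int (card I) \<le> u k - l j" using jk unfolding interval_indep_def n_def by metis
    then show ?thesis using I(3) by simp
  qed
  have sets: "path_sets xs l' u' = path_sets xs l u"
  proof
    show "path_sets xs l' u' \<subseteq> path_sets xs l u"
    proof
      fix B assume B: "B \<in> path_sets xs l' u'"
      have "l k \<le> l' k" "u' k \<le> u k" if "k \<le> n" for k
        using rk_seg[of k n] rk_seg[of 0 k] that un feas by (auto simp: l'_def u'_def feasible_def)
      then show "B \<in> path_sets xs l u"
        using B order_trans unfolding path_sets_def n_def mem_Collect_eq by meson
    qed
    show "path_sets xs l u \<subseteq> path_sets xs l' u'"
    proof
      fix B assume B: "B \<in> path_sets xs l u"
      then have ind: "indep N B" "int (card B) = int r"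
        using card_path_set[OF feas B] un path_set_interval_indep[OF feas B]
        by (simp_all add: N_def indep_interval_matroid[OF feas] n_def)
      have sub: "B \<subseteq> set xs" using B by (simp add: path_sets_def)
      have "l' k \<le> int (card (B \<inter> seg xs 0 k)) \<and> int (card (B \<inter> seg xs 0 k)) \<le> u' k" if k: "k \<le> n" for k
      proof -
        have "card (B \<inter> seg xs 0 n) = card (B \<inter> seg xs 0 k) + card (B \<inter> seg xs k n)"
          using k by (intro card_Int_seg_split d) (auto simp: n_def)
        moreover have "B \<inter> seg xs 0 n = B" using sub all by auto
        ultimately show ?thesis
          using rk_indep_subset_Int[OF ind(1), of "seg xs 0 k"] rk_indep_subset_Int[OF ind(1), of "seg xs k n"] ind(2)
          by (simp add: l'_def u'_def)
      qed
      then show "B \<in> path_sets xs l' u'" using sub by (auto simp: path_sets_def n_def)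
    qed
  qed
  have "interval_matroid xs l' u' = interval_matroid xs l u"
    using path_pair_feasible[OF pp] feas sets
    by (intro matroid_eq_if_same_bases) (simp_all add: ground_interval_matroid basis_interval_matroid)
  from that[OF pp sets this] show ?thesis .
qed

text \<open>At a common step of the two paths all bases agree: it is a loop or a coloop.\<close>
lemma no_common_step_if_no_loops:
  assumes pp: "path_pair xs l u" and gr: "set xs = ground M" and sub: "{B. basis M B} \<subseteq> path_sets xs l u"
    and "\<And>e. \<not> loop M e" "\<And>e. \<not> coloop M e"
  shows "no_common_step (length xs) l u"
  unfolding no_common_step_def
proof (intro allI impI notI)
  fix k assume k: "k < length xs" and eq: "l k = u k \<and> l (Suc k) = u (Suc k)"
  define e where "e = xs ! k"
  have d: "distinct xs" using pp by (simp add: path_pair_def)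
  have e: "e \<in> ground M" unfolding e_def gr[symmetric] using k by (rule nth_mem)
  have step: "u (Suc k) = u k + of_bool (e \<in> B)" if B: "basis M B" for B
  proof -
    have Bp: "B \<in> path_sets xs l u" using sub B by blast
    then have "int (card (B \<inter> seg xs 0 k)) = u k" "int (card (B \<inter> seg xs 0 (Suc k))) = u (Suc k)"
    proof -
      have "l j \<le> int (card (B \<inter> seg xs 0 j)) \<and> int (card (B \<inter> seg xs 0 j)) \<le> u j" if "j \<le> length xs" for j
        using Bp that by (simp add: path_sets_def)
      from this[of k] this[of "Suc k"] show "int (card (B \<inter> seg xs 0 k)) = u k"
        "int (card (B \<inter> seg xs 0 (Suc k))) = u (Suc k)" using k eq by simp_all
    qed
    moreover have "seg xs 0 (Suc k) = insert e (seg xs 0 k)" by (simp add: seg_Suc e_def)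
    moreover have "e \<notin> seg xs 0 k" using nth_notin_seg[OF d k] by (simp add: e_def)
    ultimately show ?thesis by (cases "e \<in> B") auto
  qed
  show False
  proof (cases "u (Suc k) = u k")
    case True
    then have no: "e \<notin> B" if "basis M B" for B using step[OF that] by auto
    have "\<not> indep M {e}"
    proof
      assume "indep M {e}"
      then obtain B where "{e} \<subseteq> B" "basis M B" by (rule indep_extend_basis)
      then show False using no by blast
    qed
    then show False using e assms(4)[of e] by (simp add: loop_def)
  next
    case False
    then have "e \<in> B" if "basis M B" for B using step[OF that] by (cases "e \<in> B") auto
    then show False using e assms(5)[of e] by (simp add: coloop_def)
  qed
qed

text \<open>Where the two bounding paths touch, the matroid splits as a direct sum.\<close>
lemma interval_matroid_append:
  fixes ys zs :: "'a list" and l u :: "nat \<Rightarrow> int"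
  defines "l2 \<equiv> \<lambda>j. l (length ys + j) - l (length ys)" and "u2 \<equiv> \<lambda>j. u (length ys + j) - l (length ys)"
  assumes pp: "path_pair (ys @ zs) l u" and touch: "l (length ys) = u (length ys)"
  shows "path_pair ys l u" "path_pair zs l2 u2"
    "is_direct_sum (interval_matroid (ys @ zs) l u) (interval_matroid ys l u) (interval_matroid zs l2 u2)"
proof -
  let ?k = "length ys" and ?xs = "ys @ zs"
  show pp1: "path_pair ys l u" using pp touch by (auto simp: path_pair_def lattice_path_def)
  show pp2: "path_pair zs l2 u2"
    using pp touch by (auto simp: path_pair_def lattice_path_def l2_def u2_def)
  have d: "distinct ?xs" "set ys \<inter> set zs = {}" using pp by (auto simp: path_pair_def)
  note F = path_pair_feasible[OF pp] path_pair_feasible[OF pp1] path_pair_feasible[OF pp2]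
  have iff: "interval_indep ?xs l u A \<longleftrightarrow>
      interval_indep ys l u (A \<inter> set ys) \<and> interval_indep zs l2 u2 (A \<inter> set zs)"
    if A: "A \<subseteq> set ?xs" for A
  proof -
    have s1: "A \<inter> set ys \<inter> seg ys i j = A \<inter> seg ?xs i j" if "j \<le> ?k" for i j
      using that seg_subset_set[of j ys i] seg_append1[of j ys zs i] by auto
    have s2: "A \<inter> set zs \<inter> seg zs i j = A \<inter> seg ?xs (?k + i) (?k + j)" if "j \<le> length zs" for i j
      using that seg_subset_set[of j zs i] seg_append2[of ys zs i j] by auto
    show ?thesis
    proof
      assume L: "interval_indep ?xs l u A"
      show "interval_indep ys l u (A \<inter> set ys) \<and> interval_indep zs l2 u2 (A \<inter> set zs)"
        unfolding interval_indep_def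
      proof (intro conjI allI impI)
        fix i j assume "i \<le> j" "j \<le> length ys"
        then show "int (card (A \<inter> set ys \<inter> seg ys i j)) \<le> u j - l i"
          using L by (simp add: interval_indep_def s1)
      next
        fix i j assume "i \<le> j" "j \<le> length zs"
        then have "int (card (A \<inter> seg ?xs (?k + i) (?k + j))) \<le> u (?k + j) - l (?k + i)"
          using L by (simp add: interval_indep_def)
        then show "int (card (A \<inter> set zs \<inter> seg zs i j)) \<le> u2 j - l2 i"
          using \<open>j \<le> length zs\<close> by (simp add: s2 l2_def u2_def)
      qed auto
    next
      assume R: "interval_indep ys l u (A \<inter> set ys) \<and> interval_indep zs l2 u2 (A \<inter> set zs)"
      have r1: "int (card (A \<inter> seg ?xs i j)) \<le> u j - l i" if "i \<le> j" "j \<le> ?k" for i j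
        using R that s1[of j i] unfolding interval_indep_def by metis
      have r2: "int (card (A \<inter> seg ?xs i j)) \<le> u j - l i" if ij: "?k \<le> i" "i \<le> j" "j \<le> length ?xs" for i j
      proof -
        have "i - ?k \<le> j - ?k" "j - ?k \<le> length zs" using ij by auto
        then have "int (card (A \<inter> set zs \<inter> seg zs (i - ?k) (j - ?k))) \<le> u2 (j - ?k) - l2 (i - ?k)"
          using R unfolding interval_indep_def by blast
        then show ?thesis using s2[of "j - ?k" "i - ?k"] ij by (simp add: l2_def u2_def)
      qed
      show "interval_indep ?xs l u A"
        unfolding interval_indep_def
      proof (intro conjI allI impI A)
        fix i j assume ij: "i \<le> j" "j \<le> length ?xs"
        consider "j \<le> ?k" | "?k \<le> i" | "i \<le> ?k" "?k \<le> j" by linarith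
        then show "int (card (A \<inter> seg ?xs i j)) \<le> u j - l i"
        proof cases
          case 3
          then have "card (A \<inter> seg ?xs i j) = card (A \<inter> seg ?xs i ?k) + card (A \<inter> seg ?xs ?k j)"
            using ij by (intro card_Int_seg_split d(1)) auto
          then show ?thesis using r1[of i ?k] r2[of ?k j] 3 ij touch by simp
        qed (use ij r1 r2 in auto)
      qed
    qed
  qed
  show "is_direct_sum (interval_matroid ?xs l u) (interval_matroid ys l u) (interval_matroid zs l2 u2)"
    unfolding is_direct_sum_def using d(2) iff
    by (simp add: ground_interval_matroid[OF F(1)] ground_interval_matroid[OF F(2)] ground_interval_matroid[OF F(3)]
        indep_interval_matroid[OF F(1)] indep_interval_matroid[OF F(2)] indep_interval_matroid[OF F(3)])
qed

text \<open>The region between the two paths is a border strip.\<close>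
definition snake :: "'a list \<Rightarrow> (nat \<Rightarrow> int) \<Rightarrow> (nat \<Rightarrow> int) \<Rightarrow> bool" where
  "snake xs l u \<longleftrightarrow> path_pair xs l u \<and> 2 \<le> length xs \<and> (\<forall>k. 0 < k \<longrightarrow> k < length xs \<longrightarrow> u k = l k + 1)"

lemma snake_gap:
  assumes "snake xs l u" "j < k" "k \<le> length xs" shows "l j < u k"
proof -
  have pp: "lattice_path (length xs) l" "lattice_path (length xs) u" "l 0 = 0"
    and u: "\<And>k. 0 < k \<Longrightarrow> k < length xs \<Longrightarrow> u k = l k + 1"
    and n: "2 \<le> length xs"
    using assms(1) by (auto simp: snake_def path_pair_def lattice_path_def)
  show ?thesis
  proof (cases "j = 0")
    case True
    have "0 \<le> l 1" using lattice_path_bounds(1)[OF pp(1), of 0 1] pp(3) n by simp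
    then have "1 \<le> u 1" using u[of 1] n by simp
    then show ?thesis using lattice_path_bounds(1)[OF pp(2), of 1 k] True assms(2,3) pp(3) by simp
  next
    case False
    then show ?thesis using u[of j] lattice_path_bounds(1)[OF pp(2), of j k] assms(2,3) by simp
  qed
qed

lemma snake_small_indep:
  assumes sn: "snake xs l u" and D: "D \<subseteq> set xs" "card D \<le> 1"
  shows "interval_indep xs l u D"
  unfolding interval_indep_def
proof (intro conjI allI impI D(1))
  fix j k assume jk: "j \<le> k" "k \<le> length xs"
  have "finite D" using D(1) finite_subset by auto
  then have "card (D \<inter> seg xs j k) \<le> card D" by (intro card_mono) auto
  then have c: "card (D \<inter> seg xs j k) \<le> 1" using D(2) by simp
  show "int (card (D \<inter> seg xs j k)) \<le> u k - l j"
  proof (cases "j = k")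
    case True then show ?thesis using sn jk by (simp add: snake_def path_pair_def)
  next
    case False then show ?thesis using snake_gap[OF sn, of j k] jk c by simp
  qed
qed

context
  fixes zs :: "'a list" and e :: 'a and l u :: "nat \<Rightarrow> int" and m a
  assumes sn: "snake (zs @ [e]) l u" and m: "length zs = m" "2 \<le> m" and a: "l (m - 1) = a"
begin

text \<open>If the lower path is flat at the predecessor of the last element, these two elements are
  parallel and the last one is deleted; otherwise they are in series and it is contracted. In both
  cases the remaining paths end at height \<open>a + 1\<close>.\<close>
definition "tail_l = l(m := a + 1)"
definition "tail_u = u(m := a + 1)"

lemma snake_facts:
  "distinct (zs @ [e])" "lattice_path (Suc m) l" "lattice_path (Suc m) u" "l (Suc m) = u (Suc m)"
  "u (m - 1) = a + 1" "u m = l m + 1" "u (Suc m) = l m + 1" "l m = a \<or> l m = a + 1"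
proof -
  show *: "distinct (zs @ [e])" "lattice_path (Suc m) l" "lattice_path (Suc m) u" "l (Suc m) = u (Suc m)"
    using sn m by (auto simp: snake_def path_pair_def)
  show um: "u (m - 1) = a + 1" "u m = l m + 1" using sn m a by (auto simp: snake_def)
  show "u (Suc m) = l m + 1" using *(2-4) um by (force simp: lattice_path_def)
  have "Suc (m - 1) = m" using m by simp
  then show "l m = a \<or> l m = a + 1" using *(2) a by (metis lattice_path_def less_SucI lessI)
qed

lemma snake_tail: "snake zs tail_l tail_u"
proof -
  have step: "Suc k = m \<longleftrightarrow> k = m - 1" for k using m by auto
  have "lattice_path m tail_l" "lattice_path m tail_u"
    using snake_facts m a step by (auto simp: lattice_path_def tail_l_def tail_u_def)
  moreover have "tail_l k \<le> tail_u k" if "k \<le> m" for k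
    using sn that m by (auto simp: snake_def path_pair_def tail_l_def tail_u_def)
  ultimately show ?thesis
    using sn m by (auto simp: snake_def path_pair_def tail_l_def tail_u_def)
qed

lemma snake_feasible: "feasible (zs @ [e]) l u" "feasible zs tail_l tail_u"
  using sn snake_tail by (auto simp: snake_def intro: path_pair_feasible)

lemmas snake_simps = ground_interval_matroid[OF snake_feasible(1)] ground_interval_matroid[OF snake_feasible(2)]
  indep_interval_matroid[OF snake_feasible(1)] indep_interval_matroid[OF snake_feasible(2)]
  basis_interval_matroid[OF snake_feasible(1)]

lemma snake_last_pair: "seg (zs @ [e]) (m - 1) (Suc m) = {zs ! (m - 1), e}" "zs ! (m - 1) \<noteq> e"
    "zs ! (m - 1) \<in> set zs" "e \<notin> set zs"
proof -
  have "{m - 1..<Suc m} = {m - 1, m}" using m by auto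
  then show "seg (zs @ [e]) (m - 1) (Suc m) = {zs ! (m - 1), e}" using m by (simp add: seg_def nth_append insert_commute)
  show "zs ! (m - 1) \<in> set zs" using m by simp
  moreover show "e \<notin> set zs" using snake_facts(1) by simp
  ultimately show "zs ! (m - 1) \<noteq> e" by auto
qed

lemma seg_snake: "k \<le> m \<Longrightarrow> seg (zs @ [e]) j k = seg zs j k"
  "j \<le> m \<Longrightarrow> seg (zs @ [e]) j (Suc m) = insert e (seg zs j m)"
proof -
  show 1: "k \<le> m \<Longrightarrow> seg (zs @ [e]) j k = seg zs j k" for j k using m seg_append1 by metis
  show "j \<le> m \<Longrightarrow> seg (zs @ [e]) j (Suc m) = insert e (seg zs j m)"
    using 1[of m j] m(1) by (simp add: seg_Suc nth_append)
qed

lemma snake_parallel: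
  assumes lm: "l m = a"
  shows "parallel_extension (interval_matroid zs tail_l tail_u) (interval_matroid (zs @ [e]) l u)"
proof -
  let ?f = "zs ! (m - 1)" and ?xs = "zs @ [e]"
  have vals: "l (m - 1) = a" "u m = a + 1" "u (Suc m) = a + 1" "l (Suc m) = a + 1"
    using snake_facts lm a by auto
  have "interval_indep zs tail_l tail_u A \<longleftrightarrow> interval_indep ?xs l u A" if A: "A \<subseteq> set zs" for A
  proof
    assume L: "interval_indep zs tail_l tail_u A"
    have le: "int (card (A \<inter> seg zs j k)) \<le> u k - l j" if "j < m" "j \<le> k" "k \<le> m" for j k
    proof -
      have "int (card (A \<inter> seg zs j k)) \<le> tail_u k - tail_l j"
        using L that m by (simp add: interval_indep_def)
      then show ?thesis using that vals by (simp add: tail_l_def tail_u_def split: if_splits)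
    qed
    have eA: "A \<inter> insert e S = A \<inter> S" for S using A snake_last_pair(4) by auto
    show "interval_indep ?xs l u A"
      unfolding interval_indep_def
    proof (intro conjI allI impI)
      fix j k assume jk: "j \<le> k" "k \<le> length ?xs"
      consider "j < m" "k \<le> m" | "j < m" "k = Suc m" | "j = m" "k = m" | "j = m" "k = Suc m" | "j = Suc m" "k = Suc m"
        using jk m by fastforce
      then show "int (card (A \<inter> seg ?xs j k)) \<le> u k - l j"
      proof cases
        case 1 then show ?thesis using le jk by (simp add: seg_snake)
      next
        case 2 then show ?thesis using le[of j m] vals by (simp add: seg_snake eA)
      qed (use vals lm in \<open>simp_all add: seg_snake eA\<close>)
    qed (use A in auto)
  next
    assume R: "interval_indep ?xs l u A"
    show "interval_indep zs tail_l tail_u A"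
      unfolding interval_indep_def
    proof (intro conjI allI impI A)
      fix j k assume jk: "j \<le> k" "k \<le> length zs"
      show "int (card (A \<inter> seg zs j k)) \<le> tail_u k - tail_l j"
      proof (cases "j = m")
        case True then show ?thesis using jk m by (simp add: tail_l_def tail_u_def)
      next
        case False
        have "int (card (A \<inter> seg ?xs j k)) \<le> u k - l j" using R jk by (simp add: interval_indep_def)
        then show ?thesis using False jk m vals
          by (cases "k = m") (simp_all add: seg_snake tail_l_def tail_u_def)
      qed
    qed
  qed
  moreover have "circuit (interval_matroid ?xs l u) {e, ?f}"
    unfolding circuit_def snake_simps
  proof (intro conjI allI impI notI)
    show "{e, ?f} \<subseteq> set ?xs" using snake_last_pair by auto
    assume "interval_indep ?xs l u {e, ?f}"
    then have "int (card ({e, ?f} \<inter> seg ?xs (m - 1) (Suc m))) \<le> u (Suc m) - l (m - 1)"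
      using m unfolding interval_indep_def by force
    then show False using vals snake_last_pair(1,2) by (simp add: insert_commute)
  next
    fix D assume D: "D \<subset> {e, ?f}"
    then have "card D < card {e, ?f}" by (intro psubset_card_mono) auto
    then have "card D \<le> 1" using snake_last_pair(2) by simp
    then show "interval_indep ?xs l u D"
      using D snake_last_pair by (intro snake_small_indep[OF sn]) auto
  qed
  ultimately show ?thesis
    unfolding parallel_extension_def using snake_last_pair
    by (intro exI[of _ e] exI[of _ ?f])
      (simp add: snake_simps)
qed

lemma snake_series:
  assumes lm: "l m = a + 1"
  shows "series_extension (interval_matroid zs tail_l tail_u) (interval_matroid (zs @ [e]) l u)"
proof -
  let ?f = "zs ! (m - 1)" and ?xs = "zs @ [e]"
  let ?N = "interval_matroid ?xs l u"
  have vals: "l (m - 1) = a" "u (m - 1) = a + 1" "u m = a + 2" "u (Suc m) = a + 2" "l (Suc m) = a + 2"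
    using snake_facts lm a by auto
  have pp: "path_pair ?xs l u" using sn by (simp add: snake_def)
  have "interval_indep zs tail_l tail_u A \<longleftrightarrow> interval_indep ?xs l u (insert e A)"
    if A: "A \<subseteq> set zs" for A
  proof -
    have eA: "e \<notin> A" "finite A" using A snake_last_pair(4) finite_subset[OF A] by auto
    have c1: "card (insert e A \<inter> seg ?xs j k) = card (A \<inter> seg zs j k)" if "k \<le> m" for j k
    proof -
      have "e \<notin> seg zs j k" using seg_subset_set[of k zs j] that m snake_last_pair(4) by auto
      then show ?thesis using that by (simp add: seg_snake)
    qed
    have c2: "card (insert e A \<inter> seg ?xs j (Suc m)) = Suc (card (A \<inter> seg zs j m))" if "j \<le> m" for j
    proof -
      have "insert e A \<inter> insert e (seg zs j m) = insert e (A \<inter> seg zs j m)" by auto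
      then show ?thesis using that eA by (simp add: seg_snake)
    qed
    show ?thesis
    proof
      assume L: "interval_indep zs tail_l tail_u A"
      have le: "int (card (A \<inter> seg zs j k)) \<le> tail_u k - l j" if "j \<le> k" "k \<le> m" for j k
      proof -
        have "tail_l j = l j" using lm by (simp add: tail_l_def)
        moreover have "int (card (A \<inter> seg zs j k)) \<le> tail_u k - tail_l j"
          using L that m by (simp add: interval_indep_def)
        ultimately show ?thesis by simp
      qed
      show "interval_indep ?xs l u (insert e A)"
        unfolding interval_indep_def
      proof (intro conjI allI impI)
        fix j k assume jk: "j \<le> k" "k \<le> length ?xs"
        consider "k \<le> m" | "j \<le> m" "k = Suc m" | "j = Suc m" "k = Suc m" using jk m by fastforce
        then show "int (card (insert e A \<inter> seg ?xs j k)) \<le> u k - l j"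
        proof cases
          case 1
          have "tail_u k \<le> u k" using vals by (simp add: tail_u_def)
          then show ?thesis using le[of j k] jk 1 by (simp add: c1)
        next
          case 2 then show ?thesis using le[of j m] vals by (simp add: c2 tail_u_def)
        qed (use vals in simp)
      qed (use A in auto)
    next
      assume R: "interval_indep ?xs l u (insert e A)"
      show "interval_indep zs tail_l tail_u A"
        unfolding interval_indep_def
      proof (intro conjI allI impI A)
        fix j k assume jk: "j \<le> k" "k \<le> length zs"
        have tl: "tail_l j = l j" using lm by (simp add: tail_l_def)
        show "int (card (A \<inter> seg zs j k)) \<le> tail_u k - tail_l j"
        proof (cases "k = m")
          case True
          have "int (card (insert e A \<inter> seg ?xs j (Suc m))) \<le> u (Suc m) - l j"
            using R jk True m unfolding interval_indep_def by force
          then show ?thesis using True jk vals by (simp add: c2 tl tail_u_def)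
        next
          case False
          have "int (card (insert e A \<inter> seg ?xs j k)) \<le> u k - l j"
            using R jk unfolding interval_indep_def by force
          then show ?thesis using False jk m by (simp add: c1 tl tail_u_def)
        qed
      qed
    qed
  qed
  moreover have "cocircuit ?N {e, ?f}"
    unfolding cocircuit_def
  proof (intro conjI allI impI notI)
    show "{e, ?f} \<subseteq> ground ?N" using snake_last_pair by (auto simp: snake_simps)
    assume "coindep ?N {e, ?f}"
    then obtain B where B: "B \<in> path_sets ?xs l u" "{e, ?f} \<inter> B = {}"
      by (auto simp: coindep_def snake_simps)
    have "card (B \<inter> seg ?xs 0 (Suc m)) = card (B \<inter> seg ?xs 0 (m - 1)) + card (B \<inter> seg ?xs (m - 1) (Suc m))"
      using m by (intro card_Int_seg_split snake_facts) auto
    moreover have "B \<inter> seg ?xs (m - 1) (Suc m) = {}" using B(2) snake_last_pair(1) by auto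
    moreover have "l (Suc m) \<le> int (card (B \<inter> seg ?xs 0 (Suc m)))" "int (card (B \<inter> seg ?xs 0 (m - 1))) \<le> u (m - 1)"
      using B(1) m by (auto simp: path_sets_def)
    ultimately show False using vals by simp
  next
    fix D assume D: "D \<subset> {e, ?f}"
    have coindep_step: "coindep ?N {?xs ! k}"
      if "lattice_path (Suc m) p" "\<And>k. k \<le> Suc m \<Longrightarrow> l k \<le> p k \<and> p k \<le> u k" "k < Suc m" "p (Suc k) = p k" for p k
    proof -
      have "step_set ?xs p \<in> path_sets ?xs l u" using that m by (intro step_set_in_path_sets[OF pp]) auto
      moreover have "?xs ! k \<notin> step_set ?xs p" using nth_in_step_set[OF snake_facts(1), of k p] that m by simp
      moreover have "?xs ! k \<in> set ?xs" using that(3) m by (intro nth_mem) auto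
      ultimately show ?thesis unfolding coindep_def
        by (auto simp: snake_simps)
    qed
    have "coindep ?N {?xs ! m}"
      using vals snake_facts sn m by (intro coindep_step[of u]) (auto simp: snake_def path_pair_def)
    then have ce: "coindep ?N {e}" using m by (simp add: nth_append)
    \<comment> \<open>The path that follows \<open>u\<close> but postpones the up-step at \<open>f\<close> to \<open>e\<close> gives a basis avoiding \<open>f\<close>.\<close>
    define p where "p = u(m := a + 1)"
    have step: "Suc k = m \<longleftrightarrow> k = m - 1" for k using m by auto
    have "lattice_path (Suc m) p"
      using snake_facts(3) vals m step by (auto simp: p_def lattice_path_def less_Suc_eq)
    moreover have "l k \<le> p k \<and> p k \<le> u k" if "k \<le> Suc m" for k
      using sn that m lm vals by (auto simp: p_def snake_def path_pair_def)
    ultimately have "coindep ?N {?xs ! (m - 1)}"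
      using vals m by (intro coindep_step[of p]) (auto simp: p_def)
    then have cf: "coindep ?N {?f}" using m by (simp add: nth_append)
    have "D \<subseteq> {e} \<or> D \<subseteq> {?f}" using D by auto
    then show "coindep ?N D" using ce cf unfolding coindep_def by blast
  qed
  ultimately show ?thesis
    unfolding series_extension_def using snake_last_pair
    by (intro exI[of _ e] exI[of _ ?f])
      (simp add: snake_simps)
qed

end

text \<open>Deleting or contracting the last element of a snake gives a shorter snake.\<close>
lemma snake_series_parallel:
  assumes "snake xs l u" shows "series_parallel (interval_matroid xs l u)"
  using assms
proof (induction xs arbitrary: l u rule: rev_induct)
  case (snoc e zs)
  note sn = snoc.prems
  show ?case
  proof (cases "length zs = 1")
    case True
    let ?xs = "zs @ [e]"
    have feas: "feasible ?xs l u" using sn by (auto simp: snake_def intro: path_pair_feasible)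
    have pp: "lattice_path 2 l" "lattice_path 2 u" "l 2 = u 2" "u 1 = l 1 + 1" "distinct ?xs"
      using sn True by (auto simp: snake_def path_pair_def numeral_2_eq_2)
    have l0: "l 0 = 0" "u 0 = 0" "l (Suc 0) = l 0 \<or> l (Suc 0) = l 0 + 1" "u (Suc 0) = u 0 \<or> u (Suc 0) = u 0 + 1"
      "l (Suc (Suc 0)) = l (Suc 0) \<or> l (Suc (Suc 0)) = l (Suc 0) + 1"
      "u (Suc (Suc 0)) = u (Suc 0) \<or> u (Suc (Suc 0)) = u (Suc 0) + 1"
    proof -
      have "l (Suc k) = l k \<or> l (Suc k) = l k + 1" "u (Suc k) = u k \<or> u (Suc k) = u k + 1" if "k < 2" for k
        using pp(1,2) that by (auto simp: lattice_path_def)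
      from this[of 0] this[of "Suc 0"] show "l (Suc 0) = l 0 \<or> l (Suc 0) = l 0 + 1"
        "u (Suc 0) = u 0 \<or> u (Suc 0) = u 0 + 1"
        "l (Suc (Suc 0)) = l (Suc 0) \<or> l (Suc (Suc 0)) = l (Suc 0) + 1"
        "u (Suc (Suc 0)) = u (Suc 0) \<or> u (Suc (Suc 0)) = u (Suc 0) + 1" by simp_all
      show "l 0 = 0" "u 0 = 0" using pp(1,2) by (auto simp: lattice_path_def)
    qed
    then have u2: "u 2 = 1" using pp(3,4) by (auto simp: numeral_2_eq_2)
    have "interval_indep ?xs l u A \<longleftrightarrow> card A \<le> 1" if A: "A \<subseteq> set ?xs" for A
    proof
      assume "interval_indep ?xs l u A"
      then have "int (card (A \<inter> seg ?xs 0 (length ?xs))) \<le> u (length ?xs) - l 0"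
        unfolding interval_indep_def by blast
      then have "int (card A) \<le> u 2 - l 0"
        unfolding seg_all using A True by (simp add: inf.absorb1 numeral_2_eq_2)
      then show "card A \<le> 1" using u2 l0(1) by simp
    qed (rule snake_small_indep[OF sn A])
    then show ?thesis using pp(5) True
      by (intro series_parallel.uniform_1_2)
        (auto simp: ground_interval_matroid[OF feas] indep_interval_matroid[OF feas] distinct_card)
  next
    case False
    define m where "m = length zs"
    have m: "length zs = m" "2 \<le> m" using sn False by (auto simp: m_def snake_def)
    note ctx = sn m refl[of "l (m - 1)"]
    have IH: "series_parallel (interval_matroid zs (tail_l l m (l (m - 1))) (tail_u u m (l (m - 1))))"
      by (rule snoc.IH[OF snake_tail[OF ctx]])
    show ?thesis
      using snake_facts(8)[OF ctx] snake_parallel[OF ctx] snake_series[OF ctx] IH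
        series_parallel.parallel series_parallel.series by blast
  qed
qed (simp add: snake_def)

section \<open>Cutting a lattice path matroid in two\<close>

text \<open>The largest path below \<open>p\<close> that passes position \<open>k\<close> at height at most \<open>c\<close>: after \<open>k\<close> it may rise
  with slope one. The truncated difference \<open>j - k\<close> keeps the bound constant before \<open>k\<close>. Dually for \<open>lift\<close>.\<close>
definition cap :: "nat \<Rightarrow> int \<Rightarrow> (nat \<Rightarrow> int) \<Rightarrow> nat \<Rightarrow> int" where
  "cap k c p j = min (p j) (c + int (j - k))"

definition lift :: "nat \<Rightarrow> int \<Rightarrow> (nat \<Rightarrow> int) \<Rightarrow> nat \<Rightarrow> int" where
  "lift k c p j = max (p j) (c - int (k - j))"

context
  fixes xs :: "'a list" and l u :: "nat \<Rightarrow> int" and k :: nat and c :: int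
  assumes pp: "path_pair xs l u" and k: "k \<le> length xs" and c: "l k < c" "c < u k"
begin

lemma cut_facts:
  "distinct xs" "lattice_path (length xs) l" "lattice_path (length xs) u" "l 0 = 0" "u 0 = 0"
  "l (length xs) = u (length xs)" "\<And>j. j \<le> length xs \<Longrightarrow> l j \<le> u j"
  using pp by (auto simp: path_pair_def lattice_path_def)

lemma lower_less_cap:
  assumes j: "j \<le> length xs" shows "l j < c + int (j - k)"
proof (cases "j \<le> k")
  case True then show ?thesis using lattice_path_bounds(1)[OF cut_facts(2) True k] c by simp
next
  case False then show ?thesis using lattice_path_bounds(2)[OF cut_facts(2), of k j] j c by simp
qed

lemma upper_greater_raise:
  assumes j: "j \<le> length xs" shows "c - int (k - j) < u j"
proof (cases "j \<le> k")
  case True then show ?thesis using lattice_path_bounds(2)[OF cut_facts(3) True k] c by simp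
next
  case False then show ?thesis using lattice_path_bounds(1)[OF cut_facts(3), of k j] j c by simp
qed

lemma path_pairs_cut:
  "path_pair xs l (cap k c u)" "path_pair xs (lift k c l) u"
  "path_pair xs (lift k c l) (cap k c u)"
proof -
  have "lattice_path (length xs) (cap k c u)"
    unfolding lattice_path_def
  proof (intro conjI allI impI)
    show "cap k c u 0 = 0" using lower_less_cap[of 0] cut_facts(4,5) by (simp add: cap_def)
    fix j assume j: "j < length xs"
    have "u (Suc j) = u j \<or> u (Suc j) = u j + 1" using cut_facts(3) j by (simp add: lattice_path_def)
    moreover have "int (Suc j - k) = int (j - k) \<or> int (Suc j - k) = int (j - k) + 1" by auto
    ultimately show "cap k c u (Suc j) = cap k c u j \<or> cap k c u (Suc j) = cap k c u j + 1"
      unfolding cap_def by linarith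
  qed
  moreover have "lattice_path (length xs) (lift k c l)"
    unfolding lattice_path_def
  proof (intro conjI allI impI)
    show "lift k c l 0 = 0" using upper_greater_raise[of 0] cut_facts(4,5) by (simp add: lift_def)
    fix j assume j: "j < length xs"
    have "l (Suc j) = l j \<or> l (Suc j) = l j + 1" using cut_facts(2) j by (simp add: lattice_path_def)
    moreover have "int (k - j) = int (k - Suc j) \<or> int (k - j) = int (k - Suc j) + 1" by auto
    ultimately show "lift k c l (Suc j) = lift k c l j \<or> lift k c l (Suc j) = lift k c l j + 1"
      unfolding lift_def by linarith
  qed
  moreover have "cap k c u (length xs) = u (length xs)"
    using lower_less_cap[of "length xs"] cut_facts(6) by (simp add: cap_def)
  moreover have "lift k c l (length xs) = l (length xs)"
    using upper_greater_raise[of "length xs"] cut_facts(6) by (simp add: lift_def)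
  moreover have "l j \<le> cap k c u j" "lift k c l j \<le> u j" "lift k c l j \<le> cap k c u j"
    if "j \<le> length xs" for j
    using lower_less_cap[OF that] upper_greater_raise[OF that] cut_facts(7)[OF that]
    by (auto simp: cap_def lift_def)
  ultimately show "path_pair xs l (cap k c u)" "path_pair xs (lift k c l) u"
    "path_pair xs (lift k c l) (cap k c u)"
    using cut_facts by (simp_all add: path_pair_def)
qed

text \<open>The cut creates a new contact of the bounding paths only in the third piece and only at \<open>k\<close>,
  next to which the original paths are still apart; so no loops or coloops arise.\<close>
lemma no_common_step_cut:
  assumes ncs: "no_common_step (length xs) l u"
  shows "no_common_step (length xs) l (cap k c u)" "no_common_step (length xs) (lift k c l) u"
    "no_common_step (length xs) (lift k c l) (cap k c u)"
proof -
  have 1: "l j = u j" if "l j = cap k c u j" "j \<le> length xs" for j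
    using that lower_less_cap[of j] by (auto simp: cap_def min_def split: if_splits)
  have 2: "l j = u j" if "lift k c l j = u j" "j \<le> length xs" for j
    using that upper_greater_raise[of j] by (auto simp: lift_def max_def split: if_splits)
  have 3: "l j = u j \<or> j = k" if "lift k c l j = cap k c u j" "j \<le> length xs" for j
    using that upper_greater_raise[of j] lower_less_cap[of j]
    by (auto simp: lift_def cap_def max_def min_def split: if_splits)
  show "no_common_step (length xs) l (cap k c u)" "no_common_step (length xs) (lift k c l) u"
    using ncs 1[OF _ less_imp_le] 1[OF _ Suc_leI] 2[OF _ less_imp_le] 2[OF _ Suc_leI]
    unfolding no_common_step_def by blast+
  show "no_common_step (length xs) (lift k c l) (cap k c u)"
    unfolding no_common_step_def
  proof (intro allI impI notI)
    fix j assume j: "j < length xs"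
      "lift k c l j = cap k c u j \<and> lift k c l (Suc j) = cap k c u (Suc j)"
    then have *: "l j = u j \<or> j = k" "l (Suc j) = u (Suc j) \<or> Suc j = k" using 3 by auto
    have steps: "l (Suc j) = l j \<or> l (Suc j) = l j + 1" "u (Suc j) = u j \<or> u (Suc j) = u j + 1"
      using cut_facts(2,3) j(1) by (simp_all add: lattice_path_def)
    have "\<not> (l j = u j \<and> l (Suc j) = u (Suc j))" using ncs j(1) by (simp add: no_common_step_def)
    then show False using * steps c by auto
  qed
qed

text \<open>The mass of initial segments grows with slope between zero and one, so a bound at \<open>k\<close> implies
  the sloped bounds at all other positions.\<close>
lemma base_polytope_cut:
  "x \<in> base_polytope (interval_matroid xs l (cap k c u)) \<longleftrightarrow>
     x \<in> base_polytope (interval_matroid xs l u) \<and> mass x (seg xs 0 k) \<le> of_int c"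
  "x \<in> base_polytope (interval_matroid xs (lift k c l) u) \<longleftrightarrow>
     x \<in> base_polytope (interval_matroid xs l u) \<and> of_int c \<le> mass x (seg xs 0 k)"
  "x \<in> base_polytope (interval_matroid xs (lift k c l) (cap k c u)) \<longleftrightarrow>
     x \<in> base_polytope (interval_matroid xs l u) \<and> mass x (seg xs 0 k) = of_int c"
proof -
  have lip: "mass x (seg xs 0 i) \<le> mass x (seg xs 0 j)" "mass x (seg xs 0 j) \<le> mass x (seg xs 0 i) + int (j - i)"
    if x: "\<forall>e. 0 \<le> coord x e \<and> coord x e \<le> 1" and ij: "i \<le> j" "j \<le> length xs" for i j
  proof -
    have "mass x (seg xs 0 j) = mass x (seg xs 0 i) + mass x (seg xs i j)"
      using ij by (intro sum_seg_split cut_facts) auto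
    moreover have "0 \<le> mass x (seg xs i j)" using x by (simp add: sum_nonneg)
    moreover have "mass x (seg xs i j) \<le> real (card (seg xs i j)) * 1"
      using x by (intro sum_bounded_above) auto
    ultimately show "mass x (seg xs 0 i) \<le> mass x (seg xs 0 j)"
      "mass x (seg xs 0 j) \<le> mass x (seg xs 0 i) + int (j - i)"
      using card_seg[OF cut_facts(1) ij(2), of i] by auto
  qed
  note F = path_pairs_cut[THEN path_pair_feasible] path_pair_feasible[OF pp]
  let ?box = "(\<forall>e. 0 \<le> coord x e \<and> coord x e \<le> 1) \<and>
    (\<forall>e. e \<notin> set xs \<longrightarrow> coord x e = 0)"
  let ?m = "\<lambda>j. mass x (seg xs 0 j)"
  have cap_slope: "?m j \<le> real_of_int c + real (j - k)" if ?box "?m k \<le> of_int c" "j \<le> length xs" for j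
    using that lip(1)[of j k] lip(2)[of k j] k by (cases "j \<le> k") auto
  have lift_slope: "real_of_int c - real (k - j) \<le> ?m j" if ?box "of_int c \<le> ?m k" "j \<le> length xs" for j
    using that lip(2)[of j k] lip(1)[of k j] k by (cases "j \<le> k") auto
  have cap: "(\<forall>j\<le>length xs. ?m j \<le> of_int (cap k c u j)) \<longleftrightarrow>
    (\<forall>j\<le>length xs. ?m j \<le> of_int (u j)) \<and> ?m k \<le> of_int c" if box: ?box
    using cap_slope[OF box] k by (force simp: cap_def of_int_min)
  have raise: "(\<forall>j\<le>length xs. of_int (lift k c l j) \<le> ?m j) \<longleftrightarrow>
    (\<forall>j\<le>length xs. of_int (l j) \<le> ?m j) \<and> of_int c \<le> ?m k" if box: ?box
    using lift_slope[OF box] k by (force simp: lift_def of_int_max)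
  show "x \<in> base_polytope (interval_matroid xs l (cap k c u)) \<longleftrightarrow>
      x \<in> base_polytope (interval_matroid xs l u) \<and> mass x (seg xs 0 k) \<le> of_int c"
    unfolding base_polytope_interval_matroid[OF F(1)] base_polytope_interval_matroid[OF F(4)]
    using cap by blast
  show "x \<in> base_polytope (interval_matroid xs (lift k c l) u) \<longleftrightarrow>
      x \<in> base_polytope (interval_matroid xs l u) \<and> of_int c \<le> mass x (seg xs 0 k)"
    unfolding base_polytope_interval_matroid[OF F(2)] base_polytope_interval_matroid[OF F(4)]
    using raise by blast
  show "x \<in> base_polytope (interval_matroid xs (lift k c l) (cap k c u)) \<longleftrightarrow>
      x \<in> base_polytope (interval_matroid xs l u) \<and> mass x (seg xs 0 k) = of_int c"
    unfolding base_polytope_interval_matroid[OF F(3)] base_polytope_interval_matroid[OF F(4)]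
      order_eq_iff[of "mass x (seg xs 0 k)"]
    using cap raise by blast
qed

lemma valuative_cut:
  fixes f :: "'a matroid \<Rightarrow> int"
  assumes f: "valuative f"
  shows "f (interval_matroid xs l u) = f (interval_matroid xs l (cap k c u))
    + f (interval_matroid xs (lift k c l) u) - f (interval_matroid xs (lift k c l) (cap k c u))"
proof -
  define N where "N i = (if i = 0 then interval_matroid xs l (cap k c u)
    else if i = 1 then interval_matroid xs (lift k c l) u
    else interval_matroid xs (lift k c l) (cap k c u))" for i :: nat
  define a :: "nat \<Rightarrow> int" where "a i = (if i = 2 then -1 else 1)" for i
  note F = path_pairs_cut[THEN path_pair_feasible] path_pair_feasible[OF pp]
  have "f (interval_matroid xs l u) = (\<Sum>i\<in>{0, 1, 2}. a i * f (N i))"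
  proof (rule valuative_sum_eq[OF f])
    show "ground (N i) = ground (interval_matroid xs l u)" for i
      using F by (simp add: N_def ground_interval_matroid)
    show "indicator (base_polytope (interval_matroid xs l u)) x
        = (\<Sum>i\<in>{0, 1, 2}. a i * indicator (base_polytope (N i)) x)" for x
    proof -
      have "(\<Sum>i\<in>{0, 1, 2}. h i) = h 0 + h 1 + h 2" for h :: "nat \<Rightarrow> int" by simp
      then have "(\<Sum>i\<in>{0, 1, 2}. a i * indicator (base_polytope (N i)) x)
        = indicator (base_polytope (interval_matroid xs l (cap k c u))) x
        + indicator (base_polytope (interval_matroid xs (lift k c l) u)) x
        - indicator (base_polytope (interval_matroid xs (lift k c l) (cap k c u))) x"
        by (simp only:) (simp add: N_def a_def)
      also have "\<dots> = indicator (base_polytope (interval_matroid xs l u)) x"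
        unfolding indicator_def base_polytope_cut
        by (cases "x \<in> base_polytope (interval_matroid xs l u)"; cases "mass x (seg xs 0 k)" "real_of_int c" rule: linorder_cases) simp_all
      finally show ?thesis by simp
    qed
  qed simp
  then show ?thesis by (simp add: N_def a_def)
qed

end

section \<open>Speyer's polynomial at minus one\<close>

text \<open>The two identities are proved together, since the product rule mixes them.\<close>
definition speyer_values :: "('a matroid \<Rightarrow> int poly) \<Rightarrow> 'a matroid \<Rightarrow> bool" where
  "speyer_values g M \<longleftrightarrow> (-1) ^ num_components M * poly (g M) (-1) = 1 \<and>
     (-1) ^ num_components M * poly (pderiv (g M)) (-1) = - rank_form M"

lemma valuative_additive_image:
  fixes F :: "'a matroid \<Rightarrow> int poly" and \<phi> :: "int poly \<Rightarrow> int"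
  assumes F: "valuative F" and add: "\<And>p q. \<phi> (p + q) = \<phi> p + \<phi> q"
    and scale: "\<And>a p. \<phi> (of_int a * p) = a * \<phi> p"
  shows "valuative (\<lambda>M. \<phi> (F M))"
  unfolding valuative_iff
proof (intro allI impI)
  fix E :: "'a set" and n M a assume "polytope_relation E n M a"
  then have 0: "(\<Sum>i<n. of_int (a i) * F (M i)) = 0" using F by (auto simp: valuative_iff)
  have "\<phi> 0 = 0" using add[of 0 0] by simp
  then have "\<phi> (\<Sum>i<m. of_int (a i) * F (M i)) = (\<Sum>i<m. a i * \<phi> (F (M i)))" for m
    by (induction m) (simp_all add: add scale)
  then show "(\<Sum>i<n. of_int (a i) * \<phi> (F (M i))) = 0" 
    using 0 \<open>\<phi> 0 = 0\<close> by simp metis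
qed

context
  fixes g :: "'a matroid \<Rightarrow> int poly"
  assumes g: "is_speyer_polynomial g"
begin

lemma valuative_speyer_values:
  "valuative (\<lambda>M. (-1) ^ num_components M * poly (g M) (-1))"
  "valuative (\<lambda>M. (-1) ^ num_components M * poly (pderiv (g M)) (-1))"
proof -
  have cov: "valuative (\<lambda>M. (-1) ^ num_components M * g M)"
    using g by (simp add: is_speyer_polynomial_def covaluative_def)
  have sign: "(-1) ^ n = (of_int ((-1) ^ n) :: int poly)" for n by simp
  have p: "poly (of_int a * q) (-1) = a * poly q (-1)" for a and q :: "int poly" by simp
  have d: "poly (pderiv (of_int a * q)) (-1) = a * poly (pderiv q) (-1)" for a and q :: "int poly"
    by (simp add: of_int_poly pderiv_smult)
  have "valuative (\<lambda>M. poly ((-1) ^ num_components M * g M) (-1))"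
    by (rule valuative_additive_image[OF cov]) (simp_all only: p poly_add)
  then show "valuative (\<lambda>M. (-1) ^ num_components M * poly (g M) (-1))"
    by (simp only: sign p)
  have "valuative (\<lambda>M. poly (pderiv ((-1) ^ num_components M * g M)) (-1))"
    by (rule valuative_additive_image[OF cov, where \<phi> = "\<lambda>q. poly (pderiv q) (-1)"])
      (simp_all only: d pderiv_add poly_add)
  then show "valuative (\<lambda>M. (-1) ^ num_components M * poly (pderiv (g M)) (-1))"
    by (simp only: sign d)
qed

lemma speyer_values_series_parallel:
  assumes "series_parallel M" shows "speyer_values g M"
proof -
  have "g M = [:0, 1:]" using g assms by (simp add: is_speyer_polynomial_def)
  then show ?thesis
    using series_parallel_invariants[OF assms]
    by (simp add: speyer_values_def circuit_connected_num_components pderiv_pCons)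
qed

lemma speyer_values_direct_sum:
  assumes sum: "is_direct_sum M M1 M2" and 1: "speyer_values g M1" and 2: "speyer_values g M2"
  shows "speyer_values g M"
proof -
  have gM: "g M = g M1 * g M2" using g sum by (simp add: is_speyer_polynomial_def)
  define s1 s2 :: int where "s1 = (-1) ^ num_components M1" and "s2 = (-1) ^ num_components M2"
  have s: "(-1) ^ num_components M = s1 * s2"
    by (simp add: num_components_direct_sum[OF sum] s1_def s2_def power_add)
  have *: "s1 * poly (g M1) (-1) = 1" "s2 * poly (g M2) (-1) = 1"
    "s1 * poly (pderiv (g M1)) (-1) = - rank_form M1" "s2 * poly (pderiv (g M2)) (-1) = - rank_form M2"
    using 1 2 by (simp_all add: speyer_values_def s1_def s2_def)
  have "s1 * s2 * poly (g M) (-1) = (s1 * poly (g M1) (-1)) * (s2 * poly (g M2) (-1))"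
    by (simp add: gM)
  then have "s1 * s2 * poly (g M) (-1) = 1" by (simp add: *)
  moreover have "s1 * s2 * poly (pderiv (g M)) (-1)
      = (s1 * poly (g M1) (-1)) * (s2 * poly (pderiv (g M2)) (-1))
      + (s2 * poly (g M2) (-1)) * (s1 * poly (pderiv (g M1)) (-1))"
    by (simp add: gM pderiv_mult algebra_simps)
  then have "s1 * s2 * poly (pderiv (g M)) (-1) = - rank_form M"
    by (simp add: * rank_form_direct_sum[OF sum])
  ultimately show ?thesis by (simp add: speyer_values_def s)
qed

lemma valuative_uminus_rank_form: "valuative (\<lambda>M. - rank_form M)"
  using valuative_rank_form by (simp add: valuative_def sum_negf)

text \<open>Induction on the area between the two paths plus the length: cutting decreases the area, and
  splitting at a contact decreases the length without increasing the area.\<close>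
lemma speyer_values_lattice_path:
  assumes "path_pair xs l u" "no_common_step (length xs) l u" "xs \<noteq> []"
  shows "speyer_values g (interval_matroid xs l u)"
  using assms
proof (induction "nat (\<Sum>j\<le>length xs. u j - l j) + length xs" arbitrary: xs l u rule: less_induct)
  case less
  let ?n = "length xs"
  note pp = less.prems(1) and ncs = less.prems(2)
  have lu: "l j \<le> u j" if "j \<le> ?n" for j using pp that by (simp add: path_pair_def)
  have ends: "l 0 = 0" "u 0 = 0" "l ?n = u ?n" using pp by (auto simp: path_pair_def lattice_path_def)
  consider (cut) k where "k \<le> ?n" "l k + 1 < u k" | (touch) k where "0 < k" "k < ?n" "l k = u k"
    | (snake) "\<And>k. 0 < k \<Longrightarrow> k < ?n \<Longrightarrow> u k = l k + 1"
  proof (cases "(\<exists>k\<le>?n. l k + 1 < u k) \<or> (\<exists>k. 0 < k \<and> k < ?n \<and> l k = u k)")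
    case True then show ?thesis using cut touch by blast
  next
    case False
    have "u k = l k + 1" if "0 < k" "k < ?n" for k
    proof -
      have "\<not> l k + 1 < u k" "l k \<noteq> u k" "l k \<le> u k" using False that lu[of k] by auto
      then show ?thesis by linarith
    qed
    then show ?thesis by (rule snake)
  qed
  then show ?case
  proof cases
    case cut
    let ?c = "l k + 1"
    have c: "l k < ?c" "?c < u k" using cut by auto
    note pps = path_pairs_cut[OF pp cut(1) c] and ncss = no_common_step_cut[OF pp cut(1) c ncs]
    have capped: "cap k ?c u j \<le> u j" "l j \<le> lift k ?c l j" for j
      by (simp_all add: cap_def lift_def)
    have at_k: "cap k ?c u k < u k" "l k < lift k ?c l k" using c by (simp_all add: cap_def lift_def)
    have dec: "nat (\<Sum>j\<le>?n. u' j - l' j) + ?n < nat (\<Sum>j\<le>?n. u j - l j) + ?n"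
      if "path_pair xs l' u'" "\<And>j. u' j \<le> u j" "\<And>j. l j \<le> l' j" "u' k - l' k < u k - l k" for l' u'
    proof -
      have "(\<Sum>j\<le>?n. u' j - l' j) < (\<Sum>j\<le>?n. u j - l j)"
        using that cut(1) by (intro sum_strict_mono_ex1) (auto intro: diff_mono)
      moreover have "0 \<le> (\<Sum>j\<le>?n. u' j - l' j)" using that(1) by (intro sum_nonneg) (simp add: path_pair_def)
      ultimately show ?thesis by simp
    qed
    have vals: "speyer_values g (interval_matroid xs l (cap k ?c u))"
      "speyer_values g (interval_matroid xs (lift k ?c l) u)"
      "speyer_values g (interval_matroid xs (lift k ?c l) (cap k ?c u))"
      using capped at_k pps ncss less.prems(3)
      by (auto intro!: less.hyps dec)
    show ?thesis
      unfolding speyer_values_def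
        valuative_cut[OF pp cut(1) c valuative_speyer_values(1)]
        valuative_cut[OF pp cut(1) c valuative_speyer_values(2)]
        valuative_cut[OF pp cut(1) c valuative_uminus_rank_form]
      using vals by (simp add: speyer_values_def)
  next
    case touch
    define ys zs where "ys = take k xs" and "zs = drop k xs"
    have xs: "xs = ys @ zs" and len: "length ys = k" using touch by (auto simp: ys_def zs_def)
    have lens: "length ys < ?n" "length zs < ?n" "ys \<noteq> []" "zs \<noteq> []" "?n = k + length zs"
      using touch len by (auto simp: ys_def zs_def)
    define l2 u2 where "l2 = (\<lambda>j. l (length ys + j) - l (length ys))" and "u2 = (\<lambda>j. u (length ys + j) - l (length ys))"
    note app = interval_matroid_append[OF pp[unfolded xs], unfolded len, OF touch(3)]
    have pps: "path_pair ys l u" "path_pair zs l2 u2"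
      and dsum: "is_direct_sum (interval_matroid xs l u) (interval_matroid ys l u) (interval_matroid zs l2 u2)"
      using app unfolding xs[symmetric] l2_def u2_def len by auto
    have nonneg: "0 \<le> u j - l j" if "j \<le> ?n" for j using lu[OF that] by simp
    have s1: "(\<Sum>j\<le>length ys. u j - l j) \<le> (\<Sum>j\<le>?n. u j - l j)"
      using nonneg lens by (intro sum_mono2) auto
    have "(\<Sum>j\<le>length zs. u2 j - l2 j) = (\<Sum>j\<in>(+) k ` {..length zs}. u j - l j)"
      by (simp add: sum.reindex l2_def u2_def len)
    also have "\<dots> \<le> (\<Sum>j\<le>?n. u j - l j)"
      using nonneg lens by (intro sum_mono2) auto
    finally have s2: "(\<Sum>j\<le>length zs. u2 j - l2 j) \<le> (\<Sum>j\<le>?n. u j - l j)" .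
    have "no_common_step (length ys) l u"
      using ncs lens by (simp add: no_common_step_def)
    moreover have "no_common_step (length zs) l2 u2"
      unfolding no_common_step_def
    proof (intro allI impI notI)
      fix j assume j: "j < length zs" "l2 j = u2 j \<and> l2 (Suc j) = u2 (Suc j)"
      then have "k + j < ?n" "l (k + j) = u (k + j)" "l (Suc (k + j)) = u (Suc (k + j))"
        using lens by (simp_all add: l2_def u2_def len)
      then show False using ncs by (simp add: no_common_step_def)
    qed
    ultimately have "speyer_values g (interval_matroid ys l u)" "speyer_values g (interval_matroid zs l2 u2)"
      using s1 s2 lens pps by (auto intro!: less.hyps add_le_less_mono nat_mono)
    then show ?thesis by (rule speyer_values_direct_sum[OF dsum])
  next
    case snake
    have "?n \<noteq> 1"
    proof
      assume "?n = 1"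
      then show False using ncs ends by (simp add: no_common_step_def)
    qed
    moreover have "?n \<noteq> 0" using less.prems(3) by simp
    ultimately have "2 \<le> ?n" by linarith
    then have "snake xs l u" using pp snake unfolding snake_def by blast
    then show ?thesis by (intro speyer_values_series_parallel snake_series_parallel)
  qed
qed

lemma speyer_values_no_loops:
  assumes "ground M \<noteq> {}" "\<And>e. \<not> loop M e" "\<And>e. \<not> coloop M e"
  shows "speyer_values g M"
proof -
  have vals: "speyer_values g (interval_matroid xs l u)"
    if *: "feasible xs l u" "set xs = ground M" "{B. basis M B} \<subseteq> path_sets xs l u" for xs l u
  proof -
    obtain l' u' where n: "path_pair xs l' u'" "path_sets xs l' u' = path_sets xs l u"
      "interval_matroid xs l' u' = interval_matroid xs l u"
      by (rule path_pair_normal_form[OF *(1)])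
    have "no_common_step (length xs) l' u'"
      using no_common_step_if_no_loops[OF n(1) *(2)] *(3) assms(2,3) unfolding n(2) by blast
    moreover have "xs \<noteq> []" using *(2) assms(1) by auto
    ultimately have "speyer_values g (interval_matroid xs l' u')" by (rule speyer_values_lattice_path[OF n(1)])
    then show ?thesis by (simp only: n(3))
  qed
  have "(-1) ^ num_components M * poly (g M) (-1) = 1"
    by (rule valuative_eq_if_eq_on_interval_matroids[OF valuative_speyer_values(1) valuative_1])
      (use vals in \<open>simp add: speyer_values_def\<close>)
  moreover have "(-1) ^ num_components M * poly (pderiv (g M)) (-1) = - rank_form M"
    by (rule valuative_eq_if_eq_on_interval_matroids[OF valuative_speyer_values(2) valuative_uminus_rank_form])
      (use vals in \<open>simp add: speyer_values_def\<close>)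
  ultimately show ?thesis by (simp add: speyer_values_def)
qed

end

lemma rank_form_eq_beta_sum:
  "rank_form M = (\<Sum>A\<in>Pow (ground M). (-1) ^ nullity M A * beta M A * int (rk M A))"
  unfolding rank_form_def moebius_form_def
proof (rule sum.cong[OF refl])
  fix A assume "A \<in> Pow (ground M)"
  then have "finite A" using finite_subset[OF _ finite_ground] by auto
  then have "card A = nullity M A + rk M A" using rk_le_card[of A M] by (simp add: nullity_def)
  then have sign: "(-1) ^ nullity M A * (-1) ^ rk M A = (-1 :: int) ^ card A" by (simp add: power_add)
  have "(-1) ^ nullity M A * beta M A * int (rk M A)
      = ((-1) ^ nullity M A * (-1) ^ rk M A) * (\<Sum>B\<in>Pow A. (-1) ^ card B * int (rk M B)) * int (rk M A)"
    by (simp add: beta_def)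
  also have "\<dots> = (\<Sum>B\<in>Pow A. (-1) ^ (card A + card B) * (int (rk M A) * int (rk M B)))"
    unfolding sign by (simp add: sum_distrib_left sum_distrib_right power_add mult_ac)
  finally show "(\<Sum>B\<in>Pow A. (-1) ^ (card A + card B) * (int (rk M A) * int (rk M B)))
      = (-1) ^ nullity M A * beta M A * int (rk M A)" by simp
qed

theorem proposition1p5:
  fixes g :: "'a matroid \<Rightarrow> int poly" and M :: "'a matroid"
  assumes "infinite (UNIV :: 'a set)"
    and "is_speyer_polynomial g"
    and "\<And>e. \<not> loop M e" and "\<And>e. \<not> coloop M e"
  shows "poly (pderiv (g M)) (-1) =
    (-1) ^ (num_components M - 1) *
    (\<Sum>A \<in> Pow (ground M). (-1) ^ nullity M A * beta M A * int (rk M A))"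
proof (cases "ground M = {}")
  case True
  \<comment> \<open>The empty matroid is the direct sum of two copies of itself, so its polynomial is constant.\<close>
  then have "is_direct_sum M M M" using indep_empty[of M] by (simp add: is_direct_sum_def)
  then have "g M = g M * g M" using assms(2) unfolding is_speyer_polynomial_def by blast
  then have "g M = 0 \<or> g M = 1" by simp
  then have "pderiv (g M) = 0" by (auto simp: pderiv_1)
  then show ?thesis using True by simp
next
  case False
  have "speyer_values g M" by (rule speyer_values_no_loops[OF assms(2) False assms(3,4)])
  then have eq: "(-1) ^ num_components M * poly (pderiv (g M)) (-1) = - rank_form M"
    by (simp add: speyer_values_def)
  have "finite (ground M // connected_rel M)" "ground M // connected_rel M \<noteq> {}"
    using False finite_ground[of M] by (auto simp: quotient_def)
  then have "0 < num_components M" by (simp add: num_components_def card_gt_0_iff)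
  then obtain n where n: "num_components M = Suc n" using gr0_implies_Suc by blast
  have "(-1) ^ n * (-1) ^ n = (1 :: int)" by (simp flip: power_add mult_2)
  moreover have "(-1) ^ n * poly (pderiv (g M)) (-1) = rank_form M" using eq by (simp add: n)
  ultimately have "poly (pderiv (g M)) (-1) = (-1) ^ n * rank_form M"
    by (metis mult.assoc mult_1)
  then show ?thesis by (simp add: n rank_form_eq_beta_sum)
qed

end
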